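(* There is an algorithm (a segmented version of the sieve of Eratosthenes) which, given an integer $x \ge 3$, produces the complete prime factorization of every positive integer $n \le x$ using at most $O(x \log\log x)$ arithmetic operations and at most $O(\sqrt{x}/\log\log x)$ bits of working space, where the implied constants are absolute.
   Context: Model of computation: time is measured as the number of arithmetic (and bitwise/shift) operations on integers of $O(\log x)$ bits; space is measured in bits of working memory. The output (the factorizations) is not counted toward the space bound: it may be streamed out or consumed as it is generated, so the algorithm need not store the factorizations of all $n \le x$ simultaneously. The complete prime factorization of $n$ means the list of the distinct primes dividing $n$ together with their exponents. *)

theory Defs
  imports "HOL-Computational_Algebra.Primes" Complex_Main
begin

text \<open>Programs are finite lists of instructions over registers (indexed by nat) and a
 zero-initialised random-access memory (indexed by nat). Each executed instruction is one
 operation (arithmetic, bitwise, shift, comparison, load/store, jump, output). All values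
 must fit into words of w bits (absolute value below 2 to the w); otherwise the machine
 faults. Output is written to a write-only stream, not counted toward space.\<close>

datatype aop = Add | Sub | Mul | Div | Mod | BAnd | BOr | BXor | ShiftL | ShiftR | Less | Eq

datatype instr =
    LoadConst nat int
  | Arith aop nat nat nat
  | Load nat nat
  | Store nat nat
  | JumpZero nat nat
  | Jump nat
  | Output nat
  | Halt

record state =
  pc :: nat
  regs :: "nat \<Rightarrow> int"
  mem :: "nat \<Rightarrow> int"
  out :: "int list"
  mem_used :: nat   \<comment> \<open>1 + largest memory address accessed so far (0 if none)\<close>
  halted :: bool

definition in_word :: "nat \<Rightarrow> int \<Rightarrow> bool" where
  "in_word w v \<longleftrightarrow> - (2 ^ w) \<le> v \<and> v < 2 ^ w"

fun eval_aop :: "aop \<Rightarrow> int \<Rightarrow> int \<Rightarrow> int option" where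
  "eval_aop Add a b = Some (a + b)"
| "eval_aop Sub a b = Some (a - b)"
| "eval_aop Mul a b = Some (a * b)"
| "eval_aop Div a b = (if b = 0 then None else Some (a div b))"
| "eval_aop Mod a b = (if b = 0 then None else Some (a mod b))"
| "eval_aop BAnd a b = Some (and a b)"
| "eval_aop BOr a b = Some (or a b)"
| "eval_aop BXor a b = Some (xor a b)"
| "eval_aop ShiftL a b = (if b < 0 then None else Some (push_bit (nat b) a))"
| "eval_aop ShiftR a b = (if b < 0 then None else Some (drop_bit (nat b) a))"
| "eval_aop Less a b = Some (if a < b then 1 else 0)"
| "eval_aop Eq a b = Some (if a = b then 1 else 0)"

definition set_reg :: "nat \<Rightarrow> nat \<Rightarrow> int \<Rightarrow> state \<Rightarrow> state option" where
  "set_reg w r v s = (if in_word w v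
      then Some (s\<lparr>regs := (regs s)(r := v), pc := Suc (pc s)\<rparr>) else None)"

definition step :: "nat \<Rightarrow> instr list \<Rightarrow> state \<Rightarrow> state option" where
  "step w P s =
    (if halted s then Some s
     else if pc s \<ge> length P then None
     else (case P ! pc s of
        LoadConst r c \<Rightarrow> set_reg w r c s
      | Arith op r1 r2 r3 \<Rightarrow>
          (case eval_aop op (regs s r2) (regs s r3) of
             None \<Rightarrow> None
           | Some v \<Rightarrow> set_reg w r1 v s)
      | Load r1 r2 \<Rightarrow>
          (if regs s r2 < 0 then None
           else let a = nat (regs s r2) in
             map_option (\<lambda>s'. s'\<lparr>mem_used := max (mem_used s) (Suc a)\<rparr>)
               (set_reg w r1 (mem s a) s))
      | Store r1 r2 \<Rightarrow>
          (if regs s r1 < 0 then None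
           else let a = nat (regs s r1) in
             Some (s\<lparr>mem := (mem s)(a := regs s r2),
                     mem_used := max (mem_used s) (Suc a), pc := Suc (pc s)\<rparr>))
      | JumpZero r t \<Rightarrow> Some (s\<lparr>pc := (if regs s r = 0 then t else Suc (pc s))\<rparr>)
      | Jump t \<Rightarrow> Some (s\<lparr>pc := t\<rparr>)
      | Output r \<Rightarrow> Some (s\<lparr>out := out s @ [regs s r], pc := Suc (pc s)\<rparr>)
      | Halt \<Rightarrow> Some (s\<lparr>halted := True\<rparr>)))"

text \<open>Run for t steps (the Halt instruction itself counts as a step).\<close>
fun run :: "nat \<Rightarrow> instr list \<Rightarrow> nat \<Rightarrow> state \<Rightarrow> state option" where
  "run w P 0 s = Some s"
| "run w P (Suc t) s = (case step w P s of None \<Rightarrow> None | Some s' \<Rightarrow> run w P t s')"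

definition init_state :: "nat \<Rightarrow> state" where
  "init_state x = \<lparr>pc = 0, regs = (\<lambda>_. 0)(0 := int x), mem = (\<lambda>_. 0), out = [],
                   mem_used = 0, halted = False\<rparr>"

fun instr_regs :: "instr \<Rightarrow> nat list" where
  "instr_regs (LoadConst r c) = [r]"
| "instr_regs (Arith op r1 r2 r3) = [r1, r2, r3]"
| "instr_regs (Load r1 r2) = [r1, r2]"
| "instr_regs (Store r1 r2) = [r1, r2]"
| "instr_regs (JumpZero r t) = [r]"
| "instr_regs (Jump t) = []"
| "instr_regs (Output r) = [r]"
| "instr_regs Halt = []"

text \<open>Number of registers used by the program (register 0 always holds the input).\<close>
definition num_regs :: "instr list \<Rightarrow> nat" where
  "num_regs P = Suc (Max (insert 0 (set (concat (map instr_regs P)))))"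

text \<open>Working space in bits: all registers and the memory prefix M[0..mem_used-1]
 are charged w bits each. mem_used is monotone, so at the final state this is the peak.\<close>
definition space_bits :: "nat \<Rightarrow> instr list \<Rightarrow> state \<Rightarrow> nat" where
  "space_bits w P s = w * (num_regs P + mem_used s)"

definition word_size :: "nat \<Rightarrow> nat \<Rightarrow> nat" where
  "word_size cw x = cw * nat \<lceil>log 2 (real x)\<rceil>"

definition enc_block :: "nat \<times> (nat \<times> nat) list \<Rightarrow> int list" where
  "enc_block b = (case b of (n, ps) \<Rightarrow>
     [int n, int (length ps)] @ concat (map (\<lambda>(p, e). [int p, int e]) ps))"

definition is_factorization :: "nat \<Rightarrow> (nat \<times> nat) list \<Rightarrow> bool" where
  "is_factorization n ps \<longleftrightarrow> distinct (map fst ps) \<and>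
      set ps = {(p, multiplicity p n) | p. p \<in> prime_factors n}"

definition outputs_factorizations :: "nat \<Rightarrow> int list \<Rightarrow> bool" where
  "outputs_factorizations x ostream \<longleftrightarrow>
     (\<exists>bs. ostream = concat (map enc_block bs) \<and>
           mset (map fst bs) = mset [1..<Suc x] \<and>
           (\<forall>(n, ps) \<in> set bs. is_factorization n ps))"

end

theory Submission
  imports Defs
begin

text \<open>Let \<open>y\<close> be the integer square root of \<open>x\<close>, \<open>L\<close> the bit length of \<open>x\<close> and \<open>l\<close> the bit length
  of \<open>L\<close>, so that \<open>l\<close> is of order \<open>ln (ln x)\<close>. The primes up to \<open>y\<close> are found by trial division,
  which costs at most \<open>y\<^sup>2 \<le> x\<close> steps, and are kept as prime gaps of about \<open>l\<close> bits, many to a word.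
  Then \<open>[1, x]\<close> is sieved in segments of about \<open>y / (L * l)\<close> numbers, and every number of the
  segment collects its prime divisors up to \<open>y\<close>. This list fits into two words because the product
  of the distinct primes dividing \<open>n\<close> is at most \<open>n\<close>. What remains of \<open>n\<close> after dividing these
  primes out is \<open>1\<close> or a prime, since \<open>n < (y + 1)\<^sup>2\<close>.

  There are \<open>O(y / L)\<close> primes up to \<open>y\<close> and at most \<open>x / y * L * l + 1\<close> segments, so walking through
  the prime list once per segment costs \<open>O(x * l)\<close>; marking the multiples and printing the
  factorizations costs \<open>x\<close> times the sum of the reciprocals of the primes up to \<open>x\<close>, again
  \<open>O(x * l)\<close>. Both prime number estimates follow from the fact that the product of the primes
  between \<open>n\<close> and \<open>2 * n\<close> divides the central binomial coefficient, summed over dyadic intervals.\<close>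

subsection \<open>A structured language and its weakest preconditions\<close>

text \<open>The space bound counts bits, so with words of order \<open>L\<close> bits only about
  \<open>y / (L * l)\<close> words are available. Up to constants this fixes the segment length:
  longer segments break the space bound, and shorter ones cause so many passes over the
  \<open>y / L\<close> primes that the time bound breaks. A prime list with one word per prime takes
  \<open>y / L\<close> words, too many by a factor \<open>l\<close>. In fields of
  \<open>l + 2\<close> bits it takes about \<open>y * l / L ^ 2\<close> words, which is affordable
  because \<open>l ^ 2\<close> is at most of order \<open>L\<close>. Such short fields force a bound
  on the gaps, here \<open>G = 2 ^ l\<close>; since \<open>G > L\<close>, breaking longer gaps adds
  at most \<open>y / L\<close> entries, no more in order of magnitude than there are primes. A cell
  can afford only a constant number of words, hence neither exponents nor fields of fixed width: the
  fields vary in width, and the exponents are recovered by division when a number is printed.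
  Absence of overflow, time and space are proved together with correctness, in a small structured
  language whose assertions see the clock and the memory mark.\<close>

datatype com = Basic instr | Seq com com (infixr ";;" 60) | Cond nat com com | Loop com nat com

fun clen :: "com \<Rightarrow> nat" where
  "clen (Basic i) = 1"
| "clen (a ;; b) = clen a + clen b"
| "clen (Cond r a b) = clen a + clen b + 2"
| "clen (Loop c r b) = clen c + clen b + 2"

text \<open>Jump targets are absolute, so the address of the first instruction is a parameter. In
  \<open>Loop c r b\<close> the code \<open>c\<close> computes the test register \<open>r\<close>,
  and the loop is left when \<open>r\<close> is 0.\<close>

fun compile :: "nat \<Rightarrow> com \<Rightarrow> instr list" where
  "compile o' (Basic i) = [i]"
| "compile o' (a ;; b) = compile o' a @ compile (o' + clen a) b"
| "compile o' (Cond r a b) = JumpZero r (o' + clen a + 2) # compile (o' + 1) a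
     @ Jump (o' + clen a + clen b + 2) # compile (o' + clen a + 2) b"
| "compile o' (Loop c r b) = compile o' c @ JumpZero r (o' + clen c + clen b + 2)
     # compile (o' + clen c + 1) b @ [Jump o']"

lemma length_comp [simp]: "length (compile k c) = clen c"
  by (induction c arbitrary: k) auto

type_synonym assn = "(nat \<Rightarrow> int) \<Rightarrow> (nat \<Rightarrow> int) \<Rightarrow> int list \<Rightarrow> nat \<Rightarrow> nat \<Rightarrow> bool"

text \<open>The last two arguments of an assertion are the value of \<open>mem_used\<close> and the number of steps
  executed so far, so that resource bounds are ordinary parts of pre- and postconditions.\<close>

fun wp_instr :: "nat \<Rightarrow> instr \<Rightarrow> assn \<Rightarrow> assn" where
  "wp_instr w (LoadConst r c) Q R M os U T \<longleftrightarrow> in_word w c \<and> Q (R(r := c)) M os U (Suc T)"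
| "wp_instr w (Arith op r r2 r3) Q R M os U T \<longleftrightarrow>
     (case eval_aop op (R r2) (R r3) of None \<Rightarrow> False
      | Some v \<Rightarrow> in_word w v \<and> Q (R(r := v)) M os U (Suc T))"
| "wp_instr w (Load r r2) Q R M os U T \<longleftrightarrow>
     0 \<le> R r2 \<and> in_word w (M (nat (R r2))) \<and>
     Q (R(r := M (nat (R r2)))) M os (max U (Suc (nat (R r2)))) (Suc T)"
| "wp_instr w (Store r r2) Q R M os U T \<longleftrightarrow>
     0 \<le> R r \<and> Q R (M(nat (R r) := R r2)) os (max U (Suc (nat (R r)))) (Suc T)"
| "wp_instr w (Output r) Q R M os U T \<longleftrightarrow> Q R M (os @ [R r]) U (Suc T)"
| "wp_instr w _ Q R M os U T \<longleftrightarrow> False"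

text \<open>The loop clause asks for an invariant indexed by a variant \<open>n\<close> that drops
  in every round, so termination is included. The increments of \<open>T\<close> in these clauses
  pay for jumps: a conditional executes two of them in the nonzero branch and one in the
  other.\<close>

fun wp :: "nat \<Rightarrow> com \<Rightarrow> assn \<Rightarrow> assn" where
  "wp w (Basic i) Q = wp_instr w i Q"
| "wp w (a ;; b) Q = wp w a (wp w b Q)"
| "wp w (Cond r a b) Q = (\<lambda>R M os U T. if R r = 0 then wp w b Q R M os U (Suc T)
     else wp w a (\<lambda>R M os U T. Q R M os U (Suc T)) R M os U (Suc T))"
| "wp w (Loop c r b) Q = (\<lambda>R M os U T. \<exists>I n. I n R M os U T \<and>
     (\<forall>n R M os U T. I n R M os U T \<longrightarrow>
        wp w c (\<lambda>R M os U T. if R r = 0 then Q R M os U (Suc T)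
          else wp w b (\<lambda>R M os U T. \<exists>m<(n::nat). I m R M os U (Suc T)) R M os U (Suc T)) R M os U T))"

lemma wp_instr_mono:
  assumes "wp_instr w i Q R M os U T" "\<And>R M os U T. Q R M os U T \<Longrightarrow> Q' R M os U T"
  shows "wp_instr w i Q' R M os U T"
  using assms by (cases i) (auto split: option.splits)

lemma wp_mono:
  "wp w c Q R M os U T \<Longrightarrow> (\<And>R M os U T. Q R M os U T \<Longrightarrow> Q' R M os U T) \<Longrightarrow> wp w c Q' R M os U T"
proof (induction c arbitrary: Q Q' R M os U T)
  case (Basic i)
  then show ?case using wp_instr_mono by auto
next
  case (Seq a b)
  have "wp w a (wp w b Q) R M os U T" using Seq.prems(1) by simp
  then have "wp w a (wp w b Q') R M os U T"
    by (rule Seq.IH(1)) (rule Seq.IH(2)[OF _ Seq.prems(2)])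
  then show ?case by simp
next
  case (Cond r a b)
  show ?case
  proof (cases "R r = 0")
    case True
    then have "wp w b Q R M os U (Suc T)" using Cond.prems(1) by simp
    then have "wp w b Q' R M os U (Suc T)" by (rule Cond.IH(2)) (rule Cond.prems(2))
    then show ?thesis using True by simp
  next
    case False
    then have "wp w a (\<lambda>R M os U T. Q R M os U (Suc T)) R M os U (Suc T)" using Cond.prems(1) by simp
    then have "wp w a (\<lambda>R M os U T. Q' R M os U (Suc T)) R M os U (Suc T)"
      by (rule Cond.IH(1)) (rule Cond.prems(2))
    then show ?thesis using False by simp
  qed
next
  case (Loop c r b)
  from Loop.prems(1) obtain I n where I: "I n R M os U T" and step: "\<And>n R M os U T. I n R M os U T \<Longrightarrow>
        wp w c (\<lambda>R M os U T. if R r = 0 then Q R M os U (Suc T)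
          else wp w b (\<lambda>R M os U T. \<exists>m<(n::nat). I m R M os U (Suc T)) R M os U (Suc T)) R M os U T"
    unfolding wp.simps by blast
  show ?case unfolding wp.simps
    apply (rule exI[of _ I], rule exI[of _ n], rule conjI, rule I)
    apply (intro allI impI)
    apply (drule step)
    apply (rule Loop.IH(1), assumption)
    using Loop.prems(2) by (simp split: if_splits)
qed

lemma run_add: "run w P (a + b) s = Option.bind (run w P a s) (run w P b)"
  by (induction a arbitrary: s) (auto split: option.splits)

lemma run_one: "run w P (Suc 0) s = step w P s"
  by (simp split: option.splits)

definition reaches :: "nat \<Rightarrow> instr list \<Rightarrow> nat \<Rightarrow> (nat \<Rightarrow> int) \<Rightarrow> (nat \<Rightarrow> int) \<Rightarrow> int list \<Rightarrow> nat \<Rightarrow> nat \<Rightarrow>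
    nat \<Rightarrow> assn \<Rightarrow> bool" where
  "reaches w P k R M os U T k' Q \<longleftrightarrow> (\<exists>t R' M' os' U'.
     run w P t \<lparr>pc = k, regs = R, mem = M, out = os, mem_used = U, halted = False\<rparr> =
       Some \<lparr>pc = k', regs = R', mem = M', out = os', mem_used = U', halted = False\<rparr> \<and>
     Q R' M' os' U' (T + t))"

lemma reaches_trans:
  assumes "reaches w P k R M os U T k' Q"
    and "\<And>R M os U T. Q R M os U T \<Longrightarrow> reaches w P k' R M os U T k'' Q'"
  shows "reaches w P k R M os U T k'' Q'"
proof -
  from assms(1) obtain t R' M' os' U' where 1: "run w P t \<lparr>pc = k, regs = R, mem = M, out = os, mem_used = U, halted = False\<rparr> =
       Some \<lparr>pc = k', regs = R', mem = M', out = os', mem_used = U', halted = False\<rparr>" "Q R' M' os' U' (T + t)"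
    unfolding reaches_def by blast
  from assms(2)[OF 1(2)] obtain t2 R2 M2 os2 U2 where 2: "run w P t2 \<lparr>pc = k', regs = R', mem = M', out = os', mem_used = U', halted = False\<rparr> =
       Some \<lparr>pc = k'', regs = R2, mem = M2, out = os2, mem_used = U2, halted = False\<rparr>" "Q' R2 M2 os2 U2 (T + t + t2)"
    unfolding reaches_def by blast
  show ?thesis unfolding reaches_def
    by (rule exI[of _ "t + t2"]) (use 1 2 in \<open>auto simp: run_add add.assoc\<close>)
qed

lemma reaches_step:
  assumes "step w P \<lparr>pc = k, regs = R, mem = M, out = os, mem_used = U, halted = False\<rparr> =
       Some \<lparr>pc = k', regs = R', mem = M', out = os', mem_used = U', halted = False\<rparr>"
    and "Q R' M' os' U' (Suc T)"
  shows "reaches w P k R M os U T k' Q"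
  unfolding reaches_def by (rule exI[of _ "Suc 0"]) (use assms in \<open>auto simp only: run_one\<close>, auto)

lemma nth_at: "P = pre @ i # post \<Longrightarrow> length pre = k \<Longrightarrow> P ! k = i \<and> k < length P"
  by auto

text \<open>The code sits between arbitrary \<open>pre\<close> and \<open>post\<close>, so that the
  induction hypotheses apply to fragments in place, where their absolute jump targets are right. The
  loop case needs a second induction, on the variant.\<close>

lemma wp_sound:
  "wp w c Q R M os U T \<Longrightarrow> P = pre @ compile k c @ post \<Longrightarrow> length pre = k \<Longrightarrow>
     reaches w P k R M os U T (k + clen c) Q"
proof (induction c arbitrary: Q R M os U T pre post k)
  case (Basic i)
  have P: "P ! k = i" "k < length P"
    using nth_at[of P pre i post k] Basic.prems by auto
  show ?case
  proof (cases i)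
    case (Arith op r1 r2 r3)
    then obtain v where "eval_aop op (R r2) (R r3) = Some v" "in_word w v" "Q (R(r1 := v)) M os U (Suc T)"
      using Basic.prems(1) by (auto split: option.splits)
    then show ?thesis using P Arith
      by (intro reaches_step[where R' = "R(r1 := v)" and M' = M and os' = os and U' = U])
        (auto simp: step_def set_reg_def fun_upd_def)
  next
    case (LoadConst r1 v)
    then show ?thesis using P Basic.prems(1)
      by (intro reaches_step[where R' = "R(r1 := v)" and M' = M and os' = os and U' = U])
        (auto simp: step_def set_reg_def fun_upd_def)
  next
    case (Load r1 r2)
    then show ?thesis using P Basic.prems(1)
      by (intro reaches_step[where R' = "R(r1 := M (nat (R r2)))" and M' = M and os' = os
              and U' = "max U (Suc (nat (R r2)))"])
        (auto simp: step_def set_reg_def Let_def fun_upd_def)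
  next
    case (Store r1 r2)
    then show ?thesis using P Basic.prems(1)
      by (intro reaches_step[where R' = R and M' = "M(nat (R r1) := R r2)" and os' = os
              and U' = "max U (Suc (nat (R r1)))"])
        (auto simp: step_def set_reg_def Let_def fun_upd_def)
  next
    case (Output r1)
    then show ?thesis using P Basic.prems(1)
      by (intro reaches_step[where R' = R and M' = M and os' = "os @ [R r1]" and U' = U])
        (auto simp: step_def)
  qed (use Basic.prems(1) in auto)
next
  case (Seq a b)
  show ?case
  proof (rule reaches_trans)
    show "reaches w P k R M os U T (k + clen a) (wp w b Q)"
      using Seq.prems by (intro Seq.IH(1)) auto
    fix R M os U T assume "wp w b Q R M os U T"
    from Seq.IH(2)[OF this, where pre = "pre @ compile k a" and post = post and k = "k + clen a"]
    show "reaches w P (k + clen a) R M os U T (k + clen (a ;; b)) Q"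
      using Seq.prems by (simp add: add.assoc)
  qed
next
  case (Cond r a b)
  have P: "P ! k = JumpZero r (k + clen a + 2)" "k < length P"
    using nth_at[of P pre _ _ k] Cond.prems by auto
  have P2: "P ! (k + clen a + 1) = Jump (k + clen a + clen b + 2) \<and> k + clen a + 1 < length P"
    by (rule nth_at[of P "pre @ JumpZero r (k + clen a + 2) # compile (k+1) a"]) (use Cond.prems in auto)
  show ?case
  proof (cases "R r = 0")
    case True
    show ?thesis
    proof (rule reaches_trans)
      show "reaches w P k R M os U T (k + clen a + 2) (\<lambda>R M os U T. wp w b Q R M os U T)"
        by (rule reaches_step) (use P True Cond.prems in \<open>auto simp: step_def\<close>)
      fix R M os U T assume "wp w b Q R M os U T"
      from Cond.IH(2)[OF this, where pre = "pre @ JumpZero r (k + clen a + 2) # compile (k+1) a @ [Jump (k + clen a + clen b + 2)]" and post = post and k = "k + clen a + 2"]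
      show "reaches w P (k + clen a + 2) R M os U T (k + clen (Cond r a b)) Q"
        using Cond.prems by (simp add: add.assoc add.commute add.left_commute)
    qed
  next
    case False
    show ?thesis
    proof (rule reaches_trans)
      show "reaches w P k R M os U T (k + 1) (wp w a (\<lambda>R M os U T. Q R M os U (Suc T)))"
        by (rule reaches_step) (use P False Cond.prems in \<open>auto simp: step_def\<close>)
      fix R M os U T assume A: "wp w a (\<lambda>R M os U T. Q R M os U (Suc T)) R M os U T"
      show "reaches w P (k + 1) R M os U T (k + clen (Cond r a b)) Q"
      proof (rule reaches_trans)
        show "reaches w P (k + 1) R M os U T (k + 1 + clen a) (\<lambda>R M os U T. Q R M os U (Suc T))"
          by (rule Cond.IH(1)[OF A, where pre = "pre @ [JumpZero r (k + clen a + 2)]"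
              and post = "Jump (k + clen a + clen b + 2) # compile (k + clen a + 2) b @ post"]) (use Cond.prems in auto)
        fix R M os U T assume "Q R M os U (Suc T)"
        then show "reaches w P (k + 1 + clen a) R M os U T (k + clen (Cond r a b)) Q"
          by (intro reaches_step[where w = w and P = P]) (use P2 in \<open>auto simp: step_def add.assoc add.commute add.left_commute\<close>)
      qed
    qed
  qed
next
  case (Loop c r b)
  from Loop.prems(1) obtain I n where I: "I n R M os U T" and step: "\<And>n R M os U T. I n R M os U T \<Longrightarrow>
        wp w c (\<lambda>R M os U T. if R r = 0 then Q R M os U (Suc T)
          else wp w b (\<lambda>R M os U T. \<exists>m<(n::nat). I m R M os U (Suc T)) R M os U (Suc T)) R M os U T"
    unfolding wp.simps by blast
  have P: "P ! (k + clen c) = JumpZero r (k + clen c + clen b + 2) \<and> k + clen c < length P"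
    by (rule nth_at[of P "pre @ compile k c"]) (use Loop.prems in auto)
  have P2: "P ! (k + clen c + 1 + clen b) = Jump k \<and> k + clen c + 1 + clen b < length P"
    by (rule nth_at[of P "pre @ compile k c @ JumpZero r (k + clen c + clen b + 2) # compile (k + clen c + 1) b"])
      (use Loop.prems in auto)
  from I show ?case
  proof (induction n arbitrary: R M os U T rule: less_induct)
    case (less n)
    show ?case
    proof (rule reaches_trans)
      show "reaches w P k R M os U T (k + clen c) (\<lambda>R M os U T. if R r = 0 then Q R M os U (Suc T)
          else wp w b (\<lambda>R M os U T. \<exists>m<(n::nat). I m R M os U (Suc T)) R M os U (Suc T))"
        by (rule Loop.IH(1)[OF step[OF less.prems], where pre = pre and post = "JumpZero r (k + clen c + clen b + 2) # compile (k + clen c + 1) b @ [Jump k] @ post"])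
          (use Loop.prems in auto)
      fix R M os U T assume A: "if R r = 0 then Q R M os U (Suc T)
          else wp w b (\<lambda>R M os U T. \<exists>m<(n::nat). I m R M os U (Suc T)) R M os U (Suc T)"
      show "reaches w P (k + clen c) R M os U T (k + clen (Loop c r b)) Q"
      proof (cases "R r = 0")
        case True
        then show ?thesis using A
          by (intro reaches_step[where w = w and P = P]) (use P in \<open>auto simp: step_def\<close>)
      next
        case False
        show ?thesis
        proof (rule reaches_trans)
          show "reaches w P (k + clen c) R M os U T (k + clen c + 1)
            (wp w b (\<lambda>R M os U T. \<exists>m<(n::nat). I m R M os U (Suc T)))"
            by (rule reaches_step) (use P A False in \<open>auto simp: step_def\<close>)
          fix R M os U T assume B: "wp w b (\<lambda>R M os U T. \<exists>m<(n::nat). I m R M os U (Suc T)) R M os U T"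
          show "reaches w P (k + clen c + 1) R M os U T (k + clen (Loop c r b)) Q"
          proof (rule reaches_trans)
            show "reaches w P (k + clen c + 1) R M os U T (k + clen c + 1 + clen b)
              (\<lambda>R M os U T. \<exists>m<(n::nat). I m R M os U (Suc T))"
              by (rule Loop.IH(2)[OF B, where pre = "pre @ compile k c @ [JumpZero r (k + clen c + clen b + 2)]" and post = "Jump k # post"])
                (use Loop.prems in auto)
            fix R M os U T assume "\<exists>m<(n::nat). I m R M os U (Suc T)"
            then obtain m where m: "m < n" "I m R M os U (Suc T)" by blast
            show "reaches w P (k + clen c + 1 + clen b) R M os U T (k + clen (Loop c r b)) Q"
            proof (rule reaches_trans)
              show "reaches w P (k + clen c + 1 + clen b) R M os U T k (I m)"
                by (rule reaches_step) (use P2 m in \<open>auto simp: step_def\<close>)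
              show "\<And>R M os U T. I m R M os U T \<Longrightarrow> reaches w P k R M os U T (k + clen (Loop c r b)) Q"
                using less.IH[OF m(1)] .
            qed
          qed
        qed
      qed
    qed
  qed
qed

text \<open>\<open>Halt\<close> counts as a step, and the assertion is reached one step earlier:
  hence \<open>t - 1\<close>.\<close>

lemma wp_halt:
  assumes "wp w c Q ((\<lambda>_. 0)(0 := int x)) (\<lambda>_. 0) [] 0 0"
  shows "\<exists>t s. run w (compile 0 c @ [Halt]) t (init_state x) = Some s \<and> halted s \<and>
     Q (regs s) (mem s) (out s) (mem_used s) (t - 1)"
proof -
  from wp_sound[OF assms, of "compile 0 c @ [Halt]" "[]" 0 "[Halt]"]
  obtain t R' M' os' U' where 1: "run w (compile 0 c @ [Halt]) t (init_state x) =
      Some \<lparr>pc = clen c, regs = R', mem = M', out = os', mem_used = U', halted = False\<rparr>" "Q R' M' os' U' t"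
    unfolding reaches_def init_state_def by auto
  have "run w (compile 0 c @ [Halt]) (t + Suc 0) (init_state x) =
      Some \<lparr>pc = clen c, regs = R', mem = M', out = os', mem_used = U', halted = True\<rparr>"
    unfolding run_add 1 by (simp add: run_one step_def nth_append del: run.simps)
  then show ?thesis using 1(2) by (intro exI conjI) (assumption, auto)
qed

text \<open>For loops whose number \<open>N\<close> of rounds is known beforehand. The invariant
  counts the rounds upwards, so the variant required by \<open>wp\<close> is
  \<open>N - k\<close>.\<close>

lemma wp_for:
  assumes "I 0 R M os U T"
    and "\<And>k R M os U T. k < N \<Longrightarrow> I k R M os U T \<Longrightarrow>
      wp w c (\<lambda>R M os U T. R r \<noteq> 0 \<and> wp w b (\<lambda>R M os U T. I (Suc k) R M os U (Suc T)) R M os U (Suc T)) R M os U T"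
    and "\<And>R M os U T. I N R M os U T \<Longrightarrow> wp w c (\<lambda>R M os U T. R r = 0 \<and> Q R M os U (Suc T)) R M os U T"
  shows "wp w (Loop c r b) Q R M os U T"
  unfolding wp.simps
proof (rule exI[of _ "\<lambda>n R M os U T. n \<le> N \<and> I (N - n) R M os U T"], rule exI[of _ N], intro conjI allI impI)
  fix n R M os U T assume A: "n \<le> N \<and> I (N - n) R M os U T"
  show "wp w c (\<lambda>R M os U T. if R r = 0 then Q R M os U (Suc T)
          else wp w b (\<lambda>R M os U T. \<exists>m<n. m \<le> N \<and> I (N - m) R M os U (Suc T)) R M os U (Suc T)) R M os U T"
  proof (cases "n = 0")
    case True
    then show ?thesis using A by (auto intro: wp_mono[OF assms(3)])
  next
    case False
    then have k: "N - n < N" using A by auto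
    show ?thesis
      apply (rule wp_mono[OF assms(2)[OF k conjunct2[OF A]]])
      apply simp
      apply (erule conjE)
      apply (erule wp_mono)
      apply (rule exI[of _ "n - 1"])
      using False A by (auto simp: Suc_diff_le)
  qed
qed (use assms(1) in auto)

subsection \<open>Prime number estimates\<close>

lemma prime_dvd_central_binomial:
  assumes "prime p" "n < p" "p \<le> 2 * n"
  shows "p dvd (2 * n) choose n"
proof -
  have "fact n * fact n * ((2 * n) choose n) = (fact (2 * n) :: nat)"
    using binomial_fact_lemma[of n "2 * n"] by simp
  moreover have "p dvd fact (2 * n)" using assms by (simp add: prime_dvd_fact_iff)
  ultimately have "p dvd fact n * fact n * ((2 * n) choose n)" by simp
  moreover have "\<not> p dvd fact n" using assms by (simp add: prime_dvd_fact_iff)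
  ultimately show ?thesis using assms(1) by (simp add: prime_dvd_mult_iff)
qed

lemma prod_primes_dvd:
  fixes n :: nat
  assumes "finite S" "\<And>p. p \<in> S \<Longrightarrow> prime p" "\<And>p. p \<in> S \<Longrightarrow> p dvd n"
  shows "\<Prod>S dvd n"
  using assms
proof (induction S rule: finite_induct)
  case (insert p S)
  have "coprime p (\<Prod>S)"
    by (rule prod_coprime_right) (use insert in \<open>auto intro!: primes_coprime\<close>)
  then show ?case using insert by (auto intro: divides_mult)
qed simp

text \<open>Each of these primes exceeds \<open>2 ^ k\<close>, while their product divides a
  binomial coefficient of size at most \<open>2 ^ (2 * 2 ^ k)\<close>; comparing exponents gives the
  bound.\<close>

lemma card_primes_dyadic:
  "k * card {p::nat. prime p \<and> 2 ^ k < p \<and> p \<le> 2 ^ Suc k} \<le> 2 ^ Suc k"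
proof -
  define n :: nat where "n = 2 ^ k"
  define S where "S = {p::nat. prime p \<and> n < p \<and> p \<le> 2 * n}"
  have fin: "finite S" by (rule finite_subset[of _ "{..2*n}"]) (auto simp: S_def)
  have "\<Prod>S dvd (2 * n) choose n"
    using fin by (intro prod_primes_dvd) (auto simp: S_def intro: prime_dvd_central_binomial)
  then have "\<Prod>S \<le> (2 * n) choose n" by (rule dvd_imp_le) simp
  also have "\<dots> \<le> 2 ^ (2 * n)" by (rule binomial_le_pow2)
  finally have "\<Prod>S \<le> 2 ^ (2 * n)" .
  moreover have "n ^ card S \<le> \<Prod>S"
    using prod_mono[of S "\<lambda>_. n" "\<lambda>p. p"] by (auto simp: S_def)
  ultimately have "(2::nat) ^ (k * card S) \<le> 2 ^ (2 * n)"
    by (simp add: n_def power_mult)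
  then have "k * card S \<le> 2 * n" by (subst (asm) power_increasing_iff) auto
  then show ?thesis by (simp add: S_def n_def)
qed

lemma finite_primes_le [simp]: "finite {p::nat. prime p \<and> p \<le> n}"
  by (rule finite_subset[of _ "{..n}"]) auto

lemma primes_le_Suc_dyadic:
  "{p::nat. prime p \<and> p \<le> 2 ^ Suc m} = {p. prime p \<and> p \<le> 2 ^ m} \<union> {p. prime p \<and> 2 ^ m < p \<and> p \<le> 2 ^ Suc m}"
  by (auto intro: order_trans)

text \<open>With a constant \<open>c\<close> in place of 6, and \<open>m + 1\<close> at most
  \<open>3 * m / 2\<close> for \<open>m\<close> at least 2, the induction step needs
  \<open>(c + 2) * 3 / 2\<close> to be at most \<open>2 * c\<close>, that is, \<open>c\<close> at
  least 6. For smaller \<open>m\<close> the trivial count suffices.\<close>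

lemma card_primes_le_pow2: "m * card {p::nat. prime p \<and> p \<le> 2 ^ m} \<le> 6 * 2 ^ m"
proof (induction m)
  case (Suc m)
  define A where "A = card {p::nat. prime p \<and> p \<le> 2 ^ Suc m}"
  show ?case
  proof (cases "m \<le> 1")
    case True
    have "A \<le> card {1..2 ^ Suc m :: nat}" unfolding A_def
      by (rule card_mono) (auto dest: prime_gt_0_nat)
    then have "Suc m * A \<le> 2 * 2 ^ Suc m" using True by (intro mult_mono) auto
    then show ?thesis by (simp add: A_def)
  next
    case False
    have "A \<le> card {p::nat. prime p \<and> p \<le> 2 ^ m} + card {p::nat. prime p \<and> 2 ^ m < p \<and> p \<le> 2 ^ Suc m}"
      unfolding A_def primes_le_Suc_dyadic by (rule card_Un_le)
    then have "m * A \<le> m * card {p::nat. prime p \<and> p \<le> 2 ^ m} + m * card {p::nat. prime p \<and> 2 ^ m < p \<and> p \<le> 2 ^ Suc m}"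
      by (metis add_mult_distrib2 mult_le_mono2)
    also have "\<dots> \<le> 6 * 2 ^ m + 2 ^ Suc m" using Suc card_primes_dyadic[of m] by linarith
    finally have "m * A \<le> 8 * 2 ^ m" by simp
    moreover have "2 * (Suc m * A) \<le> 3 * (m * A)"
      using mult_le_mono1[of "2 * Suc m" "3 * m" A] False by (simp only: mult.assoc) simp
    ultimately have "Suc m * A \<le> 6 * 2 ^ Suc m" by (simp only: power_Suc)
    then show ?thesis by (simp add: A_def)
  qed
qed simp

section \<open>The sum of the reciprocals of the primes\<close>

lemma sum_inverse_le_dyadic: "(\<Sum>k\<in>{0<..<2 ^ l :: nat}. 1 / real k) \<le> real l"
proof (induction l)
  case (Suc l)
  have "{0<..<2 ^ Suc l :: nat} = {0<..<2 ^ l} \<union> {2 ^ l..<2 ^ Suc l}" by auto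
  then have "(\<Sum>k\<in>{0<..<2 ^ Suc l :: nat}. 1 / real k)
     = (\<Sum>k\<in>{0<..<2 ^ l :: nat}. 1 / real k) + (\<Sum>k\<in>{2 ^ l..<2 ^ Suc l :: nat}. 1 / real k)"
    by (simp only:) (rule sum.union_disjoint, auto)
  also have "(\<Sum>k\<in>{2 ^ l..<2 ^ Suc l :: nat}. 1 / real k) \<le> (\<Sum>k\<in>{2 ^ l..<2 ^ Suc l :: nat}. 1 / 2 ^ l)"
  proof (rule sum_mono)
    fix k :: nat assume "k \<in> {2 ^ l..<2 ^ Suc l}"
    then have "real (2 ^ l) \<le> real k" by (subst of_nat_le_iff) simp
    then show "1 / real k \<le> 1 / 2 ^ l" using \<open>k \<in> _\<close> by (intro divide_left_mono mult_pos_pos) (auto intro: gr0I)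
  qed
  also have "(\<Sum>k\<in>{2 ^ l..<2 ^ Suc l :: nat}. 1 / 2 ^ l) = (1::real)" by simp
  finally show ?case using Suc by simp
qed simp

text \<open>Between \<open>2 ^ k\<close> and \<open>2 ^ Suc k\<close> there are at most
  \<open>2 ^ Suc k / k\<close> primes, each with reciprocal below \<open>1 / 2 ^ k\<close>, so this
  block contributes at most \<open>2 / k\<close>. The term \<open>1 / 2\<close> is the prime
  2.\<close>

lemma sum_inverse_primes_dyadic:
  "(\<Sum>p | prime p \<and> p \<le> 2 ^ Suc m. 1 / real p) \<le> 1 / 2 + 2 * (\<Sum>k\<in>{0<..<Suc m}. 1 / real k)"
proof (induction m)
  case 0
  have "{p::nat. prime p \<and> p \<le> 2} = {2}" by (auto dest: prime_ge_2_nat)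
  then show ?case by simp
next
  case (Suc m)
  have ins: "{0<..<Suc (Suc m)} = insert (Suc m) {0<..<Suc m}" by auto
  let ?D = "{p::nat. prime p \<and> 2 ^ Suc m < p \<and> p \<le> 2 ^ Suc (Suc m)}"
  have fin: "finite ?D" by (rule finite_subset[of _ "{..2 ^ Suc (Suc m)}"]) auto
  have "(\<Sum>p | prime p \<and> p \<le> 2 ^ Suc (Suc m). 1 / real p)
     = (\<Sum>p | prime p \<and> p \<le> 2 ^ Suc m. 1 / real p) + (\<Sum>p\<in>?D. 1 / real p)"
    unfolding primes_le_Suc_dyadic[of "Suc m"]
    by (rule sum.union_disjoint) (use fin in auto)
  also have "(\<Sum>p\<in>?D. 1 / real p) \<le> (\<Sum>p\<in>?D. 1 / 2 ^ Suc m)"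
  proof (rule sum_mono)
    fix p :: nat assume "p \<in> ?D"
    then have "real (2 ^ Suc m) \<le> real p" by (subst of_nat_le_iff) simp
    then show "1 / real p \<le> 1 / 2 ^ Suc m" using prime_gt_0_nat[of p] \<open>p \<in> ?D\<close> by (intro divide_left_mono) auto
  qed
  also have "\<dots> \<le> 2 / real (Suc m)"
  proof -
    have "real (Suc m * card ?D) \<le> real (2 ^ Suc (Suc m))"
      by (subst of_nat_le_iff) (rule card_primes_dyadic)
    then show ?thesis by (simp add: field_simps)
  qed
  finally show ?case using Suc by (simp only: ins) simp
qed

text \<open>The upper half of Mertens' second theorem: the dyadic blocks leave a harmonic sum of
  length below \<open>L\<close>, and a second dyadic argument bounds that sum by
  \<open>l\<close>.\<close>

lemma sum_inverse_primes_le: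
  assumes "x < 2 ^ L" "L < 2 ^ l"
  shows "(\<Sum>p | prime p \<and> p \<le> x. 1 / real p) \<le> 1 / 2 + 2 * real l"
proof (cases L)
  case 0
  then have "{p. prime p \<and> p \<le> x} = {}" using assms by (auto dest: prime_ge_2_nat)
  then show ?thesis by (simp only: sum.empty)
next
  case (Suc m)
  have "(\<Sum>p | prime p \<and> p \<le> x. 1 / real p) \<le> (\<Sum>p | prime p \<and> p \<le> 2 ^ Suc m. 1 / real p)"
    by (rule sum_mono2) (use assms Suc in auto)
  also have "\<dots> \<le> 1 / 2 + 2 * (\<Sum>k\<in>{0<..<Suc m}. 1 / real k)" by (rule sum_inverse_primes_dyadic)
  also have "(\<Sum>k\<in>{0<..<Suc m}. 1 / real k) \<le> (\<Sum>k\<in>{0<..<2 ^ l :: nat}. 1 / real k)"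
    by (rule sum_mono2) (use assms Suc in auto)
  also have "\<dots> \<le> real l" by (rule sum_inverse_le_dyadic)
  finally show ?thesis by simp
qed

section \<open>The average number of prime factors\<close>

lemma card_multiples_le: "card {n\<in>{1..N}. d dvd n} \<le> N div (d::nat)"
proof (cases "d = 0")
  case True
  then have "{n\<in>{1..N}. d dvd n} = {}" by auto
  then show ?thesis by (simp only: card.empty)
next
  case False
  have "{n\<in>{1..N}. d dvd n} \<subseteq> (\<lambda>i. d * i) ` {1..N div d}"
    using False by (auto simp: less_eq_div_iff_mult_less_eq mult.commute elim!: dvdE)
  then have "card {n\<in>{1..N}. d dvd n} \<le> card ((\<lambda>i. d * i) ` {1..N div d})"
    by (rule card_mono[rotated]) auto
  also have "\<dots> \<le> card {1..N div d}" by (rule card_image_le) auto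
  finally show ?thesis by simp
qed

text \<open>The range \<open>{1..N}\<close> of exponents is the same for all \<open>n\<close> up to
  \<open>N\<close>, which allows the sums over \<open>n\<close> and over \<open>k\<close> to be
  exchanged.\<close>

lemma multiplicity_eq_card:
  assumes "n > 0" "n \<le> N" "prime p"
  shows "multiplicity p n = card {k\<in>{1..N}. p ^ k dvd (n::nat)}"
proof -
  have "{k\<in>{1..N}. p ^ k dvd n} = {1..multiplicity p n}"
  proof -
    have "k \<le> N" if "p ^ k dvd n" for k
    proof -
      have "k < 2 ^ k" by (rule less_exp)
      also have "2 ^ k \<le> p ^ k" using assms by (intro power_mono prime_ge_2_nat) auto
      also have "\<dots> \<le> n" using that assms by (intro dvd_imp_le) auto
      finally show ?thesis using assms by simp
    qed
    moreover have "p ^ k dvd n \<longleftrightarrow> k \<le> multiplicity p n" for k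
      using assms by (intro power_dvd_iff_le_multiplicity) (auto simp: prime_gt_1_nat)
    ultimately show ?thesis by auto
  qed
  then show ?thesis by simp
qed

lemma sum_multiplicity_le:
  assumes "prime p"
  shows "real (\<Sum>n\<in>{1..N}. multiplicity p n) \<le> 2 * real N / real p"
proof -
  have p: "real p \<ge> 2" using prime_ge_2_nat[OF assms] by simp
  have "(\<Sum>n\<in>{1..N}. multiplicity p n) = (\<Sum>n\<in>{1..N}. card {k\<in>{1..N}. p ^ k dvd n})"
    by (rule sum.cong) (auto simp: multiplicity_eq_card assms)
  also have "\<dots> = (\<Sum>n\<in>{1..N}. \<Sum>k\<in>{1..N}. if p ^ k dvd n then 1 else 0)"
    by (simp add: sum.If_cases Int_def conj_commute)
  also have "\<dots> = (\<Sum>k\<in>{1..N}. \<Sum>n\<in>{1..N}. if p ^ k dvd n then 1 else 0)" by (rule sum.swap)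
  also have "\<dots> = (\<Sum>k\<in>{1..N}. card {n\<in>{1..N}. p ^ k dvd n})"
    by (simp add: sum.If_cases Int_def conj_commute)
  also have "\<dots> \<le> (\<Sum>k\<in>{1..N}. N div p ^ k)" by (intro sum_mono card_multiples_le)
  finally have "real (\<Sum>n\<in>{1..N}. multiplicity p n) \<le> (\<Sum>k\<in>{1..N}. real (N div p ^ k))"
    by (metis of_nat_le_iff of_nat_sum)
  also have "\<dots> \<le> (\<Sum>k\<in>{1..N}. real N * (1 / real p) ^ k)"
  proof (rule sum_mono)
    fix k
    have "real (N div p ^ k) \<le> real N / real (p ^ k)" by (rule of_nat_div_le_of_nat)
    then show "real (N div p ^ k) \<le> real N * (1 / real p) ^ k" by (simp add: power_one_over)
  qed
  also have "\<dots> = real N * (\<Sum>k\<in>{1..N}. (1 / real p) ^ k)" by (simp add: sum_distrib_left)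
  \<comment> \<open>The subtracted term strengthens the claim so that the induction closes; the
    ratio \<open>1 / p\<close> is at most \<open>1 / 2\<close>.\<close>
  also have "(\<Sum>k\<in>{1..N}. (1 / real p) ^ k) \<le> 2 * (1 / real p) - 2 * (1 / real p) ^ Suc N"
  proof (induction N)
    case (Suc N)
    have "(1 / real p) ^ Suc N * (2 * (1 / real p)) \<le> (1 / real p) ^ Suc N * 1"
      using p by (intro mult_left_mono) (auto simp: field_simps)
    then have "2 * (1 / real p) ^ Suc (Suc N) \<le> (1 / real p) ^ Suc N" by (simp add: mult_ac)
    then show ?case using Suc by simp
  qed simp
  also have "\<dots> \<le> 2 / real p" using p by simp
  finally have "real (\<Sum>n\<in>{1..N}. multiplicity p n) \<le> real N * (2 / real p)"
    by (blast intro: mult_left_mono of_nat_0_le_iff)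
  then show ?thesis by (simp add: mult.commute)
qed

text \<open>The classical function counting prime factors with multiplicity. It measures the
  divisions needed to recover all exponents of \<open>n\<close>.\<close>

definition Omega :: "nat \<Rightarrow> nat" where
  "Omega n = (\<Sum>p\<in>prime_factors n. multiplicity p n)"

lemma sum_Omega_le:
  "real (\<Sum>n\<in>{1..N}. Omega n) \<le> 2 * real N * (\<Sum>p | prime p \<and> p \<le> N. 1 / real p)"
proof -
  have "(\<Sum>n\<in>{1..N}. Omega n) = (\<Sum>n\<in>{1..N}. \<Sum>p | prime p \<and> p \<le> N. multiplicity p n)"
    unfolding Omega_def
  proof (rule sum.cong[OF refl], rule sum.mono_neutral_left)
    fix n assume n: "n \<in> {1..N}"
    then show "prime_factors n \<subseteq> {p. prime p \<and> p \<le> N}"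
      by (auto simp: prime_factors_dvd dest: dvd_imp_le)
    show "\<forall>p\<in>{p. prime p \<and> p \<le> N} - prime_factors n. multiplicity p n = 0"
      using n by (auto simp: prime_factors_dvd not_dvd_imp_multiplicity_0)
  qed auto
  also have "\<dots> = (\<Sum>p | prime p \<and> p \<le> N. \<Sum>n\<in>{1..N}. multiplicity p n)" by (rule sum.swap)
  also have "real \<dots> = (\<Sum>p | prime p \<and> p \<le> N. real (\<Sum>n\<in>{1..N}. multiplicity p n))" by simp
  also have "\<dots> \<le> (\<Sum>p | prime p \<and> p \<le> N. 2 * real N / real p)"
    by (intro sum_mono sum_multiplicity_le) auto
  also have "\<dots> = 2 * real N * (\<Sum>p | prime p \<and> p \<le> N. 1 / real p)"
    by (simp add: sum_distrib_left)
  finally show ?thesis .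
qed

subsection \<open>Data structures of the sieve\<close>

text \<open>In two's complement \<open>- m\<close> is \<open>not m + 1\<close>; for odd
  \<open>m\<close> the number \<open>not m\<close> is even, so \<open>- m\<close> and
  \<open>m\<close> share the lowest bit and differ in all others. The general case is this one
  shifted by \<open>k\<close>.\<close>

lemma and_uminus_odd_mult_power:
  assumes "odd (m::int)"
  shows "and (m * 2 ^ k) (- (m * 2 ^ k)) = 2 ^ k"
proof -
  obtain j where j: "m = 2 * j + 1" using assms by (elim oddE)
  have m: "- m = 2 * (not j) + 1" by (simp add: j not_eq_complement)
  have "and (1 + 2 * j) (1 + 2 * not j) = 1 + 2 * and j (not j)"
    by (subst and_int_rec) simp
  then have "and m (- m) = 1"
    unfolding m by (simp add: j add.commute)
  then have "push_bit k (and m (- m)) = 2 ^ k" by (simp add: push_bit_eq_mult)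
  then show ?thesis by (simp only: push_bit_and) (simp add: push_bit_eq_mult)
qed

text \<open>A list of positive numbers is stored in two words: \<open>C\<close> concatenates the binary digits,
  each \<open>p\<close> in a field of \<open>k\<close> bits with \<open>2 ^ k\<close> barely above \<open>p\<close>, and \<open>K\<close> has its one bits
  at the upper ends of the fields.\<close>

inductive encodes :: "nat list \<Rightarrow> int \<Rightarrow> int \<Rightarrow> bool" where
  encodes_Nil: "encodes [] 0 0"
| encodes_Cons: "encodes ps C K \<Longrightarrow> p < 2 ^ k \<Longrightarrow> 2 ^ k \<le> 2 * p \<Longrightarrow>
    encodes (p # ps) (C * 2 ^ k + int p) ((K + 1) * 2 ^ k)"

text \<open>Evenness leaves bit 0 of \<open>K\<close> free, and adding 1 before the next shift sets
  the mark there. It holds because a field has positive width: \<open>k = 0\<close> would force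
  \<open>p = 0\<close> and then contradict the lower bound on \<open>p\<close>.\<close>

lemma encodes_nonneg: "encodes ps C K \<Longrightarrow> 0 \<le> C \<and> 0 \<le> K \<and> even K"
proof (induction rule: encodes.induct)
  case (encodes_Cons ps C K p k)
  then have "k \<noteq> 0" by (cases k) auto
  then show ?case using encodes_Cons by auto
qed simp

lemma encodes_decode:
  assumes "encodes (p # ps) C K"
  shows "K \<noteq> 0" "and K (- K) > 0" "C mod and K (- K) = int p"
    "encodes ps (C div and K (- K)) (K div and K (- K) - 1)" "and K (- K) \<le> 2 * int p"
proof -
  from assms obtain C' K' k where *: "encodes ps C' K'" "p < 2 ^ k" "2 ^ k \<le> 2 * p"
      "C = C' * 2 ^ k + int p" "K = (K' + 1) * 2 ^ k"
    by cases auto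
  have K': "0 \<le> K'" "odd (K' + 1)" using encodes_nonneg[OF *(1)] by auto
  have q: "and K (- K) = 2 ^ k" unfolding *(5) using K'(2) by (rule and_uminus_odd_mult_power)
  have p: "int p < 2 ^ k" using *(2) by (metis of_nat_less_iff of_nat_numeral of_nat_power)
  show "K \<noteq> 0" using K' *(5) by simp
  show "and K (- K) > 0" unfolding q by simp
  show "C mod and K (- K) = int p" unfolding q *(4) using p by simp
  have "int (2 ^ k) \<le> int (2 * p)" using *(3) by (simp only: of_nat_le_iff)
  then show "and K (- K) \<le> 2 * int p" unfolding q by simp
  have "C div 2 ^ k = C'" "K div 2 ^ k - 1 = K'" using p by (simp_all add: *(4,5))
  then show "encodes ps (C div and K (- K)) (K div and K (- K) - 1)" unfolding q using *(1) by simp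
qed

lemma encodes_NilD: "encodes [] C K \<Longrightarrow> C = 0 \<and> K = 0"
  by (auto elim: encodes.cases)

text \<open>A field multiplies the size by \<open>2 ^ k\<close>, at most \<open>2 * p\<close>. The
  added 1 and 2 absorb the new digit and the new mark in the induction.\<close>

lemma encodes_bounds:
  assumes "encodes ps C K"
  shows "C + 1 \<le> int (2 ^ length ps * prod_list ps) \<and> K + 2 \<le> 2 * int (2 ^ length ps * prod_list ps)"
  using assms
proof (induction rule: encodes.induct)
  case (encodes_Cons ps C K p k)
  define D where "D = int (2 ^ length ps * prod_list ps)"
  define q :: int where "q = 2 ^ k"
  have CK: "0 \<le> C" "0 \<le> K" using encodes_nonneg[OF encodes_Cons(1)] by auto
  have p: "int p + 1 \<le> q" "q \<le> 2 * int p"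
    using encodes_Cons(2,3) unfolding q_def
    by (metis Suc_eq_plus1 Suc_leI of_nat_1 of_nat_add of_nat_le_iff of_nat_numeral of_nat_power)
       (metis encodes_Cons(3) of_nat_le_iff of_nat_mult of_nat_numeral of_nat_power)
  have IH: "C + 1 \<le> D" "K + 2 \<le> 2 * D" using encodes_Cons.IH by (auto simp: D_def)
  have "C * q + int p + 1 \<le> (C + 1) * q" using p by (simp add: algebra_simps)
  also have "\<dots> \<le> D * (2 * int p)" using IH p CK by (intro mult_mono) auto
  finally have 1: "C * q + int p + 1 \<le> D * (2 * int p)" .
  have "(K + 1) * q + 2 \<le> (K + 2) * q" using p encodes_Cons(2,3)
    by (cases "p = 0") (auto simp: algebra_simps)
  also have "\<dots> \<le> (2 * D) * (2 * int p)" using IH p CK by (intro mult_mono) auto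
  finally have 2: "(K + 1) * q + 2 \<le> (2 * D) * (2 * int p)" .
  show ?case using 1 2 by (simp add: D_def q_def mult_ac)
qed simp

lemma prod_list_primes:
  assumes "distinct ps" "\<And>p. p \<in> set ps \<Longrightarrow> prime p \<and> p dvd n" "n > (0::nat)"
  shows "prod_list ps \<le> n" "2 ^ length ps \<le> prod_list ps"
proof -
  have "prod_list ps dvd n" using assms(1,2)
  proof (induction ps)
    case (Cons p ps)
    have "coprime p (prod_list ps)"
      using Cons by (intro prod_list_coprime_right) (auto intro!: primes_coprime)
    then show ?case using Cons by (auto intro: divides_mult)
  qed simp
  then show "prod_list ps \<le> n" using assms(3) by (rule dvd_imp_le)
  show "2 ^ length ps \<le> prod_list ps" using assms(2)
    by (induction ps) (auto intro!: mult_le_mono prime_ge_2_nat)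
qed

text \<open>Rounding the fields up to powers of two costs a factor \<open>2 ^ length ps\<close>. As
  every prime is at least 2, this factor is itself at most the product of the primes, hence the
  square of \<open>n\<close>.\<close>

lemma encodes_primes_bounds:
  assumes "encodes ps C K" "distinct ps" "\<And>p. p \<in> set ps \<Longrightarrow> prime p \<and> p dvd n" "n > 0"
  shows "C < int n * int n" "K < 2 * int n * int n"
proof -
  have "2 ^ length ps * prod_list ps \<le> n * n"
    using prod_list_primes[OF assms(2-4)] by (intro mult_le_mono) auto
  then have "int (2 ^ length ps * prod_list ps) \<le> int n * int n"
    by (simp only: of_nat_mult[symmetric] of_nat_le_iff)
  then show "C < int n * int n" "K < 2 * int n * int n" using encodes_bounds[OF assms(1)] by auto
qed

text \<open>Digits in base \<open>r\<close>, least significant first. No length is stored: valid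
  entries are nonzero, so a word has been read completely exactly when 0 remains.\<close>

primrec pack :: "nat \<Rightarrow> nat list \<Rightarrow> nat" where
  "pack r [] = 0"
| "pack r (e # es) = e + r * pack r es"

lemma pack_append: "pack r (es @ [e]) = pack r es + e * r ^ length es"
  by (induction es) (auto simp: algebra_simps)

lemma pack_less: "(\<And>e. e \<in> set es \<Longrightarrow> e < r) \<Longrightarrow> pack r es < r ^ length es"
proof (induction es)
  case (Cons e es)
  then have "pack r es + 1 \<le> r ^ length es" "e < r" by auto
  then have "e + r * pack r es < r * (pack r es + 1)" by simp
  also have "\<dots> \<le> r * r ^ length es" using \<open>pack r es + 1 \<le> _\<close> by (rule mult_le_mono2)
  finally show ?case by simp
qed simp

text \<open>The primes are stored as the increments of a cursor: the entry \<open>2 * d + b\<close> advances the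
  cursor by \<open>d\<close> and reports a prime there iff \<open>b = 1\<close>. Long prime gaps are bridged by entries
  \<open>2 * G\<close>.\<close>

primrec decode_entries :: "nat \<Rightarrow> nat list \<Rightarrow> nat list" where
  "decode_entries v [] = []"
| "decode_entries v (e # es) =
     (if odd e then [v + e div 2] else []) @ decode_entries (v + e div 2) es"

definition advance :: "nat list \<Rightarrow> nat" where
  "advance es = sum_list (map (\<lambda>e. e div 2) es)"

lemma advance_append: "advance (es @ fs) = advance es + advance fs"
  by (simp add: advance_def)

lemma decode_entries_append:
  "decode_entries v (es @ fs) = decode_entries v es @ decode_entries (v + advance es) fs"
  by (induction es arbitrary: v) (auto simp: advance_def add.assoc)

definition entries_ok :: "nat \<Rightarrow> nat list \<Rightarrow> bool" where
  "entries_ok G es \<longleftrightarrow> (\<forall>e\<in>set es. 2 \<le> e \<and> e \<le> 2 * G + 1 \<and> (odd e \<or> e = 2 * G))"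

text \<open>Every entry either reports a prime or advances the cursor by \<open>G\<close>.\<close>

lemma length_entries_le:
  "entries_ok G es \<Longrightarrow> G * length es \<le> G * length (decode_entries v es) + advance es"
proof (induction es arbitrary: v)
  case (Cons e es)
  then have "entries_ok G es" by (simp add: entries_ok_def)
  note IH = Cons.IH[OF this, of "v + e div 2"]
  show ?case
  proof (cases "odd e")
    case True
    then show ?thesis using IH by (simp add: advance_def)
  next
    case False
    then have "e div 2 = G" using Cons.prems by (simp add: entries_ok_def)
    then show ?thesis using IH False by (simp add: advance_def)
  qed
qed simp

text \<open>The cursor stands at \<open>1 + advance es\<close>, \<open>n\<close> is the next
  candidate, and \<open>c\<close> counts the numbers strictly between the two.\<close>

definition gen_inv :: "nat \<Rightarrow> nat \<Rightarrow> nat list \<Rightarrow> nat \<Rightarrow> bool" where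
  "gen_inv G n es c \<longleftrightarrow> entries_ok G es \<and> decode_entries 1 es = filter prime [2..<n] \<and>
     2 + advance es + c = n \<and> c < G"

lemma gen_inv_emit:
  assumes "gen_inv G n es c" "prime n \<or> Suc c = G"
  shows "gen_inv G (Suc n) (es @ [2 * Suc c + of_bool (prime n)]) 0"
  using assms unfolding gen_inv_def
  by (auto simp: decode_entries_append advance_append entries_ok_def advance_def)

lemma gen_inv_skip:
  assumes "gen_inv G n es c" "\<not> prime n" "Suc c \<noteq> G"
  shows "gen_inv G (Suc n) es (Suc c)"
  using assms unfolding gen_inv_def by auto

definition primes_upto :: "nat \<Rightarrow> nat list" where
  "primes_upto y = filter prime [2..<Suc y]"

lemma set_primes_upto: "set (primes_upto y) = {p. prime p \<and> p \<le> y}"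
  by (auto simp: primes_upto_def dest: prime_ge_2_nat)

lemma distinct_primes_upto: "distinct (primes_upto y)"
  by (simp add: primes_upto_def)

lemma length_primes_upto: "length (primes_upto y) = card {p. prime p \<and> p \<le> y}"
  using distinct_card[OF distinct_primes_upto[of y]] by (simp add: set_primes_upto)

text \<open>Reversed because a cell is a stack onto which the primes are pushed in the order in
  which the sieve meets them.\<close>

definition divisors_in :: "nat list \<Rightarrow> nat \<Rightarrow> nat list" where
  "divisors_in ps n = rev (filter (\<lambda>p. p dvd n) ps)"

definition cofactor :: "nat list \<Rightarrow> nat \<Rightarrow> nat" where
  "cofactor ps n = fold (\<lambda>p r. r div p ^ multiplicity p r) ps n"

definition factor_list :: "nat \<Rightarrow> nat \<Rightarrow> (nat \<times> nat) list" where
  "factor_list y n = (let ps = divisors_in (primes_upto y) n in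
     map (\<lambda>p. (p, multiplicity p n)) ps @
     (if cofactor ps n = 1 then [] else [(cofactor ps n, 1)]))"

lemma cofactor_props:
  assumes "n > 0" "\<And>p. p \<in> set ps \<Longrightarrow> prime p"
  shows "cofactor ps n dvd n \<and> cofactor ps n > 0 \<and>
    (\<forall>q. prime q \<longrightarrow> multiplicity q (cofactor ps n) = (if q \<in> set ps then 0 else multiplicity q n))"
  using assms unfolding cofactor_def
proof (induction ps arbitrary: n)
  case (Cons p ps)
  define r where "r = n div p ^ multiplicity p n"
  have p: "prime p" using Cons by auto
  have n: "n = p ^ multiplicity p n * r" unfolding r_def
    by (simp add: multiplicity_dvd)
  have r0: "r > 0" using n Cons.prems(1) by (intro gr0I) auto
  have rn: "r dvd n" by (subst n) simp
  have mult: "multiplicity q r = (if q = p then 0 else multiplicity q n)" if q: "prime q" for q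
  proof (cases "q = p")
    case True
    have "multiplicity p n = multiplicity p n + multiplicity p r"
      by (subst n) (use p r0 in \<open>simp add: prime_elem_multiplicity_mult_distrib\<close>)
    then show ?thesis using True by simp
  next
    case False
    have "multiplicity q (p ^ multiplicity p n) = 0"
      using False p q by (intro not_dvd_imp_multiplicity_0) (metis prime_dvd_power primes_dvd_imp_eq)
    moreover have "multiplicity q n = multiplicity q (p ^ multiplicity p n) + multiplicity q r"
      by (subst n) (use p q r0 in \<open>simp add: prime_elem_multiplicity_mult_distrib prime_gt_0_nat\<close>)
    ultimately show ?thesis using False by simp
  qed
  from Cons.IH[OF r0] Cons.prems(2)
  have "fold (\<lambda>p r. r div p ^ multiplicity p r) ps r dvd r \<and> fold (\<lambda>p r. r div p ^ multiplicity p r) ps r > 0 \<and>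
    (\<forall>q. prime q \<longrightarrow> multiplicity q (fold (\<lambda>p r. r div p ^ multiplicity p r) ps r) = (if q \<in> set ps then 0 else multiplicity q r))"
    by auto
  then show ?case using rn mult by (auto simp: r_def[symmetric] intro: dvd_trans)
qed simp

lemma set_divisors_in_primes_upto:
  "set (divisors_in (primes_upto y) n) = {p. prime p \<and> p \<le> y \<and> p dvd n}"
  by (auto simp: divisors_in_def set_primes_upto)

lemma distinct_divisors_in: "distinct ps \<Longrightarrow> distinct (divisors_in ps n)"
  by (simp add: divisors_in_def)

lemma is_factorization_factor_list:
  assumes "n > 0" "n < (y + 1) ^ 2"
  shows "is_factorization n (factor_list y n)"
proof -
  define ps where "ps = divisors_in (primes_upto y) n"
  define r where "r = cofactor ps n"
  have ps: "set ps = {p. prime p \<and> p \<le> y \<and> p dvd n}" "distinct ps"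
    by (auto simp: ps_def set_divisors_in_primes_upto distinct_divisors_in distinct_primes_upto)
  have r: "r dvd n" "r > 0" "\<And>q. prime q \<Longrightarrow> multiplicity q r = (if q \<in> set ps then 0 else multiplicity q n)"
    using cofactor_props[OF assms(1), of ps] ps unfolding r_def by auto
  have big: "q > y" if "prime q" "q dvd r" for q
  proof (rule ccontr)
    assume "\<not> q > y"
    then have "q \<in> set ps" using that r(1) ps dvd_trans by auto
    then have "multiplicity q r = 0" using r(3) that by auto
    then show False using that r(2) prime_multiplicity_gt_zero_iff[OF prime_imp_prime_elem, of q r] by simp
  qed
  \<comment> \<open>A proper factorization of \<open>r\<close> would yield two factors above
    \<open>y\<close>, whose product is at least \<open>(y + 1) * (y + 1)\<close> and so exceeds
    \<open>n\<close>.\<close>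
  have r_prime: "prime r" if "r \<noteq> 1"
  proof -
    obtain q where q: "prime q" "q dvd r" using prime_factor_nat[OF \<open>r \<noteq> 1\<close>] by blast
    obtain s where s: "r = q * s" using q(2) by blast
    have "s = 1"
    proof (rule ccontr)
      assume "s \<noteq> 1"
      then obtain q' where q': "prime q'" "q' dvd s" using prime_factor_nat[OF \<open>s \<noteq> 1\<close>] by blast
      have "q' > y" using big q' s by auto
      moreover have "q' \<le> s" using q' r(2) s by (intro dvd_imp_le) auto
      moreover have "q > y" using big q by auto
      ultimately have "(y + 1) * (y + 1) \<le> q * s" by (intro mult_le_mono) auto
      also have "\<dots> \<le> n" using r(1) assms(1) s by (metis dvd_imp_le)
      finally show False using assms(2) by (simp add: power2_eq_square)
    qed
    then show ?thesis using q s by simp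
  qed
  have fl: "factor_list y n = map (\<lambda>p. (p, multiplicity p n)) ps @ (if r = 1 then [] else [(r, 1)])"
    by (simp add: factor_list_def Let_def ps_def r_def)
  show ?thesis
  proof (cases "r = 1")
    case True
    have "p \<in> set ps" if "prime p" "p dvd n" for p
    proof (rule ccontr)
      assume "p \<notin> set ps"
      then have "multiplicity p n = 0" using r(3)[OF that(1)] True by simp
      then show False using that assms(1) prime_multiplicity_gt_zero_iff[OF prime_imp_prime_elem, of p n] by simp
    qed
    then have "set ps = prime_factors n" using ps assms(1) by (auto simp: prime_factors_dvd)
    then show ?thesis using True ps(2)
      by (auto simp: is_factorization_def fl o_def)
  next
    case False
    note rp = r_prime[OF False]
    have rnot: "r \<notin> set ps" using big[OF rp] ps by auto
    have "multiplicity r n = 1" using r(3)[OF rp] rnot rp by (simp add: multiplicity_prime)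
    moreover have "prime_factors n = insert r (set ps)"
    proof -
      have "p \<in> set ps" if "prime p" "p dvd n" "p \<noteq> r" for p
      proof (rule ccontr)
        assume "p \<notin> set ps"
        then have "multiplicity p n = multiplicity p r" using r(3)[OF that(1)] by simp
        also have "\<dots> = 0" using that rp by (intro not_dvd_imp_multiplicity_0) (metis primes_dvd_imp_eq)
        finally show False using that assms(1) prime_multiplicity_gt_zero_iff[OF prime_imp_prime_elem, of p n] by simp
      qed
      then show ?thesis using ps rp r(1) assms(1) by (auto simp: prime_factors_dvd)
    qed
    ultimately show ?thesis using False ps(2) rnot
      by (auto simp: is_factorization_def fl o_def)
  qed
qed

subsection \<open>The program\<close>

text \<open>Register \<open>rM\<close> holds the segment length, \<open>rA\<close> the first number of the current segment,
  \<open>rN\<close> the number of words of the packed prime list (stored at addresses \<open>0..<rN\<close>), \<open>rR\<close> the radix of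
  the packing and \<open>rG\<close> the length at which prime gaps are broken. Cell \<open>j\<close> of the segment
  occupies the addresses \<open>rN + 2 * j\<close> and \<open>rN + 2 * j + 1\<close>.\<close>

abbreviation (input) "rX \<equiv> 0 :: nat"
abbreviation (input) "rY \<equiv> 23 :: nat"
abbreviation (input) "rL \<equiv> 2 :: nat"
abbreviation (input) "rl \<equiv> 3 :: nat"
abbreviation (input) "rG \<equiv> 4 :: nat"
abbreviation (input) "rM \<equiv> 5 :: nat"
abbreviation (input) "rR \<equiv> 6 :: nat"
abbreviation (input) "rN \<equiv> 7 :: nat"
abbreviation (input) "rA \<equiv> 8 :: nat"
abbreviation (input) "rT \<equiv> 9 :: nat"
abbreviation (input) "rU \<equiv> 10 :: nat"
abbreviation (input) "rC \<equiv> 11 :: nat"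
abbreviation (input) "rW \<equiv> 12 :: nat"
abbreviation (input) "rB \<equiv> 13 :: nat"
abbreviation (input) "rI \<equiv> 14 :: nat"
abbreviation (input) "rD \<equiv> 15 :: nat"
abbreviation (input) "rF \<equiv> 16 :: nat"
abbreviation (input) "rE \<equiv> 17 :: nat"
abbreviation (input) "rV \<equiv> 18 :: nat"
abbreviation (input) "rQ \<equiv> 19 :: nat"
abbreviation (input) "rJ \<equiv> 20 :: nat"
abbreviation (input) "rP \<equiv> 21 :: nat"
abbreviation (input) "rK \<equiv> 22 :: nat"

abbreviation "const r c \<equiv> Basic (LoadConst r c)"
abbreviation "arith op r a b \<equiv> Basic (Arith op r a b)"
abbreviation "load r a \<equiv> Basic (Load r a)"
abbreviation "store a r \<equiv> Basic (Store a r)"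
abbreviation "print r \<equiv> Basic (Output r)"
abbreviation "skip \<equiv> const rU 0"
abbreviation "inc r \<equiv> const rU 1 ;; arith Add r r rU"

definition sqrt_prog :: com where
  "sqrt_prog = const rY 1 ;;
     Loop (const rU 1 ;; arith Add rT rY rU ;; arith Mul rT rT rT ;; arith Add rU rX rU ;; arith Less rT rT rU)
       rT (inc rY)"

text \<open>The running power of two is kept in \<open>rG\<close> on purpose: the second call, which
  computes \<open>l\<close> from \<open>L\<close>, leaves there the gap bound
  \<open>2 ^ l\<close>.\<close>

definition log_prog :: "nat \<Rightarrow> nat \<Rightarrow> com" where
  "log_prog a r = const r 1 ;; const rG 2 ;;
     Loop (const rU 1 ;; arith Add rU a rU ;; arith Less rT rG rU)
       rT (inc r ;; arith Add rG rG rG)"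

text \<open>The radix \<open>4 * G\<close> is above the largest entry \<open>2 * G + 1\<close> and,
  being \<open>2 ^ (l + 2)\<close>, makes an entry worth \<open>l + 2\<close> bits.\<close>

definition setup_prog :: com where
  "setup_prog = arith Mul rT rL rl ;; arith Div rM rY rT ;; inc rM ;; const rU 4 ;; arith Mul rR rG rU"

text \<open>Here \<open>rW\<close> is the partially filled word and \<open>rB\<close> the power of the radix that belongs to its
  next entry; a word is full as soon as \<open>rB\<close> reaches \<open>x\<close>.\<close>

definition flush_prog :: com where
  "flush_prog = store rN rW ;; inc rN ;; const rW 0 ;; const rB 1"

definition divisor_prog :: com where
  "divisor_prog = const rD 2 ;; Loop (arith Mod rT rI rD) rT (inc rD)"

definition emit_prog :: com where
  "emit_prog = arith Add rE rC rC ;; arith Add rE rE rF ;; arith Mul rE rE rB ;; arith Add rW rW rE ;;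
     arith Mul rB rB rR ;; const rC 0 ;; arith Less rT rB rX ;; Cond rT skip flush_prog"

definition gen_step_prog :: com where
  "gen_step_prog = inc rC ;; divisor_prog ;; arith Eq rF rD rI ;; arith Eq rT rC rG ;; arith Add rT rT rF ;;
     Cond rT emit_prog skip ;; inc rI"

definition gen_prog :: com where
  "gen_prog = const rN 0 ;; const rW 0 ;; const rB 1 ;; const rC 0 ;; const rI 2 ;;
     Loop (const rU 1 ;; arith Add rT rY rU ;; arith Less rT rI rT) rT
       gen_step_prog ;;
     flush_prog"

abbreviation cell_prog :: com where
  "cell_prog \<equiv> arith Add rP rJ rJ ;; arith Add rP rP rN"

definition clear_prog :: com where
  "clear_prog = const rJ 0 ;; const rE 0 ;;
     Loop (arith Less rT rJ rM) rT (cell_prog ;; store rP rE ;; inc rP ;; store rP rE ;; inc rJ)"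

text \<open>\<open>rV\<close> runs through the positions given by the entries, and \<open>rQ\<close> is kept at the least power of
  two above \<open>rV\<close>: this is the width of the field in which a prime is recorded.\<close>

definition mark_prog :: com where
  "mark_prog = const rU 0 ;; arith Sub rJ rU rA ;; arith Mod rJ rJ rV ;;
     Loop (arith Less rT rJ rM) rT
       (cell_prog ;; load rE rP ;; arith Mul rE rE rQ ;; arith Add rE rE rV ;; store rP rE ;;
        inc rP ;; load rE rP ;; inc rE ;; arith Mul rE rE rQ ;; store rP rE ;; arith Add rJ rJ rV)"

definition double_prog :: com where
  "double_prog = Loop (const rU 1 ;; arith Add rT rV rU ;; arith Less rT rQ rT) rT (arith Add rQ rQ rQ)"

definition entry_prog :: com where
  "entry_prog = const rU 2 ;; arith Div rT rE rU ;; arith Add rV rV rT ;;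
     double_prog ;; const rU 2 ;; arith Mod rT rE rU ;; Cond rT mark_prog skip"

definition word_prog :: com where
  "word_prog = Loop skip rW (arith Mod rE rW rR ;; arith Div rW rW rR ;; entry_prog)"

definition sieve_prog :: com where
  "sieve_prog = const rV 1 ;; const rQ 2 ;; const rI 0 ;;
     Loop (arith Less rT rI rN) rT (load rW rI ;; word_prog ;; inc rI)"

text \<open>The lowest one bit of \<open>K\<close>, isolated as \<open>and K (- K)\<close>, delimits the most recently
  recorded prime.\<close>

abbreviation decode_prog :: "com \<Rightarrow> com" where
  "decode_prog c \<equiv> const rU 0 ;; arith Sub rQ rU rK ;; arith BAnd rQ rK rQ ;; arith Mod rV rC rQ ;;
     arith Div rC rC rQ ;; arith Div rK rK rQ ;; const rU 1 ;; arith Sub rK rK rU ;; c"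

definition divide_out_prog :: "nat \<Rightarrow> com" where
  "divide_out_prog r = const rE 0 ;;
     Loop (arith Mod rT r rV ;; const rU 0 ;; arith Eq rT rT rU) rT (arith Div r r rV ;; inc rE)"

definition fetch_prog :: com where
  "fetch_prog = cell_prog ;; load rC rP ;; inc rP ;; load rK rP"

text \<open>Registers are copied by adding 0. This pass finds the number of factors and leaves the
  cofactor in \<open>rD\<close>, where \<open>print_prog\<close> expects it.\<close>

definition count_prog :: com where
  "count_prog = const rU 0 ;; arith Add rD rI rU ;; const rF 0 ;;
     Loop skip rK (decode_prog (divide_out_prog rD ;; inc rF)) ;;
     const rU 1 ;; arith Less rT rU rD ;; arith Add rF rF rT"

definition print_prog :: com where
  "print_prog = Loop skip rK
      (decode_prog (const rU 0 ;; arith Add rW rI rU ;; divide_out_prog rW ;; print rV ;; print rE)) ;;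
     const rU 1 ;; arith Less rT rU rD ;; Cond rT (print rD ;; const rU 1 ;; print rU) skip"

text \<open>The output format puts the number of prime factors before the factors, and decoding
  consumes \<open>rC\<close> and \<open>rK\<close>. Hence the cell is fetched and decoded twice,
  once to count and once to print.\<close>

definition block_prog :: com where
  "block_prog = arith Add rI rA rJ ;; fetch_prog ;; count_prog ;; print rI ;; print rF ;; fetch_prog ;; print_prog"

text \<open>The product of the two comparisons is their conjunction: the segment ends, or
  \<open>x\<close> is passed, since the last segment may extend beyond \<open>x\<close>.\<close>

definition output_prog :: com where
  "output_prog = const rJ 0 ;;
     Loop (arith Add rT rA rJ ;; const rU 1 ;; arith Add rU rX rU ;; arith Less rT rT rU ;;
           arith Less rU rJ rM ;; arith Mul rT rT rU) rT (block_prog ;; inc rJ)"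

definition main_prog :: com where
  "main_prog = sqrt_prog ;; log_prog rX rL ;; log_prog rL rl ;; setup_prog ;; gen_prog ;; const rA 1 ;;
     Loop (const rU 1 ;; arith Add rT rX rU ;; arith Less rT rA rT) rT
       (clear_prog ;; sieve_prog ;; output_prog ;; arith Add rA rA rM)"

declare wp.simps(4) [simp del]

subsection \<open>Verification of the program\<close>

text \<open>A frame condition: \<open>S\<close> collects the registers that a program part may
  change.\<close>

definition same :: "nat set \<Rightarrow> (nat \<Rightarrow> int) \<Rightarrow> (nat \<Rightarrow> int) \<Rightarrow> bool" where
  "same S R' R \<longleftrightarrow> (\<forall>r. r \<notin> S \<longrightarrow> R' r = R r)"

lemma sameD: "same S R' R \<Longrightarrow> r \<notin> S \<Longrightarrow> R' r = R r"
  by (simp add: same_def)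

lemma same_refl [simp]: "same S R R"
  by (simp add: same_def)

lemma same_upd [simp]:
  "r \<in> S \<Longrightarrow> same S (R'(r := v)) R \<longleftrightarrow> same S R' R"
  "r \<in> S \<Longrightarrow> same S R' (R(r := v)) \<longleftrightarrow> same S R' R"
  unfolding same_def by (metis fun_upd_other)+

lemma same_trans: "same S' R2 R1 \<Longrightarrow> same S R1 R0 \<Longrightarrow> S' \<subseteq> S \<Longrightarrow> same S R2 R0"
  by (auto simp: same_def)

text \<open>\<open>wp_for\<close> with the frame condition built into the invariant. The premises
  offer it also pointwise, as rewrite rules for the unchanged registers.\<close>

lemma wp_for_same:
  assumes "I 0 R M os U T"
    and "\<And>k R' M' os' U' T'. k < N \<Longrightarrow> same S R' R \<Longrightarrow> (\<And>i. i \<notin> S \<Longrightarrow> R' i = R i) \<Longrightarrow> I k R' M' os' U' T' \<Longrightarrow>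
      wp w c (\<lambda>R' M' os' U' T'. R' r \<noteq> 0 \<and>
        wp w b (\<lambda>R' M' os' U' T'. same S R' R \<and> I (Suc k) R' M' os' U' (Suc T')) R' M' os' U' (Suc T')) R' M' os' U' T'"
    and "\<And>R' M' os' U' T'. same S R' R \<Longrightarrow> (\<And>i. i \<notin> S \<Longrightarrow> R' i = R i) \<Longrightarrow> I N R' M' os' U' T' \<Longrightarrow>
      wp w c (\<lambda>R' M' os' U' T'. R' r = 0 \<and> Q R' M' os' U' (Suc T')) R' M' os' U' T'"
  shows "wp w (Loop c r b) Q R M os U T"
  by (rule wp_for[where N = N and I = "\<lambda>k R' M' os' U' T'. same S R' R \<and> I k R' M' os' U' T'"])
    (use assms sameD in auto)

lemma advance_ge_length: "entries_ok G es \<Longrightarrow> length es \<le> advance es"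
proof (induction es)
  case (Cons e es)
  then have "entries_ok G es" "2 \<le> e" by (simp_all add: entries_ok_def)
  then have "length es \<le> advance es" "e div 2 \<ge> 1" using Cons.IH div_le_mono[of 2 e 2] by simp_all
  then show ?case by (simp add: advance_def)
qed (simp add: advance_def)

text \<open>The assumptions on \<open>L\<close> and \<open>l\<close> make them the bit lengths of
  \<open>x\<close> and of \<open>L\<close>. The factor 100 leaves room for all intermediate values;
  for the packed words and the cells these are small multiples of \<open>x * x\<close>.\<close>

locale sieve =
  fixes w x y L l :: nat
  assumes x3: "x \<ge> 3"
    and y: "y * y \<le> x" "x < (y + 1) * (y + 1)"
    and L: "2 ^ (L - 1) \<le> x" "x < 2 ^ L"
    and l: "2 ^ (l - 1) \<le> L" "L < 2 ^ l"
    and w: "100 * (x * x) \<le> 2 ^ w"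
begin

lemma in_word_quad: "- (100 * (int x * int x)) \<le> v \<Longrightarrow> v < 100 * (int x * int x) \<Longrightarrow> in_word w v"
proof -
  have "int (100 * (x * x)) \<le> int (2 ^ w)" using w by (simp only: of_nat_le_iff)
  then show "- (100 * (int x * int x)) \<le> v \<Longrightarrow> v < 100 * (int x * int x) \<Longrightarrow> in_word w v"
    by (simp add: in_word_def)
qed

lemma in_word_lin: "- (100 * int x) \<le> v \<Longrightarrow> v \<le> 100 * int x \<Longrightarrow> in_word w v"
proof (rule in_word_quad)
  have "int x * 3 \<le> int x * int x" using x3 by (intro mult_left_mono) auto
  then show "- (100 * int x) \<le> v \<Longrightarrow> - (100 * (int x * int x)) \<le> v" "v \<le> 100 * int x \<Longrightarrow> v < 100 * (int x * int x)"
    using x3 by linarith+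
qed

lemma in_word_consts [simp]: "in_word w 0" "in_word w 1" "in_word w 2" "in_word w 4"
  "in_word w (if b then 1 else 0)"
  using x3 by (auto intro!: in_word_lin)

lemma L_ge_2: "L \<ge> 2"
proof (rule ccontr)
  assume "\<not> L \<ge> 2"
  then have "L = 0 \<or> L = 1" by auto
  then show False using L x3 by auto
qed

lemma l_ge_2: "l \<ge> 2"
proof (rule ccontr)
  assume "\<not> l \<ge> 2"
  then have "l = 0 \<or> l = 1" by auto
  then show False using l L_ge_2 by auto
qed

lemma y_ge_1: "y \<ge> 1" using y x3 by (cases y) auto

lemma y_le_x: "y \<le> x"
  using y(1) y_ge_1 by (metis le_trans le_square)

lemma L_le_x: "L \<le> x"
proof -
  have "L - 1 < 2 ^ (L - 1)" by (rule less_exp)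
  then show ?thesis using L by linarith
qed

lemma pow_l_le: "2 ^ l \<le> 2 * L"
  using l(1) l_ge_2 by (cases l) auto

lemma l_le_L: "l \<le> L"
proof -
  have "l - 1 < 2 ^ (l - 1)" by (rule less_exp)
  then show ?thesis using l by linarith
qed

section \<open>Square root and bit lengths\<close>

lemma wp_sqrt:
  assumes "R rX = int x"
    and Q: "\<And>R' T'. same {rY, rT, rU} R' R \<Longrightarrow> R' rY = int y \<Longrightarrow> T' \<le> T + 20 * y \<Longrightarrow> Q R' M os U T'"
  shows "wp w sqrt_prog Q R M os U T"
proof -
  have sq: "(int k + 2) * (int k + 2) \<le> int x \<longleftrightarrow> k + 1 < y" for k
  proof
    assume "(int k + 2) * (int k + 2) \<le> int x"
    then have "int ((k + 2) * (k + 2)) \<le> int x" by (simp only: of_nat_mult of_nat_add of_nat_numeral)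
    then have "(k + 2) * (k + 2) \<le> x" by (simp only: of_nat_le_iff)
    then have "(k + 2) * (k + 2) < (y + 1) * (y + 1)" using y(2) by linarith
    then have "k + 2 < y + 1" by (metis linorder_not_le mult_le_mono)
    then show "k + 1 < y" by simp
  next
    assume "k + 1 < y"
    then have "(k + 2) * (k + 2) \<le> y * y" by (intro mult_le_mono) auto
    then have "int ((k + 2) * (k + 2)) \<le> int x" using y(1) by (subst of_nat_le_iff) linarith
    then show "(int k + 2) * (int k + 2) \<le> int x" by (simp only: of_nat_mult of_nat_add of_nat_numeral)
  qed
  have iw: "in_word w ((int k + 2) * (int k + 2))" if "k < y" for k
  proof (rule in_word_quad)
    have "(k + 2) * (k + 2) \<le> (x + x) * (x + x)" using that y_le_x x3 by (intro mult_le_mono) auto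
    then have "int ((k + 2) * (k + 2)) \<le> int ((x + x) * (x + x))" by (simp only: of_nat_le_iff)
    then have "(int k + 2) * (int k + 2) \<le> 4 * (int x * int x)" by (simp add: algebra_simps)
    moreover have "int x * int x > 0" using x3 by simp
    ultimately show "(int k + 2) * (int k + 2) < 100 * (int x * int x)" by linarith
    show "- (100 * (int x * int x)) \<le> (int k + 2) * (int k + 2)"
      using \<open>int x * int x > 0\<close> by (simp add: order_trans[of _ 0])
  qed
  show ?thesis unfolding sqrt_prog_def
    apply simp
    apply (rule wp_for_same[where N = "y - 1" and S = "{rY, rT, rU}" and I = "\<lambda>k R' M' os' U' T'.
        R' rY = int (k + 1) \<and> M' = M \<and> os' = os \<and> U' = U \<and> T' \<le> T + 1 + 10 * k"])
    subgoal by simp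
    subgoal for k R' M' os' U' T'
      using y_le_x iw[of k] sq[of k] assms(1)
      by (auto simp: algebra_simps intro!: in_word_lin)
    subgoal for R' M' os' U' T'
      using y_le_x y_ge_1 iw[of "y - 1"] sq[of "y - 1"] assms(1)
      by (auto simp: algebra_simps intro!: in_word_lin Q)
    done
qed

lemma wp_log:
  assumes "a \<notin> {rG, rT, rU, r}" "r \<notin> {rG, rT, rU}" and a: "R a = int v"
    and v: "v \<le> x" "2 ^ (n - 1) \<le> v" "v < 2 ^ n" "v > 0"
    and Q: "\<And>R' T'. same {r, rG, rT, rU} R' R \<Longrightarrow> R' r = int n \<Longrightarrow> R' rG = int (2 ^ n) \<Longrightarrow>
      T' \<le> T + 20 * n \<Longrightarrow> Q R' M os U T'"
  shows "wp w (log_prog a r) Q R M os U T"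
proof -
  have n: "n \<ge> 1" using v by (cases n) auto
  have pow: "2 ^ Suc k \<le> v \<longleftrightarrow> k < n - 1" for k
  proof
    assume "2 ^ Suc k \<le> v"
    then have "(2::nat) ^ Suc k < 2 ^ n" using v by linarith
    then show "k < n - 1" by (subst (asm) power_strict_increasing_iff) auto
  next
    assume "k < n - 1"
    then have "(2::nat) ^ Suc k \<le> 2 ^ (n - 1)" by (intro power_increasing) auto
    then show "2 ^ Suc k \<le> v" using v by linarith
  qed
  have pow': "(2::int) * 2 ^ k < 1 + int v \<longleftrightarrow> k < n - 1" for k
  proof -
    have "(2::int) * 2 ^ k < 1 + int v \<longleftrightarrow> int (2 ^ Suc k) < int (Suc v)" by simp
    also have "\<dots> \<longleftrightarrow> 2 ^ Suc k < Suc v" by (rule of_nat_less_iff)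
    finally show ?thesis using pow[of k] by (simp only: less_Suc_eq_le)
  qed
  have "n - 1 < 2 ^ (n - 1)" by (rule less_exp)
  then have nx: "n \<le> x" using v by linarith
  have iw: "in_word w (2 * (2 * 2 ^ k))" "in_word w (2 + int k)" if "k < n - 1" for k
  proof (rule in_word_lin)
    have "int (2 ^ Suc k) \<le> int x" using pow[of k] that v by (subst of_nat_le_iff) linarith
    then show "2 * (2 * 2 ^ k) \<le> 100 * int x" by simp
    show "- (100 * int x) \<le> 2 * (2 * 2 ^ k)" by (rule order_trans[of _ 0]) auto
    show "in_word w (2 + int k)" using that nx by (intro in_word_lin) auto
  qed
  have iw2: "in_word w (int v + 1)" using v x3 by (intro in_word_lin) auto
  show ?thesis unfolding log_prog_def
    using assms(1,2) apply simp
    apply (rule wp_for_same[where N = "n - 1" and S = "{r, rG, rT, rU}" and I = "\<lambda>k R' M' os' U' T'.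
        R' r = int (k + 1) \<and> R' rG = 2 ^ (k + 1) \<and> M' = M \<and> os' = os \<and> U' = U \<and> T' \<le> T + 2 + 10 * k"])
    subgoal by simp
    subgoal for k R' M' os' U' T'
      using iw[of k] iw2 pow'[of k] a by (auto simp: algebra_simps)
    subgoal for R' M' os' U' T'
      using iw2 pow'[of "n - 1"] a n power_Suc[of "2::int" "n - 1"] by (auto simp: algebra_simps intro!: Q)
    done
qed

section \<open>Generation of the packed prime list\<close>

lemma wp_divisor:
  assumes n: "n \<ge> 2" "n \<le> x" "R rI = int n"
    and Q: "\<And>R' T' d. same {rD, rT, rU} R' R \<Longrightarrow> R' rD = int d \<Longrightarrow> d = n \<longleftrightarrow> prime n \<Longrightarrow> d \<le> n \<Longrightarrow>
      T' \<le> T + 10 * n \<Longrightarrow> Q R' M os U T'"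
  shows "wp w divisor_prog Q R M os U T"
proof -
  \<comment> \<open>Trial division stops at the least divisor from 2 on, after \<open>d - 2\<close>
    rounds; it reaches \<open>n\<close> itself exactly for primes.\<close>
  define d where "d = (LEAST d. 2 \<le> d \<and> d dvd n)"
  have d: "2 \<le> d \<and> d dvd n" unfolding d_def by (rule LeastI[of _ n]) (use n in auto)
  have least: "d \<le> k" if "2 \<le> k" "k dvd n" for k unfolding d_def using that by (intro Least_le) auto
  have "d \<le> n" using least[of n] n by auto
  have dp: "d = n \<longleftrightarrow> prime n"
  proof
    assume "d = n"
    show "prime n" unfolding prime_nat_iff
    proof (intro conjI allI impI)
      fix m assume m: "m dvd n"
      show "m = 1 \<or> m = n"
      proof (cases "m \<ge> 2")
        case True
        then have "n \<le> m" using least[OF True m] \<open>d = n\<close> by simp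
        moreover have "m \<le> n" using m n by (intro dvd_imp_le) auto
        ultimately show ?thesis by simp
      next
        case False
        moreover have "m \<noteq> 0" using m n by (auto intro: gr0I)
        ultimately show ?thesis by auto
      qed
    qed (use n in auto)
  next
    assume "prime n"
    then show "d = n" using d by (auto simp: prime_nat_iff)
  qed
  have nd: "int n mod (2 + int k) \<noteq> 0" if "k < d - 2" for k
  proof
    assume "int n mod (2 + int k) = 0"
    then have "int n mod int (k + 2) = 0" by (simp add: add.commute)
    then have "(k + 2) dvd n" by (metis mod_0_imp_dvd int_dvd_int_iff)
    then have "d \<le> k + 2" by (intro least) auto
    then show False using that by simp
  qed
  have d0: "int n mod int d = 0" using d by (metis dvd_imp_mod_0 int_dvd_int_iff)
  have iw: "in_word w (int n mod (2 + int k))" if "k \<le> n" for k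
  proof (rule in_word_lin)
    have "0 \<le> int n mod (2 + int k)" "int n mod (2 + int k) < 2 + int k" by simp_all
    then show "- (100 * int x) \<le> int n mod (2 + int k)" "int n mod (2 + int k) \<le> 100 * int x" using that n x3 by linarith+
  qed
  show ?thesis unfolding divisor_prog_def
    apply simp
    apply (rule wp_for_same[where N = "d - 2" and S = "{rD, rT, rU}" and I = "\<lambda>k R' M' os' U' T'.
        R' rD = int (k + 2) \<and> M' = M \<and> os' = os \<and> U' = U \<and> T' \<le> T + 1 + 6 * k"])
    subgoal by simp
    subgoal for k R' M' os' U' T'
      using nd[of k] iw[of k] \<open>d \<le> n\<close> n by (auto simp: algebra_simps intro!: in_word_lin)
    subgoal for R' M' os' U' T'
      using d0 d \<open>d \<le> n\<close> n dp by (auto simp: algebra_simps intro!: Q[of _ d])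
    done
qed

text \<open>Larger than \<open>L\<close>, so that breaking gaps at \<open>G\<close> adds only about
  \<open>y / L\<close> entries, and at most \<open>2 * L\<close>, so that an entry still takes only
  \<open>l + 2\<close> bits.\<close>

definition "G = (2::nat) ^ l"
definition "seg = y div (L * l) + 1"

lemma G_bounds: "4 \<le> G" "G \<le> 2 * x" "L < G"
proof -
  have "(2::nat) ^ 2 \<le> 2 ^ l" using l_ge_2 by (rule power_increasing) auto
  then show "4 \<le> G" by (simp add: G_def)
  show "G \<le> 2 * x" using pow_l_le L_le_x by (simp add: G_def)
  show "L < G" using l(2) by (simp add: G_def)
qed

text \<open>\<open>bs\<close> holds the entries of the words already written, \<open>cur\<close>
  those of the word being filled. The inequality with \<open>L - 1\<close> records that a full word
  has at least \<open>(L - 1) / (l + 2)\<close> entries, which later bounds the number of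
  words.\<close>

definition gen_mem :: "nat list list \<Rightarrow> nat list \<Rightarrow> (nat \<Rightarrow> int) \<Rightarrow> (nat \<Rightarrow> int) \<Rightarrow> bool" where
  "gen_mem bs cur R M \<longleftrightarrow> R rN = int (length bs) \<and> (\<forall>i<length bs. M i = int (pack (4 * G) (bs ! i))) \<and>
     (\<forall>i<length bs. pack (4 * G) (bs ! i) < x * (8 * x)) \<and>
     R rW = int (pack (4 * G) cur) \<and> R rB = int ((4 * G) ^ length cur) \<and> (4 * G) ^ length cur < x \<and>
     (L - 1) * length bs \<le> (l + 2) * length (concat bs) \<and> length bs \<le> length (concat bs)"

lemma wp_emit:
  assumes gm: "gen_mem bs cur R M" and cur: "\<And>e. e \<in> set cur \<Longrightarrow> e < 4 * G"
    and R: "R rC = int c" "R rF = of_bool b" "R rX = int x" "R rR = 4 * int G"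
    and e: "e = 2 * c + of_bool b" "e < 4 * G"
    and len: "length (concat bs) \<le> x"
    and Q: "\<And>R' M' U' T' bs' cur'. same {rE, rW, rB, rC, rT, rU, rN} R' R \<Longrightarrow> gen_mem bs' cur' R' M' \<Longrightarrow>
      concat bs' @ cur' = concat bs @ cur @ [e] \<Longrightarrow> R' rC = 0 \<Longrightarrow> U' \<le> max U (length bs') \<Longrightarrow>
      length bs \<le> length bs' \<Longrightarrow> T' \<le> T + 20 \<Longrightarrow> Q R' M' os U' T'"
  shows "wp w emit_prog Q R M os U T"
proof -
  define m where "m = (4 * G) ^ length cur"
  note gm' = gm[unfolded gen_mem_def]
  have m: "m < x" "R rB = int m" "m \<ge> 1" using gm' G_bounds by (auto simp: m_def)
  have pk: "pack (4 * G) cur < m" unfolding m_def using cur by (rule pack_less)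
  have e8: "e < 8 * x" using e(2) G_bounds by linarith
  have "e * m \<le> 8 * x * x" using mult_le_mono[of e "8 * x" m x] e8 m by linarith
  then have "int (e * m) \<le> int (8 * x * x)" by (simp only: of_nat_le_iff)
  then have em: "int e * int m \<le> 8 * (int x * int x)" by simp
  have "m * (4 * G) \<le> x * (8 * x)" using mult_le_mono[of m x "4 * G" "8 * x"] m G_bounds by linarith
  then have "int (m * (4 * G)) \<le> int (x * (8 * x))" by (simp only: of_nat_le_iff)
  then have mG: "int m * (4 * int G) \<le> 8 * (int x * int x)" by simp
  have xx: "int x * int x \<ge> 3 * int x" using x3 by (intro mult_right_mono) auto
  have mG0: "0 \<le> int m * (4 * int G)" by simp
  have em0: "0 \<le> int e * int m" by simp
  have iw: "in_word w (int e)" "in_word w (2 * int c)" "in_word w (int e * int m)"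
      "in_word w (int (pack (4 * G) cur) + int e * int m)" "in_word w (int m * (4 * int G))"
      "in_word w (int (length bs) + 1)"
  proof -
    show "in_word w (int e)" "in_word w (2 * int c)" using e8 e(1) by (auto intro!: in_word_lin)
    show "in_word w (int e * int m)" "in_word w (int (pack (4 * G) cur) + int e * int m)"
      using em xx em0 pk m(1) x3 by (intro in_word_quad; linarith)+
    show "in_word w (int m * (4 * int G))" using mG xx x3 mG0 by (intro in_word_quad; linarith)
    show "in_word w (int (length bs) + 1)" using gm' len x3 by (intro in_word_lin) auto
  qed
  have ce: "int c + int c + of_bool b = int e" "int c + int c = 2 * int c" using e by auto
  have pack_e: "int (pack (4 * G) (cur @ [e])) = int (pack (4 * G) cur) + int e * int m"
    by (simp add: pack_append m_def)
  have pow_e: "int ((4 * G) ^ length (cur @ [e])) = int m * (4 * int G)" by (simp add: m_def)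
  show ?thesis
  proof (cases "m * (4 * G) < x")
    case True
    then have *: "int m * (4 * int G) < int x" by (metis of_nat_less_iff of_nat_mult of_nat_numeral)
    have gm2: "gen_mem bs (cur @ [e]) R' M" if "R' rN = R rN"
      "R' rW = int (pack (4 * G) cur) + int e * int m" "R' rB = int m * (4 * int G)" for R'
      unfolding gen_mem_def pack_e pow_e using that gm' True by (auto simp: m_def mult_ac)
    show ?thesis unfolding emit_prog_def
      using iw R ce m gm' * by (auto intro!: Q[of _ bs "cur @ [e]"] gm2)
  next
    case False
    then have *: "\<not> int m * (4 * int G) < int x" by (metis of_nat_less_iff of_nat_mult of_nat_numeral)
    \<comment> \<open>The word is flushed because its radix power has reached \<open>x\<close>,
      which is at least \<open>2 ^ (L - 1)\<close>, and each entry raises the exponent of 2 by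
      \<open>l + 2\<close>.\<close>
    have Lb: "L - 1 \<le> (l + 2) * Suc (length cur)"
    proof -
      have "(2::nat) ^ (L - 1) \<le> m * (4 * G)" using False L by linarith
      also have "m * (4 * G) = (2 ^ (l + 2)) ^ Suc (length cur)" by (simp add: m_def G_def mult.commute)
      also have "\<dots> = 2 ^ ((l + 2) * Suc (length cur))" by (rule power_mult[symmetric])
      finally show ?thesis by (subst (asm) power_increasing_iff) auto
    qed
    have gm2: "gen_mem (bs @ [cur @ [e]]) [] R' M'" if "R' rN = int (length bs) + 1"
      "R' rW = 0" "R' rB = 1" "M' = M(length bs := int (pack (4 * G) cur) + int e * int m)" for R' M'
    proof -
      have "(L - 1) * length (bs @ [cur @ [e]]) = (L - 1) * length bs + (L - 1)" by simp
      also have "\<dots> \<le> (l + 2) * length (concat bs) + (l + 2) * Suc (length cur)" using Lb gm' by linarith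
      also have "\<dots> = (l + 2) * length (concat (bs @ [cur @ [e]]))" by (simp add: distrib_left)
      finally have "(L - 1) * length (bs @ [cur @ [e]]) \<le> (l + 2) * length (concat (bs @ [cur @ [e]]))" .
      moreover have "pack (4 * G) (cur @ [e]) < x * (8 * x)"
      proof -
        have "pack (4 * G) (cur @ [e]) < (e + 1) * m" using pk by (simp add: pack_append m_def)
        also have "\<dots> \<le> (8 * x) * x" using mult_le_mono[of "e + 1" "8 * x" m x] e8 m by linarith
        finally show ?thesis by (simp add: mult.commute)
      qed
      ultimately show ?thesis
        unfolding gen_mem_def using that gm' x3 pack_e by (auto simp: nth_append less_Suc_eq)
    qed
    show ?thesis unfolding emit_prog_def flush_prog_def
      using iw R ce m gm' * by (auto intro!: Q[of _ "bs @ [cur @ [e]]" "[]"] gm2)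
  qed
qed

end

lemma entries_okD:
  assumes "entries_ok G es" "e \<in> set es"
  shows "2 \<le> e" "e \<le> 2 * G + 1"
  using assms unfolding entries_ok_def by blast+

lemma entries_ok_append: "entries_ok G (es @ fs) \<longleftrightarrow> entries_ok G es \<and> entries_ok G fs"
  unfolding entries_ok_def set_append by blast

context sieve
begin

text \<open>A candidate costs at most \<open>10 * y + 60\<close> steps, mostly for trial division.
  The last flush may write a word that is not full, whence the extra \<open>L - 1\<close> in the
  bound on the number of words.\<close>

lemma wp_gen:
  assumes R: "R rX = int x" "R rY = int y" "R rG = int G" "R rR = 4 * int G"
    and Q: "\<And>R' M' U' T' bs. same {rN, rW, rB, rC, rI, rD, rF, rE, rT, rU} R' R \<Longrightarrow> R' rN = int (length bs) \<Longrightarrow>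
      \<forall>i<length bs. M' i = int (pack (4 * G) (bs ! i)) \<Longrightarrow> entries_ok G (concat bs) \<Longrightarrow>
      decode_entries 1 (concat bs) = primes_upto y \<Longrightarrow> 1 + advance (concat bs) \<le> y \<Longrightarrow>
      (L - 1) * length bs \<le> (l + 2) * length (concat bs) + (L - 1) \<Longrightarrow> length bs \<le> x + 1 \<Longrightarrow>
      \<forall>i<length bs. pack (4 * G) (bs ! i) < x * (8 * x) \<Longrightarrow>
      U' \<le> max U (length bs) \<Longrightarrow> T' \<le> T + 20 + y * (10 * y + 60) \<Longrightarrow> Q R' M' os U' T'"
  shows "wp w gen_prog Q R M os U T"
proof -
  let ?S = "{rN, rW, rB, rC, rI, rD, rF, rE, rT, rU}"
  define I where "I = (\<lambda>k R' M' os' U' T'. os' = os \<and> R' rI = int (k + 2) \<and>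
     T' \<le> T + 5 + k * (10 * y + 60) \<and>
     (\<exists>bs cur c. gen_mem bs cur R' M' \<and> R' rC = int c \<and> gen_inv G (k + 2) (concat bs @ cur) c \<and>
        U' \<le> max U (length bs)))"
  have body: "wp w gen_step_prog (\<lambda>R' M' os' U' T'. same ?S R' R \<and> I (Suc k) R' M' os' U' (Suc T')) R1 M1 os1 U1 T1"
    if k: "k + 2 \<le> y" and same: "same ?S R1 R" and I1: "os1 = os" "R1 rI = int (k + 2)"
      "T1 \<le> T + 9 + k * (10 * y + 60)" and gm: "gen_mem bs cur R1 M1" and rC: "R1 rC = int c"
      and gi: "gen_inv G (k + 2) (concat bs @ cur) c" and U1: "U1 \<le> max U (length bs)"
    for k R1 M1 os1 U1 T1 bs cur c
  proof -
    have kx: "k + 2 \<le> x" using k y_le_x by simp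
    have c: "c < G" and adv: "2 + advance (concat bs @ cur) + c = k + 2"
      and ok: "entries_ok G (concat bs @ cur)"
      using gi by (auto simp: gen_inv_def)
    have len: "length (concat bs) \<le> x"
      using advance_ge_length[OF ok] adv kx by simp
    have cur: "e < 4 * G" if "e \<in> set cur" for e
      using entries_okD(2)[OF ok, of e] that G_bounds by simp
    have gmR: "gen_mem bs cur R' M1" if "R' rN = R1 rN" "R' rW = R1 rW" "R' rB = R1 rB" for R'
      using gm that by (simp add: gen_mem_def)
    show ?thesis unfolding gen_step_prog_def
      apply (simp add: rC)
      apply (intro conjI)
      subgoal using adv kx by (intro in_word_lin) auto
      apply (rule wp_divisor[where n = "k + 2"])
      subgoal by simp
      subgoal using kx by simp
      subgoal using I1 by simp
      subgoal premises p for R2 T2 d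
      proof -
        note f2 = sameD[OF p(1)]
        have [simp]: "R2 rI = int (k + 2)" "R2 rG = int G" "R2 rC = int c + 1" "R2 rX = int x" "R2 rR = 4 * int G"
          using f2 sameD[OF same] I1 R by auto
        have s2: "same ?S R2 R" using same by (intro same_trans[OF p(1)]) auto
        have T2: "T2 + 40 \<le> T + 5 + Suc k * (10 * y + 60)"
          using p(5) I1(3) k by simp
        define b where "b = prime (k + 2)"
        have "R2 rD = 2 + int k \<longleftrightarrow> int d = int (k + 2)" using p(2) by simp
        then have F: "R2 rD = 2 + int k \<longleftrightarrow> b" using p(3) unfolding b_def of_nat_eq_iff by auto
        have iw: "in_word w (int c + 1)" "in_word w (int (k + 2) + 1)"
          using adv kx by (auto intro!: in_word_lin)
        have F2: "int c + 1 = int G \<longleftrightarrow> Suc c = G" by auto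
        show ?thesis
        proof (cases "b \<or> Suc c = G")
          case False
          have gi': "gen_inv G (Suc k + 2) (concat bs @ cur) (Suc c)"
            using gen_inv_skip[OF gi] False by (simp add: b_def)
          have "\<not> b" "Suc c \<noteq> G" using False by auto
          then show ?thesis using s2 T2 iw U1 gi' gmR f2
            apply (simp add: F F2 I_def I1(1))
            apply (rule exI[of _ bs], rule exI[of _ cur], intro conjI)
             apply (rule gmR; simp)
            apply (rule exI[of _ "Suc c"])
            apply simp
            done
        next
          case True
          have gi': "gen_inv G (Suc k + 2) (concat bs @ cur @ [2 * Suc c + of_bool b]) 0"
            using gen_inv_emit[OF gi] True by (simp add: b_def)
          have e: "2 * Suc c + of_bool b < 4 * G" using c G_bounds by (cases b) auto
          have emit: "wp w emit_prog (\<lambda>R' M' os' U' T'. in_word w (R' rI + 1) \<and>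
               same ?S R' R \<and> I (Suc k) (R'(rU := 1, rI := R' rI + 1)) M' os' U' (Suc (Suc (Suc (Suc T'))))) R' M1 os U1 (Suc (Suc (Suc (Suc T2))))"
            if R': "R' rC = int (Suc c)" "R' rF = of_bool b" "R' rX = int x" "R' rR = 4 * int G"
              "R' rN = R1 rN" "R' rW = R1 rW" "R' rB = R1 rB" "R' rI = int (k + 2)" and same': "same ?S R' R" for R'
            apply (rule wp_emit[OF gmR[OF R'(5-7)] cur R'(1-4) refl e len])
             apply assumption
            subgoal premises q for R3 M3 U3 T3 bs' cur'
            proof -
              have "R3 rI = int (k + 2)" using sameD[OF q(1)] R'(8) by simp
              moreover have "same ?S R3 R" using same' by (intro same_trans[OF q(1)]) auto
              moreover have "gen_mem bs' cur' (R3(rU := 1, rI := v)) M3" for v using q(2) by (simp add: gen_mem_def)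
              ultimately show ?thesis using iw q(3-) gi' U1 T2
                apply (simp add: I_def)
                apply (rule exI[of _ bs'], rule exI[of _ cur'])
                apply simp
                done
            qed
            done
          show ?thesis using True iw F F2 f2 s2
            apply (cases b; cases "Suc c = G")
            apply (simp_all add: I1(1))
            apply (rule wp_mono[OF emit]; simp add: add.commute)+
            done
        qed
      qed
      done
  qed
  have gm0: "gen_mem [] [] R' M" if "R' rN = 0" "R' rW = 0" "R' rB = 1" for R'
    using that x3 by (simp add: gen_mem_def)
  have gi0: "gen_inv G (Suc (Suc 0)) [] 0" using G_bounds by (simp add: gen_inv_def entries_ok_def advance_def)
  have fin: "wp w flush_prog Q R1 M1 os U1 T1"
    if same: "same ?S R1 R" and gm: "gen_mem bs cur R1 M1"
      and gi: "gen_inv G (y + 1) (concat bs @ cur) c" and U1: "U1 \<le> max U (length bs)"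
      and T1: "T1 \<le> T + 10 + y * (10 * y + 60)" for R1 M1 U1 T1 bs cur c
  proof -
    note gm' = gm[unfolded gen_mem_def]
    have adv: "1 + advance (concat bs @ cur) \<le> y" and ok: "entries_ok G (concat bs @ cur)"
      and dec: "decode_entries 1 (concat bs @ cur) = primes_upto y"
      using gi by (auto simp: gen_inv_def primes_upto_def)
    have len: "length bs \<le> x"
      using advance_ge_length[OF ok] adv gm' y_le_x by simp
    have iw: "in_word w (int (length bs) + 1)" using len x3 by (intro in_word_lin) auto
    have mem: "\<forall>i<length (bs @ [cur]). (M1(length bs := R1 rW)) i = int (pack (4 * G) ((bs @ [cur]) ! i))"
      using gm' by (auto simp: nth_append less_Suc_eq)
    have "pack (4 * G) cur < (4 * G) ^ length cur"
      using entries_okD(2)[OF ok] G_bounds by (intro pack_less) fastforce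
    also have "\<dots> < x" using gm' by simp
    also have "x \<le> x * (8 * x)" using x3 by simp
    finally have pk: "\<forall>i<length (bs @ [cur]). pack (4 * G) ((bs @ [cur]) ! i) < x * (8 * x)"
      using gm' by (auto simp: nth_append less_Suc_eq)
    have "(L - 1) * length (bs @ [cur]) \<le> (l + 2) * length (concat bs) + (L - 1)" using gm' by simp
    also have "\<dots> \<le> (l + 2) * length (concat (bs @ [cur])) + (L - 1)" by (simp add: distrib_left)
    finally have Ln: "(L - 1) * length (bs @ [cur]) \<le> (l + 2) * length (concat (bs @ [cur])) + (L - 1)" .
    show ?thesis unfolding flush_prog_def
      using gm' iw same U1 T1
      apply simp
      apply (rule Q[of _ "bs @ [cur]"])
      using mem ok dec adv Ln len pk by simp_all
  qed
    show ?thesis unfolding gen_prog_def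
      apply simp
      apply (rule wp_for_same[where N = "y - 1" and S = ?S and I = I])
      subgoal unfolding I_def by (auto intro!: exI[of _ "[]"] gm0 gi0)
      subgoal premises p for k R1 M1 os1 U1 T1
      proof -
        have iw: "in_word w (1 + int y)" using y_le_x x3 by (intro in_word_lin) auto
        from p(4) obtain bs cur c where *: "os1 = os" "R1 rI = int (k + 2)"
          "T1 \<le> T + 5 + k * (10 * y + 60)" "gen_mem bs cur R1 M1" "R1 rC = int c"
          "gen_inv G (k + 2) (concat bs @ cur) c" "U1 \<le> max U (length bs)" unfolding I_def by blast
        have "gen_mem bs cur (R1(rU := 1, rT := 1)) M1" using *(4) by (simp add: gen_mem_def)
        note gm1 = this
        have [simp]: "R1 rY = int y" "int y + 1 = 1 + int y" using p(3)[of rY] R(2) by simp_all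
        have [simp]: "1 + int k < int y" "Suc (Suc k) \<le> y" using p(1) by simp_all
        show ?thesis using p(2) *(1-3,5) iw
          apply simp
          apply (rule body[OF _ _ _ _ _ gm1 _ *(6,7)])
          apply simp_all
          done
      qed
      subgoal premises p for R1 M1 os1 U1 T1
      proof -
        have iw: "in_word w (1 + int y)" using y_le_x x3 by (intro in_word_lin) auto
        from p(3) obtain bs cur c where *: "os1 = os" "R1 rI = int (y - 1 + 2)"
          "T1 \<le> T + 5 + (y - 1) * (10 * y + 60)" "gen_mem bs cur R1 M1" "R1 rC = int c"
          "gen_inv G (y - 1 + 2) (concat bs @ cur) c" "U1 \<le> max U (length bs)" unfolding I_def by blast
        have "gen_mem bs cur (R1(rU := 1, rT := 0)) M1" using *(4) by (simp add: gen_mem_def)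
        note gm1 = this
        have "(y - 1) * (10 * y + 60) \<le> y * (10 * y + 60)" by (rule mult_le_mono1) simp
        then have t: "T1 + 4 \<le> T + 10 + y * (10 * y + 60)" using *(3) by linarith
        have "gen_inv G (y + 1) (concat bs @ cur) c" using *(6) y_ge_1 by simp
        note F = fin[OF _ gm1 this *(7)]
        have "R1 rI = int (y + 1)" using *(2) y_ge_1 by simp
        then have [simp]: "R1 rY = int y" "int y + 1 = 1 + int y" "R1 rI = 1 + int y"
          using p(2)[of rY] R(2) by simp_all
        show ?thesis using p(1) *(1) iw t
          apply simp
          apply (rule F)
          apply simp_all
          done
      qed
      done
qed


section \<open>Sieving one segment\<close>

lemma seg_bounds: "1 \<le> seg" "seg \<le> y" "seg \<le> x"
proof -
  show "1 \<le> seg" by (simp add: seg_def)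
  have "L * l \<ge> 2 * 1" using L_ge_2 l_ge_2 by (intro mult_le_mono) auto
  then have "y div (L * l) \<le> y div 2" by (intro div_le_mono2) auto
  then show "seg \<le> y" using y_ge_1 unfolding seg_def by linarith
  then show "seg \<le> x" using y_le_x by simp
qed

definition cells :: "nat \<Rightarrow> (nat \<Rightarrow> nat list) \<Rightarrow> (nat \<Rightarrow> int) \<Rightarrow> bool" where
  "cells N F M \<longleftrightarrow> (\<forall>j<seg. encodes (F j) (M (N + 2 * j)) (M (N + 2 * j + 1)))"

lemma nat_cell [simp]:
  "nat (2 * int j + int N) = N + 2 * j" "nat (2 * int j + int N + 1) = N + 2 * j + 1"
  by (auto simp: nat_add_distrib nat_mult_distrib)

lemma wp_clear:
  assumes R: "R rM = int seg" "R rN = int N" "N \<le> x + 1"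
    and Q: "\<And>R' M' U' T'. same {rJ, rE, rT, rP, rU} R' R \<Longrightarrow> \<forall>i<N. M' i = M i \<Longrightarrow>
      cells N (\<lambda>_. []) M' \<Longrightarrow> U' \<le> max U (N + 2 * seg) \<Longrightarrow> T' \<le> T + 20 * seg \<Longrightarrow> Q R' M' os U' T'"
  shows "wp w clear_prog Q R M os U T"
  unfolding clear_prog_def
  apply simp
  apply (rule wp_for_same[where N = seg and S = "{rJ, rE, rT, rP, rU}" and I = "\<lambda>k R' M' os' U' T'. os' = os \<and>
     R' rJ = int k \<and> R' rE = 0 \<and> (\<forall>i<N. M' i = M i) \<and> (\<forall>j<k. M' (N + 2 * j) = 0 \<and> M' (N + 2 * j + 1) = 0) \<and>
     U' \<le> max U (N + 2 * k) \<and> T' \<le> T + 2 + 14 * k"])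
  subgoal by simp
  subgoal premises p for k R' M' os' U' T'
  proof -
    have iw: "in_word w (2 * int k + int N)" "in_word w (2 * int k + int N + 1)" "in_word w (int k + 1)" "in_word w (2 * int k)"
      using p(1) seg_bounds R(3) x3 by (auto intro!: in_word_lin)
    have "R' rM = int seg" "R' rN = int N" using p(3) R by simp_all
    then show ?thesis using p(1,2,4) iw by (auto simp: less_Suc_eq) 
  qed
  subgoal premises p for R' M' os' U' T'
  proof -
    have "R' rM = int seg" "R' rN = int N" using p(2) R by simp_all
    then show ?thesis using p(1,3) seg_bounds by (auto intro!: Q simp: cells_def encodes_Nil)
  qed
  done

lemma sq_le_4: "n \<le> 2 * x \<Longrightarrow> int n * int n \<le> 4 * (int x * int x)"
proof -
  assume "n \<le> 2 * x"
  then have "n * n \<le> (2 * x) * (2 * x)" by (intro mult_le_mono)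
  then have "int (n * n) \<le> int ((2 * x) * (2 * x))" by (simp only: of_nat_le_iff)
  then show ?thesis by simp
qed

text \<open>The range is \<open>2 * x\<close> rather than \<open>x\<close> because the last segment
  may extend beyond \<open>x\<close> and all of its cells are marked.\<close>

lemma in_word_encodes:
  assumes "encodes ps C K" "distinct ps" "\<And>p. p \<in> set ps \<Longrightarrow> prime p \<and> p dvd n" "n > 0" "n \<le> 2 * x"
  shows "in_word w C" "in_word w K" "in_word w (K + 1)"
proof -
  have b: "C < int n * int n" "K < 2 * (int n * int n)"
    using encodes_primes_bounds[OF assms(1-4)] by (auto simp: mult.assoc)
  note n2 = sq_le_4[OF assms(5)]
  have "0 \<le> C" "0 \<le> K" using encodes_nonneg[OF assms(1)] by auto
  moreover have "int x * int x \<ge> 1 * 1" using x3 by (intro mult_mono) auto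
  ultimately show "in_word w C" "in_word w K" "in_word w (K + 1)" using b n2 by (intro in_word_quad; linarith)+
qed

lemma wp_mark:
  assumes R: "R rM = int seg" "R rN = int N" "R rA = int a" "R rV = int v" "R rQ = 2 ^ q"
    and N: "N \<le> x + 1" and a: "1 \<le> a" "a \<le> x" and v: "prime v" "v \<le> x" "v < 2 ^ q" "2 ^ q \<le> 2 * v"
    and cells: "cells N F M" and F: "\<And>j. j < seg \<Longrightarrow> distinct (v # F j)"
      "\<And>j p. j < seg \<Longrightarrow> p \<in> set (F j) \<Longrightarrow> prime p \<and> p dvd a + j"
    and Q: "\<And>R' M' U' T'. same {rJ, rE, rT, rP, rU} R' R \<Longrightarrow> \<forall>i<N. M' i = M i \<Longrightarrow>
      cells N (\<lambda>j. if v dvd a + j then v # F j else F j) M' \<Longrightarrow> U' \<le> max U (N + 2 * seg) \<Longrightarrow>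
      T' \<le> T + 10 + 20 * (seg div v + 1) \<Longrightarrow> Q R' M' os U' T'"
  shows "wp w mark_prog Q R M os U T"
proof -
  have v0: "v > 0" using v by (simp add: prime_gt_0_nat)
  \<comment> \<open>The index of the first multiple of \<open>v\<close> in the segment that starts
    at \<open>a\<close>, if the segment reaches that far.\<close>
  define j0 where "j0 = nat ((- int a) mod int v)"
  have j0: "int j0 = (- int a) mod int v" using v0 by (simp add: j0_def)
  have j0v: "j0 < v" using v0 j0 by (metis of_nat_0_less_iff of_nat_less_iff pos_mod_bound)
  have "int v dvd - int a - (- int a) mod int v" by (rule dvd_minus_mod)
  then have "int v dvd - int (a + j0)" using j0 by simp
  then have dvd0: "v dvd a + j0" by (simp only: dvd_minus_iff int_dvd_int_iff)
  have nodvd: "\<not> v dvd a + i" if "v dvd a + j" "j < i" "i < j + v" for i j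
  proof
    assume "v dvd a + i"
    then have "v dvd (a + i) - (a + j)" using that(1) by (rule dvd_diff_nat)
    then have "v \<le> i - j" using that by (intro dvd_imp_le) auto
    then show False using that by auto
  qed
  have nodvd0: "\<not> v dvd a + i" if "i < j0" for i
  proof
    assume "v dvd a + i"
    then have "v dvd (a + j0) - (a + i)" using dvd0 by (intro dvd_diff_nat)
    then have "v \<le> j0 - i" using that by (intro dvd_imp_le) auto
    then show False using j0v that by auto
  qed
  \<comment> \<open>The number of multiples of \<open>v\<close> in the segment, hence of
    rounds.\<close>
  define H where "H = (LEAST k. seg \<le> j0 + k * v)"
  have ex: "seg \<le> j0 + (seg div v + 1) * v"
    using div_mult_mod_eq[of seg v] mod_less_divisor[OF v0, of seg]
    unfolding add_mult_distrib mult_1 by linarith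
  have H: "seg \<le> j0 + H * v" unfolding H_def by (rule LeastI[of _ "seg div v + 1"]) (rule ex)
  have Hle: "H \<le> seg div v + 1" unfolding H_def by (rule Least_le) (rule ex)
  have Hlt: "j0 + k * v < seg" if "k < H" for k using not_less_Least[OF that[unfolded H_def]] by simp
  \<comment> \<open>After \<open>k\<close> rounds exactly the cells before the next multiple
    \<open>j0 + k * v\<close> are up to date.\<close>
  define F' where "F' k j = (if j < j0 + k * v \<and> v dvd a + j then v # F j else F j)" for k j
  have iwA: "in_word w (- int a)" using a by (intro in_word_lin) auto
  have iwQ: "in_word w (int j0)" using j0v v x3 by (intro in_word_lin) auto
  show ?thesis unfolding mark_prog_def
    apply (simp add: R j0[symmetric] iwA iwQ v0)
    apply (rule wp_for_same[where N = H and S = "{rJ, rE, rT, rP, rU}" and I = "\<lambda>k R' M' os' U' T'. os' = os \<and>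
       R' rJ = int (j0 + k * v) \<and> (\<forall>i<N. M' i = M i) \<and> cells N (F' k) M' \<and>
       U' \<le> max U (N + 2 * seg) \<and> T' \<le> T + 5 + 18 * k"])
    subgoal using cells nodvd0 by (auto simp: F'_def cells_def)
    subgoal premises p for k R' M' os' U' T'
    proof -
      define j where "j = j0 + k * v"
      have j: "j < seg" using Hlt[OF p(1)] by (simp add: j_def)
      have rJ: "R' rJ = int j" using p(4) by (simp add: j_def)
      have Rs: "R' rM = int seg" "R' rN = int N" "R' rV = int v" "R' rQ = 2 ^ q" using p(3) R by simp_all
      define C where "C = M' (N + 2 * j)"
      define K where "K = M' (N + 2 * j + 1)"
      have Fj: "F' k j = F j" by (simp add: F'_def j_def)
      have vj: "v dvd a + j" using dvd0 by (simp add: j_def add.assoc[symmetric])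
      have enc: "encodes (F j) C K" using p(4) j Fj by (auto simp: cells_def C_def K_def)
      have enc': "encodes (v # F j) (C * 2 ^ q + int v) ((K + 1) * 2 ^ q)"
        using enc v by (intro encodes_Cons) auto
      have nj: "a + j \<le> 2 * x" using a j seg_bounds by simp
      have iw1: "in_word w C" "in_word w K" "in_word w (K + 1)"
        using in_word_encodes[OF enc, of "a + j"] F[OF j] nj a by auto
      have pr: "\<And>p. p \<in> set (v # F j) \<Longrightarrow> prime p \<and> p dvd a + j" using F(2)[OF j] v vj by auto
      have iw2: "in_word w (C * 2 ^ q + int v)" "in_word w ((K + 1) * 2 ^ q)"
        using in_word_encodes[OF enc' F(1)[OF j] pr] nj a by auto
      have "0 \<le> C * 2 ^ q" using encodes_nonneg[OF enc] by simp
      then have iw3: "in_word w (C * 2 ^ q)" using iw2(1) unfolding in_word_def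
        by (smt (verit) of_nat_0_le_iff zero_le_power)
      have iw4: "in_word w (2 * int j + int N)" "in_word w (2 * int j + int N + 1)" "in_word w (int j + int v)" "in_word w (2 * int j)"
        using j seg_bounds N v x3 by (auto intro!: in_word_lin)
      define M2 where "M2 = M'(N + 2 * j := C * 2 ^ q + int v, N + 2 * j + 1 := (K + 1) * 2 ^ q)"
      have cells2: "cells N (F' (Suc k)) M2"
        unfolding cells_def
      proof (intro allI impI)
        fix i assume i: "i < seg"
        show "encodes (F' (Suc k) i) (M2 (N + 2 * i)) (M2 (N + 2 * i + 1))"
        proof (cases "i = j")
          case True
          have "F' (Suc k) j = v # F j" using vj v0 by (simp add: F'_def j_def)
          then show ?thesis using enc' True by (simp add: M2_def)
        next
          case False
          have 1: "M2 (N + 2 * i) = M' (N + 2 * i)" "M2 (N + 2 * i + 1) = M' (N + 2 * i + 1)"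
            using False by (auto simp: M2_def)
          have "j < i \<Longrightarrow> i < j + v \<Longrightarrow> \<not> v dvd a + i" by (rule nodvd[OF vj])
          moreover have "j0 + Suc k * v = j + v" by (simp add: j_def)
          ultimately have "F' (Suc k) i = F' k i" using False
            unfolding F'_def j_def[symmetric] by (cases "i < j") auto
          then show ?thesis using p(4) i unfolding 1 by (auto simp: cells_def)
        qed
      qed
      have MN: "\<forall>i<N. M2 i = M i" using p(4) by (auto simp: M2_def)
      have jk: "int j + int v = int j0 + (int v + int k * int v)" by (simp add: j_def)
      from p(4) have st: "os' = os" "U' \<le> max U (N + 2 * seg)" "T' \<le> T + 5 + 18 * k" by auto
      show ?thesis using p(2) st Rs rJ iw1 iw2 iw3 iw4 j cells2 MN
        unfolding C_def K_def M2_def 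
          apply (simp add: jk)
          apply (auto simp: le_max_iff_disj)
          done
    qed
    subgoal premises p for R' M' os' U' T'
    proof -
      have Rs: "R' rM = int seg" using p(2) R by simp_all
      have "\<not> int (j0 + H * v) < int seg" using H by linarith
      moreover have "cells N (\<lambda>j. if v dvd a + j then v # F j else F j) M'"
        using p(3) H by (auto simp: cells_def F'_def)
      ultimately show ?thesis using p(1,3) Rs Hle by (auto intro!: Q)
    qed
    done
qed

text \<open>Amortized: the cost is charged to the growth of the exponent from \<open>q\<close> to
  \<open>q'\<close>, so that it telescopes over all entries of a pass instead of being paid for each
  of them.\<close>

lemma wp_double:
  assumes R: "R rV = int v" "R rQ = 2 ^ q" and v: "2 ^ q \<le> 2 * v" "v \<le> x"
    and Q: "\<And>R' T' q'. same {rQ, rT, rU} R' R \<Longrightarrow> R' rQ = 2 ^ q' \<Longrightarrow> q \<le> q' \<Longrightarrow> v < 2 ^ q' \<Longrightarrow> 2 ^ q' \<le> 2 * v \<Longrightarrow>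
      T' + 10 * q \<le> T + 10 + 10 * q' \<Longrightarrow> Q R' M os U T'"
  shows "wp w double_prog Q R M os U T"
proof -
  define H where "H = (LEAST k. v < 2 ^ (q + k))"
  have "v < 2 ^ v" by (rule less_exp)
  also have "(2::nat) ^ v \<le> 2 ^ (q + v)" by (rule power_increasing) auto
  finally have ex: "v < 2 ^ (q + v)" .
  have H: "v < 2 ^ (q + H)" unfolding H_def by (rule LeastI[of _ v]) (rule ex)
  have Hlt: "2 ^ (q + k) \<le> v" if "k < H" for k using not_less_Least[OF that[unfolded H_def]] by simp
  have H2: "2 ^ (q + H) \<le> 2 * v"
  proof (cases H)
    case 0
    then show ?thesis using v by simp
  next
    case (Suc k)
    then show ?thesis using Hlt[of k] by simp
  qed
  have cond: "(2::int) ^ (q + k) < int v + 1 \<longleftrightarrow> 2 ^ (q + k) \<le> v" for k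
  proof -
    have "int (2 ^ (q + k)) < int (Suc v) \<longleftrightarrow> 2 ^ (q + k) \<le> v"
      by (simp only: of_nat_less_iff less_Suc_eq_le)
    then show ?thesis by (simp only: of_nat_power of_nat_numeral of_nat_Suc add.commute)
  qed
  have iw: "in_word w (2 * 2 ^ (q + k))" if "k < H" for k
  proof (rule in_word_lin)
    have "int (2 ^ (q + k)) \<le> int v" using Hlt[OF that] by (simp only: of_nat_le_iff)
    then have "(2::int) ^ (q + k) \<le> int v" by (simp only: of_nat_power of_nat_numeral)
    then show "2 * 2 ^ (q + k) \<le> 100 * int x" using v by linarith
    show "- (100 * int x) \<le> 2 * 2 ^ (q + k)" by (rule order_trans[of _ 0]) auto
  qed
  have iw2: "in_word w (int v + 1)" using v x3 by (intro in_word_lin) auto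
  show ?thesis unfolding double_prog_def
    apply (rule wp_for_same[where N = H and S = "{rQ, rT, rU}" and I = "\<lambda>k R' M' os' U' T'. os' = os \<and> M' = M \<and> U' = U \<and>
       R' rQ = 2 ^ (q + k) \<and> T' \<le> T + 8 * k"])
    subgoal using R by simp
    subgoal premises p for k R' M' os' U' T'
    proof -
      have "R' rV = int v" using p(3) R by simp
      moreover have "(2::int) ^ (q + k) < int v + 1" using cond Hlt[OF p(1)] by simp
      ultimately show ?thesis using p(2,4) iw[OF p(1)] iw2 by simp
    qed
    subgoal premises p for R' M' os' U' T'
    proof -
      have "R' rV = int v" using p(2) R by simp
      moreover have "\<not> (2::int) ^ (q + H) < int v + 1" using cond H by simp
      ultimately show ?thesis using p(1,3) H H2 iw2 by (auto intro!: Q[of _ "q + H"])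
    qed
    done
qed


text \<open>Among \<open>seg\<close> consecutive numbers at most \<open>seg div p + 1\<close> are
  multiples of \<open>p\<close>. The bound is therefore the same for every segment.\<close>

definition sieve_time :: "nat list \<Rightarrow> nat" where
  "sieve_time es = 60 * length es + sum_list (map (\<lambda>p. 30 + 20 * (seg div p + 1)) (decode_entries 1 es))"

lemma sieve_time_append:
  "sieve_time (es @ [e]) = sieve_time es + 60 +
     (if odd e then 30 + 20 * (seg div (1 + advance es + e div 2) + 1) else 0)"
  by (simp add: sieve_time_def decode_entries_append)

text \<open>The term \<open>10 * q\<close> pays for all doublings of \<open>rQ\<close> made so far.\<close>

definition sieve_inv :: "nat \<Rightarrow> nat \<Rightarrow> (nat \<Rightarrow> int) \<Rightarrow> nat \<Rightarrow> nat \<Rightarrow> nat list \<Rightarrow> nat \<Rightarrow>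
    (nat \<Rightarrow> int) \<Rightarrow> (nat \<Rightarrow> int) \<Rightarrow> nat \<Rightarrow> nat \<Rightarrow> bool" where
  "sieve_inv N a M0 U0 T0 ds c R M U T \<longleftrightarrow> (\<exists>q. R rV = int (1 + advance ds) \<and> R rQ = 2 ^ q \<and>
     2 ^ q \<le> 2 * (1 + advance ds) \<and> 1 + advance ds < 2 ^ q \<and>
     (\<forall>i<N. M i = M0 i) \<and> cells N (\<lambda>j. divisors_in (decode_entries 1 ds) (a + j)) M \<and>
     U \<le> max U0 (N + 2 * seg) \<and> T \<le> T0 + c + sieve_time ds + 10 * q)"

text \<open>The result holds with ten steps in reserve. The loop of \<open>wp_word\<close> spends
  them on splitting off the entry and on its jumps, so that its own invariant can keep
  \<open>c\<close> fixed.\<close>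

lemma wp_entry:
  assumes R: "R rM = int seg" "R rN = int N" "R rA = int a"
    and N: "N \<le> x + 1" and a: "1 \<le> a" "a \<le> x"
    and e: "R rE = int e" and adv: "1 + advance (ds @ [e]) \<le> y"
    and dec: "\<And>p. p \<in> set (decode_entries 1 (ds @ [e])) \<Longrightarrow> prime p" "distinct (decode_entries 1 (ds @ [e]))"
    and inv: "sieve_inv N a M0 U0 T0 ds c R M U T"
    and Q: "\<And>R' M' U' T'. same {rJ, rE, rT, rP, rU, rV, rQ} R' R \<Longrightarrow>
      sieve_inv N a M0 U0 T0 (ds @ [e]) c R' M' U' (T' + 10) \<Longrightarrow> Q R' M' os U' T'"
  shows "wp w entry_prog Q R M os U T"
proof -
  define v where "v = 1 + advance (ds @ [e])"
  have v: "v = 1 + advance ds + e div 2" "v \<le> y" using adv by (auto simp: v_def advance_def)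
  have vx: "v \<le> x" using v y_le_x by simp
  from inv obtain q where q: "R rV = int (1 + advance ds)" "R rQ = 2 ^ q"
     "2 ^ q \<le> 2 * (1 + advance ds)" "\<forall>i<N. M i = M0 i"
     "cells N (\<lambda>j. divisors_in (decode_entries 1 ds) (a + j)) M"
     "U \<le> max U0 (N + 2 * seg)" "T \<le> T0 + c + sieve_time ds + 10 * q"
    by (auto simp: sieve_inv_def)
  have decv: "decode_entries 1 (ds @ [e]) = decode_entries 1 ds @ (if odd e then [v] else [])"
    by (simp add: decode_entries_append v)
  have iw: "in_word w (int e div 2)" "in_word w (int v)" "in_word w (int e mod 2)"
  proof -
    have "int e div 2 = int (e div 2)" by simp
    then show "in_word w (int e div 2)" using v vx by (intro in_word_lin) auto
    show "in_word w (int v)" using vx by (intro in_word_lin) auto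
    have "int e mod 2 = 0 \<or> int e mod 2 = 1" by presburger
    then show "in_word w (int e mod 2)" by auto
  qed
  have vv: "1 + int (advance ds) + int e div 2 = int v" using v by simp
  have "wp w double_prog (\<lambda>R' M' os' U' T'. wp w (const rU 2 ;; arith Mod rT rE rU ;; Cond rT mark_prog skip) Q R' M' os' U' T')
      (R(rU := 2, rT := int e div 2, rV := int v)) M os U (Suc (Suc (Suc T)))"
  proof (rule wp_double[where v = v and q = q])
    fix R' T' q'
    assume same: "same {rQ, rT, rU} R' (R(rU := 2, rT := int e div 2, rV := int v))"
      and q': "R' rQ = 2 ^ q'" "q \<le> q'" "v < 2 ^ q'" "2 ^ q' \<le> 2 * v"
      and T': "T' + 10 * q \<le> Suc (Suc (Suc T)) + 10 + 10 * q'"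
    have R': "R' rM = int seg" "R' rN = int N" "R' rA = int a" "R' rV = int v" "R' rE = int e"
      using sameD[OF same] R e by simp_all
    have s2: "same {rJ, rE, rT, rP, rU, rV, rQ} R' R" using same by (intro same_trans[OF same]) auto
    show "wp w (const rU 2 ;; arith Mod rT rE rU ;; Cond rT mark_prog skip) Q R' M os U T'"
    proof (cases "odd e")
      case True
      then have od: "int e mod 2 = 1" by presburger
      have pv: "prime v" using dec(1)[of v, unfolded decv] True by simp
      show ?thesis
        apply (simp add: R' od iw)
        apply (rule wp_mark[OF _ _ _ _ _ N a pv vx q'(3,4) q(5)])
        using R' q' apply simp_all[5]
        subgoal for j using dec(2)[unfolded decv] True by (auto simp: divisors_in_def)
        subgoal for j p using dec(1)[of p, unfolded decv] by (auto simp: divisors_in_def)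
        subgoal premises p for R2 M2 U2 T2
        proof (rule Q)
          have s3: "same {rJ, rE, rT, rP, rU} R2 R'" using p(1) by simp
          show "same {rJ, rE, rT, rP, rU, rV, rQ} R2 R" by (rule same_trans[OF s3 s2]) auto
          have "R2 rV = int v" "R2 rQ = 2 ^ q'" using sameD[OF s3] R' q' by simp_all
          moreover have "divisors_in (decode_entries 1 (ds @ [e])) n =
             (if v dvd n then v # divisors_in (decode_entries 1 ds) n else divisors_in (decode_entries 1 ds) n)" for n
            using True unfolding decv by (simp add: divisors_in_def)
          ultimately show "sieve_inv N a M0 U0 T0 (ds @ [e]) c R2 M2 U2 (Suc T2 + 10)"
            unfolding sieve_inv_def v_def[symmetric]
            using p(2-5) q q' T' True by (auto simp: sieve_time_append v intro!: exI[of _ q'])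
        qed
        done
    next
      case False
      then have od: "int e mod 2 = 0" by presburger
      have "sieve_inv N a M0 U0 T0 (ds @ [e]) c R2 M U (14 + T')" if "R2 rV = int v" "R2 rQ = 2 ^ q'" for R2
        unfolding sieve_inv_def v_def[symmetric] decv
        using q q' T' False that by (auto simp: sieve_time_append decv intro!: exI[of _ q'])
      then show ?thesis using R' od iw q' s2 by (auto intro!: Q)
    qed
  qed (use v vx q in auto)
  note A = this
  show ?thesis unfolding entry_prog_def
    apply (simp add: q(1,2) e iw vv)
    apply (rule wp_mono[OF A])
    apply (auto split: if_splits)
    done
qed

lemma wp_word:
  assumes R: "R rM = int seg" "R rN = int N" "R rA = int a" "R rR = 4 * int G" "R rW = int (pack (4 * G) es)"
    and N: "N \<le> x + 1" and a: "1 \<le> a" "a \<le> x"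
    and ok: "entries_ok G es" and adv: "1 + advance (ds @ es) \<le> y"
    and dec: "\<And>p. p \<in> set (decode_entries 1 (ds @ es)) \<Longrightarrow> prime p" "distinct (decode_entries 1 (ds @ es))"
    and W: "pack (4 * G) es < x * (8 * x)"
    and inv: "sieve_inv N a M0 U0 T0 ds c R M U T"
    and Q: "\<And>R' M' U' T'. same {rJ, rE, rT, rP, rU, rV, rQ, rW} R' R \<Longrightarrow>
      sieve_inv N a M0 U0 T0 (ds @ es) (c + 5) R' M' U' T' \<Longrightarrow> Q R' M' os U' T'"
  shows "wp w word_prog Q R M os U T"
proof -
  have Gpos: "4 * G > 0" using G_bounds by simp
  have okD: "2 \<le> e \<and> e < 4 * G" if "e \<in> set es" for e
    using entries_okD[OF ok that] G_bounds by simp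
  \<comment> \<open>What remains of a word never exceeds the word itself, so the range of the stored
    word covers every remainder.\<close>
  have pk_le: "pack (4 * G) (drop k es) \<le> pack (4 * G) es" for k
  proof (induction k arbitrary: es)
    case (Suc k)
    show ?case
    proof (cases es)
      case (Cons e fs)
      have "pack (4 * G) (drop k fs) \<le> pack (4 * G) fs" by (rule Suc)
      also have "\<dots> \<le> 4 * G * pack (4 * G) fs" using Gpos by simp
      finally show ?thesis using Cons by simp
    qed simp
  qed simp
  have iw: "in_word w (int n)" if "n < x * (8 * x)" for n
  proof -
    have "int n < int (x * (8 * x))" using that by (simp only: of_nat_less_iff)
    then have "int n < 8 * (int x * int x)" by simp
    moreover have "0 \<le> int x * int x" by simp
    ultimately show ?thesis by (intro in_word_quad; linarith)
  qed
  let ?S = "{rJ, rE, rT, rP, rU, rV, rQ, rW}"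
  show ?thesis unfolding word_prog_def
    apply (rule wp_for_same[where N = "length es" and S = ?S and I = "\<lambda>k R' M' os' U' T'. os' = os \<and>
       R' rW = int (pack (4 * G) (drop k es)) \<and> sieve_inv N a M0 U0 T0 (ds @ take k es) c R' M' U' T'"])
    subgoal using R inv by simp
    subgoal premises p for k R' M' os' U' T'
    proof -
      define e where "e = es ! k"
      define r where "r = pack (4 * G) (drop (Suc k) es)"
      have dr: "drop k es = e # drop (Suc k) es" and tk: "take (Suc k) es = take k es @ [e]"
        using p(1) by (simp_all add: Cons_nth_drop_Suc take_Suc_conv_app_nth e_def)
      have e: "2 \<le> e" "e < 4 * G" using okD[of e] p(1) by (auto simp: e_def)
      have W': "R' rW = int (e + 4 * G * r)" using p(4) dr by (simp add: r_def)
      have md: "int (e + 4 * G * r) mod (4 * int G) = int e" "int (e + 4 * G * r) div (4 * int G) = int r"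
      proof -
        have "(e + 4 * G * r) mod (4 * G) = e" "(e + 4 * G * r) div (4 * G) = r" using e Gpos by auto
        then have "int (e + 4 * G * r) mod int (4 * G) = int e" "int (e + 4 * G * r) div int (4 * G) = int r"
          by (simp_all only: of_nat_mod[symmetric] of_nat_div[symmetric])
        then show "int (e + 4 * G * r) mod (4 * int G) = int e" "int (e + 4 * G * r) div (4 * int G) = int r" by simp_all
      qed
      have es: "es = (take k es @ [e]) @ drop (Suc k) es" using tk by (metis append_take_drop_id)
      have dsplit: "ds @ es = ((ds @ take k es) @ [e]) @ drop (Suc k) es" using es by simp
      have adv': "1 + advance ((ds @ take k es) @ [e]) \<le> y"
        using adv unfolding dsplit advance_append by simp
      have dec': "\<And>p. p \<in> set (decode_entries 1 ((ds @ take k es) @ [e])) \<Longrightarrow> prime p"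
        "distinct (decode_entries 1 ((ds @ take k es) @ [e]))"
        using dec unfolding dsplit decode_entries_append[of 1 "(ds @ take k es) @ [e]" "drop (Suc k) es"] by simp_all
      have iws: "in_word w (int e)" "in_word w (int r)"
      proof -
        have "e < x * (8 * x)" using mult_le_mono[of 1 x "8 * x" "8 * x"] e G_bounds x3 by linarith
        then show "in_word w (int e)" by (rule iw)
        have "r < x * (8 * x)" using pk_le[of "Suc k"] W by (simp add: r_def)
        then show "in_word w (int r)" by (rule iw)
      qed
      have Rs: "R' rM = int seg" "R' rN = int N" "R' rA = int a" "R' rR = 4 * int G"
        using p(3) R by simp_all
      \<comment> \<open>An entry is at least 2, so the word is nonzero as long as entries
        remain.\<close>
      have "0 \<le> 4 * int G * int r" by simp
      then have nz: "int e + 4 * int G * int r \<noteq> 0" using e by linarith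
      have inv': "sieve_inv N a M0 U0 T0 (ds @ take k es) (c + 4) (R'(rU := 0, rE := int e, rW := int r)) M' U' (Suc (Suc (Suc (Suc T'))))"
        using p(4) by (auto simp: sieve_inv_def)
      have "wp w entry_prog (\<lambda>R' M' os' U' T'. same ?S R' R \<and> os' = os \<and>
         R' rW = int (pack (4 * G) (drop (Suc k) es)) \<and> sieve_inv N a M0 U0 T0 (ds @ take (Suc k) es) c R' M' U' (Suc T'))
         (R'(rU := 0, rE := int e, rW := int r)) M' os U' (Suc (Suc (Suc (Suc T'))))"
      proof (rule wp_entry[OF _ _ _ N a _ adv' dec' inv'])
        fix R2 M2 U2 T2
        assume q: "same {rJ, rE, rT, rP, rU, rV, rQ} R2 (R'(rU := 0, rE := int e, rW := int r))"
          "sieve_inv N a M0 U0 T0 ((ds @ take k es) @ [e]) (c + 4) R2 M2 U2 (T2 + 10)"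
        have "same ?S R2 (R'(rU := 0, rE := int e, rW := int r))" by (rule same_trans[OF q(1) same_refl]) auto
        then have "same ?S R2 R'" by simp
        then have "same ?S R2 R" using p(2) by (rule same_trans) simp
        moreover have "R2 rW = int r" using sameD[OF q(1)] by simp
        moreover have "sieve_inv N a M0 U0 T0 (ds @ take (Suc k) es) c R2 M2 U2 (Suc T2)"
          using q(2) tk by (auto simp: sieve_inv_def)
        ultimately show "same ?S R2 R \<and> os = os \<and>
         R2 rW = int (pack (4 * G) (drop (Suc k) es)) \<and> sieve_inv N a M0 U0 T0 (ds @ take (Suc k) es) c R2 M2 U2 (Suc T2)"
          by (simp add: r_def)
      qed (use Rs in auto)
      note A = this
      have r: "os' = os" "G \<noteq> 0" using p(4) Gpos by auto
      have W2: "R' rW = int e + 4 * int G * int r" using W' by simp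
      have md2: "(int e + 4 * int G * int r) mod (4 * int G) = int e" "(int e + 4 * int G * int r) div (4 * int G) = int r"
        using md by simp_all
      show ?thesis
        apply (simp add: Rs W2 nz r iws md2[simplified])
        apply (rule wp_mono[OF A])
        apply simp
        done
    qed
    subgoal premises p for R' M' os' U' T'
      using p(1,3) by (auto intro!: Q simp: sieve_inv_def)
    done
qed

lemma wp_sieve:
  assumes R: "R rM = int seg" "R rN = int N" "R rA = int a" "R rR = 4 * int G"
    and N: "N = length bs" "N \<le> x + 1" and a: "1 \<le> a" "a \<le> x"
    and ok: "entries_ok G (concat bs)" and adv: "1 + advance (concat bs) \<le> y"
    and dec: "decode_entries 1 (concat bs) = primes_upto y"
    and W: "\<forall>i<N. M i = int (pack (4 * G) (bs ! i)) \<and> pack (4 * G) (bs ! i) < x * (8 * x)"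
    and cells: "cells N (\<lambda>_. []) M"
    and Q: "\<And>R' M' U' T'. same {rJ, rE, rT, rP, rU, rV, rQ, rW, rI} R' R \<Longrightarrow> \<forall>i<N. M' i = M i \<Longrightarrow>
      cells N (\<lambda>j. divisors_in (primes_upto y) (a + j)) M' \<Longrightarrow> U' \<le> max U (N + 2 * seg) \<Longrightarrow>
      T' \<le> T + 30 + 30 * N + sieve_time (concat bs) + 10 * L \<Longrightarrow> Q R' M' os U' T'"
  shows "wp w sieve_prog Q R M os U T"
proof -
  let ?S = "{rJ, rE, rT, rP, rU, rV, rQ, rW, rI}"
  have split: "concat bs = concat (take k bs) @ bs ! k @ concat (drop (Suc k) bs)" if "k < length bs" for k
    using that by (metis append_take_drop_id concat_append concat.simps(2) Cons_nth_drop_Suc)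
  show ?thesis unfolding sieve_prog_def
    apply simp
    apply (rule wp_for_same[where N = N and S = ?S and I = "\<lambda>k R' M' os' U' T'. os' = os \<and>
       R' rI = int k \<and> sieve_inv N a M U T (concat (take k bs)) (3 + 20 * k) R' M' U' T'"])
    subgoal using cells unfolding sieve_inv_def
      by (auto intro!: exI[of _ 1] simp: sieve_time_def advance_def divisors_in_def)
    subgoal premises p for k R' M' os' U' T'
    proof -
      have p2: "same ?S R' R" using p(2) by simp
      have k: "k < length bs" using p(1) N by simp
      note sp = split[OF k]
      have Mk: "M' k = int (pack (4 * G) (bs ! k))" "pack (4 * G) (bs ! k) < x * (8 * x)"
        using p(1,4) W by (auto simp: sieve_inv_def)
      have iw: "in_word w (M' k)"
      proof -
        have "int (pack (4 * G) (bs ! k)) < int (x * (8 * x))" using Mk(2) by (simp only: of_nat_less_iff)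
        then have "int (pack (4 * G) (bs ! k)) < 8 * (int x * int x)" by simp
        moreover have "0 \<le> int x * int x" by simp
        ultimately show ?thesis unfolding Mk(1) by (intro in_word_quad; linarith)
      qed
      have iw2: "in_word w (int k + 1)" using p(1) N x3 by (intro in_word_lin) auto
      have Rs: "R' rM = int seg" "R' rN = int N" "R' rA = int a" "R' rR = 4 * int G"
        using p(3) R by simp_all
      have ok': "entries_ok G (bs ! k)" using ok unfolding sp by (simp add: entries_ok_append)
      have adv': "1 + advance (concat (take k bs) @ bs ! k) \<le> y"
        using adv unfolding sp advance_append by simp
      have sub: "primes_upto y = decode_entries 1 (concat (take k bs) @ bs ! k) @
          decode_entries (1 + advance (concat (take k bs) @ bs ! k)) (concat (drop (Suc k) bs))"
        unfolding dec[symmetric] by (subst sp, simp only: append_assoc[symmetric] decode_entries_append[of 1 "concat (take k bs) @ bs ! k"])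
      have dec': "\<And>p. p \<in> set (decode_entries 1 (concat (take k bs) @ bs ! k)) \<Longrightarrow> prime p"
        "distinct (decode_entries 1 (concat (take k bs) @ bs ! k))"
        using set_primes_upto[of y] distinct_primes_upto[of y] unfolding sub by auto
      have tk: "concat (take (Suc k) bs) = concat (take k bs) @ bs ! k"
        using k by (simp add: take_Suc_conv_app_nth)
      let ?R = "R'(rT := 1, rW := M' k)"
      have inv': "sieve_inv N a M U T (concat (take k bs)) (3 + 20 * k + 3) ?R M' (max U' (Suc k)) (Suc (Suc (Suc T')))"
        using p(1,4) by (auto simp: sieve_inv_def)
      have "wp w word_prog (\<lambda>R' M' os' U' T'. in_word w (R' rI + 1) \<and> same ?S R' R \<and> os' = os \<and>
         R' rI = int k \<and> sieve_inv N a M U T (concat (take (Suc k) bs)) (3 + 20 * k + 17) R' M' U' (T' + 4)) ?R M' os (max U' (Suc k)) (Suc (Suc (Suc T')))"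
      proof (rule wp_word[OF _ _ _ _ _ N(2) a ok' adv' dec' Mk(2) inv'])
        fix R2 M2 U2 T2
        assume q: "same {rJ, rE, rT, rP, rU, rV, rQ, rW} R2 ?R"
          "sieve_inv N a M U T (concat (take k bs) @ bs ! k) (3 + 20 * k + 3 + 5) R2 M2 U2 T2"
        have "same ?S R2 ?R" by (rule same_trans[OF q(1) same_refl]) auto
        then have "same ?S R2 R'" by simp
        then have "same ?S R2 R" using p2 by (rule same_trans) simp
        moreover have "R2 rI = int k" using sameD[OF q(1)] p(4) by simp
        moreover have "sieve_inv N a M U T (concat (take (Suc k) bs)) (3 + 20 * k + 17) R2 M2 U2 (T2 + 4)"
          using q(2) tk by (auto simp: sieve_inv_def)
        ultimately show "in_word w (R2 rI + 1) \<and> same ?S R2 R \<and> os = os \<and> R2 rI = int k \<and>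
           sieve_inv N a M U T (concat (take (Suc k) bs)) (3 + 20 * k + 17) R2 M2 U2 (T2 + 4)" using iw2 by simp
      qed (use Rs Mk in auto)
      note A = this
      have r: "R' rI = int k" "os' = os" using p(4) by auto
      show ?thesis
        apply (simp add: r Rs p(1) iw)
        apply (rule wp_mono[OF A])
        apply (auto simp: sieve_inv_def)
        done
    qed
    subgoal premises p for R' M' os' U' T'
    proof -
      have "R' rN = int N" using p(2) R by simp
      from p(3) N have "sieve_inv N a M U T (concat bs) (3 + 20 * N) R' M' U' T'" by simp
      then obtain q where q: "2 ^ q \<le> 2 * (1 + advance (concat bs))" "\<forall>i<N. M' i = M i"
         "cells N (\<lambda>j. divisors_in (primes_upto y) (a + j)) M'"
         "U' \<le> max U (N + 2 * seg)" "T' \<le> T + (3 + 20 * N) + sieve_time (concat bs) + 10 * q"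
        unfolding sieve_inv_def dec by blast
      \<comment> \<open>\<open>2 ^ q\<close> is at most twice the cursor, which stays within
        \<open>y\<close>. Hence \<open>q\<close> is at most \<open>L\<close>, and the doublings of a
        whole pass cost at most \<open>10 * L\<close>.\<close>
      have "(2::nat) ^ q \<le> 2 * x" by (rule order_trans[OF q(1)]) (use adv y_le_x in simp)
      also have "\<dots> < 2 ^ Suc L" using L by simp
      finally have "q < Suc L" by (subst (asm) power_strict_increasing_iff) auto
      then show ?thesis using q p(1,3) \<open>R' rN = int N\<close> by (auto intro!: Q)
    qed
    done
qed

end

section \<open>Reading the cells and printing the factorizations\<close>

lemma cofactor_snoc: "cofactor (ps @ [p]) n = cofactor ps n div p ^ multiplicity p (cofactor ps n)"
  by (simp add: cofactor_def)

context sieve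
begin

lemma in_word_mod: "0 < p \<Longrightarrow> p \<le> x \<Longrightarrow> in_word w (v mod int p)"
proof -
  assume "0 < p" "p \<le> x"
  then have "0 \<le> v mod int p" "v mod int p < int p" by simp_all
  then show ?thesis using \<open>p \<le> x\<close> by (intro in_word_lin) linarith+
qed

lemma wp_divide_out:
  assumes r: "r \<notin> {rE, rT, rU, rV}" and R: "R r = int n" "R rV = int p"
    and p: "prime p" "p \<le> x" and n: "n > 0" "n \<le> x"
    and Q: "\<And>R' T'. same {r, rE, rT, rU} R' R \<Longrightarrow> R' r = int (n div p ^ multiplicity p n) \<Longrightarrow>
      R' rE = int (multiplicity p n) \<Longrightarrow> T' \<le> T + 10 + 10 * multiplicity p n \<Longrightarrow> Q R' M os U T'"
  shows "wp w (divide_out_prog r) Q R M os U T"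
proof -
  define m where "m = multiplicity p n"
  have p0: "p > 0" using p by (simp add: prime_gt_0_nat)
  have "p ^ m dvd n" unfolding m_def by (rule multiplicity_dvd)
  then obtain s where s: "n = p ^ m * s" by blast
  have ps: "\<not> p dvd s"
  proof
    assume "p dvd s"
    then have "p ^ Suc m dvd n" unfolding s power_Suc2 by (rule mult_dvd_mono[OF dvd_refl])
    then have "Suc m \<le> multiplicity p n" using n p
      by (subst (asm) power_dvd_iff_le_multiplicity) (auto simp: prime_gt_1_nat)
    then show False by (simp add: m_def)
  qed
  have dv: "n div p ^ k = p ^ (m - k) * s" if "k \<le> m" for k
  proof -
    have "n = p ^ k * (p ^ (m - k) * s)" unfolding s mult.assoc[symmetric] power_add[symmetric] using that by simp
    then show ?thesis using p0 by simp
  qed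
  have cond: "p dvd n div p ^ k \<longleftrightarrow> k < m" if "k \<le> m" for k
  proof (cases "k < m")
    case True
    then have "m - k = Suc (m - Suc k)" by simp
    then show ?thesis unfolding dv[OF that] using True by simp
  next
    case False
    then show ?thesis unfolding dv[OF that] using ps that by simp
  qed
  have cond': "int (n div p ^ k) mod int p = 0 \<longleftrightarrow> k < m" if "k \<le> m" for k
    using cond[OF that] by (simp only: of_nat_mod[symmetric] of_nat_eq_0_iff dvd_eq_mod_eq_0)
  have m: "m \<le> x"
  proof -
    have "m < 2 ^ m" by (rule less_exp)
    also have "\<dots> \<le> p ^ m" using p by (intro power_mono prime_ge_2_nat) auto
    also have "\<dots> \<le> n" using \<open>p ^ m dvd n\<close> n by (intro dvd_imp_le)
    finally show ?thesis using n by simp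
  qed
  have nx: "n div p ^ k \<le> x" for k using n div_le_dividend le_trans by blast
  have stp: "n div p ^ k div p = n div p ^ Suc k" for k
    by (metis div_mult2_eq power_Suc2)
  have stp': "int (n div p ^ k) div int p = int (n div p ^ Suc k)" for k
    unfolding stp[symmetric] by (simp only: of_nat_div)
  show ?thesis unfolding divide_out_prog_def
    apply simp
    apply (rule wp_for_same[where N = m and S = "{r, rE, rT, rU}" and I = "\<lambda>k R' M' os' U' T'. os' = os \<and> M' = M \<and> U' = U \<and>
       R' r = int (n div p ^ k) \<and> R' rE = int k \<and> T' \<le> T + 1 + 9 * k"])
    subgoal using R r by simp
    subgoal premises P for k R' M' os' U' T'
    proof -
      have "R' rV = int p" using P(3) R r by simp
      moreover have "in_word w (int k + 1)" "in_word w (int (n div p ^ Suc k))"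
        using P(1) m x3 nx[of "Suc k"] by (auto intro!: in_word_lin)
      ultimately show ?thesis using P(2,4) r cond'[of k] P(1) in_word_mod[OF p0 p(2)] p0
        by (simp add: stp' del: power_Suc)
    qed
    subgoal premises P for R' M' os' U' T'
    proof -
      have V: "R' rV = int p" using P(2) R r by simp
      show ?thesis using P(1,3) V r cond'[of m] in_word_mod[OF p0 p(2)] p0
        by (simp del: power_Suc) (intro Q; simp add: m_def)
    qed
    done
qed

text \<open>Decoding only shrinks \<open>C\<close> and \<open>K\<close>, so their initial range is
  preserved; the isolated bit is at most \<open>2 * p\<close>.\<close>

lemma wp_decode:
  assumes enc: "encodes (p # ps) C K" and R: "R rC = C" "R rK = K" and p: "p \<le> x"
    and iw: "in_word w C" "in_word w K"
    and A: "\<And>R' C' K'. same {rU, rQ, rV, rC, rK} R' R \<Longrightarrow> R' rV = int p \<Longrightarrow> R' rC = C' \<Longrightarrow> R' rK = K' \<Longrightarrow>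
      encodes ps C' K' \<Longrightarrow> in_word w C' \<Longrightarrow> in_word w K' \<Longrightarrow> wp w c Q R' M os U (T + 8)"
  shows "wp w (decode_prog c) Q R M os U T"
proof -
  define q where "q = and K (- K)"
  note d = encodes_decode[OF enc, folded q_def]
  have CK: "0 \<le> C" "0 \<le> K" using encodes_nonneg[OF enc] by auto
  have "0 \<le> C div q" "C div q \<le> C" using CK d(2) zdiv_mono2[of C 1 q] by (auto simp: pos_imp_zdiv_nonneg_iff)
  moreover have "0 \<le> K div q - 1" using encodes_nonneg[OF d(4)] by simp
  moreover have "K div q \<le> K" using CK d(2) zdiv_mono2[of K 1 q] by auto
  ultimately have iws: "in_word w (- K)" "in_word w (C div q)" "in_word w (K div q)" "in_word w (K div q - 1)"
    using iw CK unfolding in_word_def by auto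
  have "in_word w q" "in_word w (int p)" using d(2,5) p by (auto intro!: in_word_lin)
  then have A': "wp w c Q (R(rQ := q, rV := int p, rC := C div q, rU := 1, rK := K div q - 1)) M os U (T + 8)"
    by (intro A[OF _ _ refl refl]) (use d(4) iws in auto)
  have "T + 8 = Suc (Suc (Suc (Suc (Suc (Suc (Suc (Suc T)))))))" by simp
  note A2 = A'[unfolded this]
  show ?thesis using A2 iws \<open>in_word w q\<close> \<open>in_word w (int p)\<close> d(2,3)
    by (simp add: R q_def[symmetric] fun_upd_twist)
qed

definition div_time :: "nat list \<Rightarrow> nat \<Rightarrow> nat" where
  "div_time ps n = sum_list (map (\<lambda>p. 30 + 10 * multiplicity p n) ps)"

lemma wp_count:
  assumes R: "R rI = int n" "R rC = C" "R rK = K" and enc: "encodes ps C K" and iw: "in_word w C" "in_word w K"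
    and n: "n > 0" "n \<le> x" and ps: "\<And>p. p \<in> set ps \<Longrightarrow> prime p \<and> p \<le> x" and len: "length ps \<le> x"
    and Q: "\<And>R' T'. same {rU, rD, rF, rT, rE, rQ, rV, rC, rK} R' R \<Longrightarrow> R' rD = int (cofactor ps n) \<Longrightarrow>
      R' rF = int (length ps) + (if cofactor ps n = 1 then 0 else 1) \<Longrightarrow>
      T' \<le> T + 20 + div_time ps n \<Longrightarrow> Q R' M os U T'"
  shows "wp w count_prog Q R M os U T"
proof -
  let ?S = "{rU, rD, rF, rT, rE, rQ, rV, rC, rK}"
  have cof: "cofactor (take k ps) n > 0" "cofactor (take k ps) n \<le> x" "cofactor (take k ps) n dvd n" for k
  proof -
    have "cofactor (take k ps) n dvd n \<and> cofactor (take k ps) n > 0"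
      using cofactor_props[OF n(1), of "take k ps"] ps by (auto dest: in_set_takeD)
    then show "cofactor (take k ps) n > 0" "cofactor (take k ps) n \<le> x" "cofactor (take k ps) n dvd n"
      using n by (auto dest: dvd_imp_le)
  qed
  have iwn: "in_word w (int n)" using n by (intro in_word_lin) auto
  show ?thesis unfolding count_prog_def
    apply (simp add: R(1) iwn)
    apply (rule wp_for_same[where N = "length ps" and S = ?S and I = "\<lambda>k R' M' os' U' T'. os' = os \<and> M' = M \<and> U' = U \<and>
       R' rD = int (cofactor (take k ps) n) \<and> R' rF = int k \<and>
       (\<exists>C K. R' rC = C \<and> R' rK = K \<and> encodes (drop k ps) C K \<and> in_word w C \<and> in_word w K) \<and>
       T' \<le> T + 3 + div_time (take k ps) n"])
    subgoal using R enc iw by (simp add: cofactor_def div_time_def)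
    subgoal premises P for k R1 M1 os1 U1 T1
    proof -
      define p where "p = ps ! k"
      have p: "prime p" "p \<le> x" using ps P(1) by (auto simp: p_def)
      have dr: "drop k ps = p # drop (Suc k) ps" and tk: "take (Suc k) ps = take k ps @ [p]"
        using P(1) by (simp_all add: Cons_nth_drop_Suc take_Suc_conv_app_nth p_def)
      define r where "r = cofactor (take k ps) n"
      have r: "r > 0" "r \<le> x" "r dvd n" using cof by (auto simp: r_def)
      have mult: "multiplicity p r \<le> multiplicity p n" using r n by (intro dvd_imp_multiplicity_le) auto
      obtain C K where CK: "R1 rC = C" "R1 rK = K" "encodes (p # drop (Suc k) ps) C K" "in_word w C" "in_word w K"
        using P(4) dr by auto
      have st: "os1 = os" "M1 = M" "U1 = U" "R1 rD = int r" "R1 rF = int k" "T1 \<le> T + 3 + div_time (take k ps) n"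
        using P(4) by (auto simp: r_def)
      have P2: "same ?S R1 R" using P(2) by simp
      have iwk: "in_word w (int k + 1)" using P(1) len x3 by (intro in_word_lin) auto
      have K0: "K \<noteq> 0" using encodes_decode[OF CK(3)] by simp
      have dt: "div_time (take (Suc k) ps) n = div_time (take k ps) n + 30 + 10 * multiplicity p n"
        unfolding tk by (simp add: div_time_def)
      have A: "wp w (decode_prog (divide_out_prog rD ;; inc rF)) (\<lambda>R' M' os' U' T'. same ?S R' R \<and>
          (os' = os \<and> M' = M \<and> U' = U \<and>
       R' rD = int (cofactor (take (Suc k) ps) n) \<and> R' rF = int (Suc k) \<and>
       (\<exists>C K. R' rC = C \<and> R' rK = K \<and> encodes (drop (Suc k) ps) C K \<and> in_word w C \<and> in_word w K) \<and>
       Suc T' \<le> T + 3 + div_time (take (Suc k) ps) n)) (R1(rU := 0)) M os U (Suc (Suc T1))"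
      proof (rule wp_decode[OF CK(3) _ _ p(2) CK(4,5)])
        fix R2 C2 K2
        assume q: "same {rU, rQ, rV, rC, rK} R2 (R1(rU := 0))" "R2 rV = int p" "R2 rC = C2" "R2 rK = K2"
          "encodes (drop (Suc k) ps) C2 K2" "in_word w C2" "in_word w K2"
        have s2: "same ?S R2 R" using q(1) by (intro same_trans[OF _ P2, of "{rU, rQ, rV, rC, rK}"]) auto
        have R2: "R2 rD = int r" "R2 rF = int k" using sameD[OF q(1)] st by simp_all
        show "wp w (divide_out_prog rD ;; inc rF) (\<lambda>R' M' os' U' T'. same ?S R' R \<and>
          (os' = os \<and> M' = M \<and> U' = U \<and>
       R' rD = int (cofactor (take (Suc k) ps) n) \<and> R' rF = int (Suc k) \<and>
       (\<exists>C K. R' rC = C \<and> R' rK = K \<and> encodes (drop (Suc k) ps) C K \<and> in_word w C \<and> in_word w K) \<and>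
       Suc T' \<le> T + 3 + div_time (take (Suc k) ps) n)) R2 M os U (Suc (Suc T1) + 8)"
          unfolding wp.simps(2)
        proof (rule wp_divide_out[OF _ R2(1) q(2) p r(1,2)])
          fix R3 T3
          assume h: "same {rD, rE, rT, rU} R3 R2" "R3 rD = int (r div p ^ multiplicity p r)"
            "T3 \<le> Suc (Suc T1) + 8 + 10 + 10 * multiplicity p r"
          have "same ?S R3 R" by (rule same_trans[OF h(1) s2]) auto
          moreover have "R3 rC = C2" "R3 rK = K2" "R3 rF = int k" using sameD[OF h(1)] q R2 by simp_all
          moreover have "cofactor (take (Suc k) ps) n = r div p ^ multiplicity p r"
            unfolding tk cofactor_snoc r_def[symmetric] ..
          ultimately show "wp w (const rU 1) (wp w (arith Add rF rF rU) (\<lambda>R' M' os' U' T'. same ?S R' R \<and>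
          (os' = os \<and> M' = M \<and> U' = U \<and>
       R' rD = int (cofactor (take (Suc k) ps) n) \<and> R' rF = int (Suc k) \<and>
       (\<exists>C K. R' rC = C \<and> R' rK = K \<and> encodes (drop (Suc k) ps) C K \<and> in_word w C \<and> in_word w K) \<and>
       Suc T' \<le> T + 3 + div_time (take (Suc k) ps) n))) R3 M os U T3"
            using h q iwk mult st(6) dt by (simp add: add.commute)
        qed auto
      qed (use CK in auto)
      show ?thesis
        apply (subst wp.simps(1))
        apply (simp add: CK K0 st(1-3) del: wp.simps)
        apply (rule wp_mono[OF A])
        apply simp
        done
    qed
    subgoal premises P for R1 M1 os1 U1 T1
    proof -
      obtain C K where CK: "R1 rC = C" "R1 rK = K" "encodes [] C K"
        using P(3) by auto
      have K0: "K = 0" using encodes_NilD[OF CK(3)] by simp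
      have cp: "cofactor ps n > 0" using cof(1)[of "length ps"] by simp
      have iwk: "in_word w (int (length ps))" "in_word w (int (length ps) + 1)" using len x3 by (auto intro!: in_word_lin)
      show ?thesis
      proof (cases "cofactor ps n = 1")
        case True
        then show ?thesis using P(1,3) CK K0 iwk by (auto intro!: Q)
      next
        case False
        then have "1 < cofactor ps n" using cp by simp
        then show ?thesis using P(1,3) CK K0 iwk by (auto intro!: Q)
      qed
    qed
    done
qed


lemma wp_print:
  assumes R: "R rI = int n" "R rC = C" "R rK = K" and enc: "encodes ps C K" and iw: "in_word w C" "in_word w K"
    and n: "n > 0" "n \<le> x" and ps: "\<And>p. p \<in> set ps \<Longrightarrow> prime p \<and> p \<le> x"
    and cof: "R rD = int r" "r > 0"
    and Q: "\<And>R' T'. same {rU, rW, rT, rE, rQ, rV, rC, rK} R' R \<Longrightarrow>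
      T' \<le> T + 20 + div_time ps n \<Longrightarrow>
      Q R' M (os @ concat (map (\<lambda>p. [int p, int (multiplicity p n)]) ps) @ (if r = 1 then [] else [int r, 1])) U T'"
  shows "wp w print_prog Q R M os U T"
proof -
  let ?S = "{rU, rW, rT, rE, rQ, rV, rC, rK}"
  define out where "out qs = os @ concat (map (\<lambda>p. [int p, int (multiplicity p n)]) qs)" for qs
  have iwn: "in_word w (int n)" using n by (intro in_word_lin) auto
  show ?thesis unfolding print_prog_def
    apply simp
    apply (rule wp_for_same[where N = "length ps" and S = ?S and I = "\<lambda>k R' M' os' U' T'. os' = out (take k ps) \<and> M' = M \<and> U' = U \<and>
       (\<exists>C K. R' rC = C \<and> R' rK = K \<and> encodes (drop k ps) C K \<and> in_word w C \<and> in_word w K) \<and>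
       T' \<le> T + div_time (take k ps) n"])
    subgoal using R enc iw by (simp add: out_def div_time_def)
    subgoal premises P for k R1 M1 os1 U1 T1
    proof -
      define p where "p = ps ! k"
      have p: "prime p" "p \<le> x" using ps P(1) by (auto simp: p_def)
      have dr: "drop k ps = p # drop (Suc k) ps" and tk: "take (Suc k) ps = take k ps @ [p]"
        using P(1) by (simp_all add: Cons_nth_drop_Suc take_Suc_conv_app_nth p_def)
      obtain C K where CK: "R1 rC = C" "R1 rK = K" "encodes (p # drop (Suc k) ps) C K" "in_word w C" "in_word w K"
        using P(4) dr by auto
      have st: "os1 = out (take k ps)" "M1 = M" "U1 = U" "T1 \<le> T + div_time (take k ps) n"
        using P(4) by auto
      note P2 = P(2)
      have rI: "R1 rI = int n" using P(3) R by simp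
      have K0: "K \<noteq> 0" using encodes_decode[OF CK(3)] by simp
      have dt: "div_time (take (Suc k) ps) n = div_time (take k ps) n + 30 + 10 * multiplicity p n"
        unfolding tk by (simp add: div_time_def)
      have ot: "out (take (Suc k) ps) = out (take k ps) @ [int p, int (multiplicity p n)]"
        unfolding tk by (simp add: out_def)
      define Q' where "Q' = (\<lambda>R' M' os' U' T'. same ?S R' R \<and>
          (os' = out (take (Suc k) ps) \<and> M' = M \<and> U' = U \<and>
       (\<exists>C K. R' rC = C \<and> R' rK = K \<and> encodes (drop (Suc k) ps) C K \<and> in_word w C \<and> in_word w K) \<and>
       Suc T' \<le> T + div_time (take (Suc k) ps) n))"
      have A: "wp w (decode_prog (const rU 0 ;; arith Add rW rI rU ;; divide_out_prog rW ;; print rV ;; print rE)) Q'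
         (R1(rU := 0)) M (out (take k ps)) U (Suc (Suc T1))"
      proof (rule wp_decode[OF CK(3) _ _ p(2) CK(4,5)])
        fix R2 C2 K2
        assume q: "same {rU, rQ, rV, rC, rK} R2 (R1(rU := 0))" "R2 rV = int p" "R2 rC = C2" "R2 rK = K2"
          "encodes (drop (Suc k) ps) C2 K2" "in_word w C2" "in_word w K2"
        have s2: "same ?S R2 R" by (rule same_trans[OF _ P2, of "{rU, rQ, rV, rC, rK}"]) (use q(1) in auto)
        have R2: "R2 rI = int n" using sameD[OF q(1)] rI by simp_all
        have B: "wp w (divide_out_prog rW) (wp w (print rV ;; print rE) Q') (R2(rU := 0, rW := int n)) M (out (take k ps)) U
            (Suc (Suc (Suc (Suc T1) + 8)))"
        proof (rule wp_divide_out[OF _ _ _ p n])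
          fix R3 T3
          assume h: "same {rW, rE, rT, rU} R3 (R2(rU := 0, rW := int n))" "R3 rW = int (n div p ^ multiplicity p n)"
            "R3 rE = int (multiplicity p n)"
            "T3 \<le> Suc (Suc (Suc (Suc T1) + 8)) + 10 + 10 * multiplicity p n"
          have "same {rW, rE, rT, rU} R3 R2" using h(1) by simp
          then have "same ?S R3 R" by (rule same_trans[OF _ s2]) auto
          moreover have "R3 rC = C2" "R3 rK = K2" "R3 rV = int p" using sameD[OF h(1)] q by simp_all
          ultimately show "wp w (print rV ;; print rE) Q' R3 M (out (take k ps)) U T3"
            using h q st(4) dt ot by (simp add: Q'_def)
        qed (use q in auto)
        show "wp w (const rU 0 ;; arith Add rW rI rU ;; divide_out_prog rW ;; print rV ;; print rE) Q' R2 M (out (take k ps)) U (Suc (Suc T1) + 8)"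
          using B R2 iwn by simp
      qed (use CK in auto)
      show ?thesis
        apply (subst wp.simps(1))
        apply (simp add: CK K0 st(1-3) del: wp.simps)
        apply (rule wp_mono[OF A])
        apply (simp add: Q'_def)
        done
    qed
    subgoal premises P for R1 M1 os1 U1 T1
    proof -
      obtain C K where CK: "R1 rC = C" "R1 rK = K" "encodes [] C K"
        using P(3) by auto
      have K0: "K = 0" using encodes_NilD[OF CK(3)] by simp
      have rD: "R1 rD = int r" using P(2) cof by simp
      have out: "os1 = os @ concat (map (\<lambda>p. [int p, int (multiplicity p n)]) ps)" "M1 = M" "U1 = U"
        "T1 \<le> T + div_time ps n" using P(3) by (auto simp: out_def)
      show ?thesis
      proof (cases "r = 1")
        case True
        have Q1: "Q R' M os1 U T'" if "same ?S R' R" "T' \<le> T + 20 + div_time ps n" for R' T'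
          using Q[OF that] True out by simp
        show ?thesis using True P(1) CK K0 rD out(2-4) by (auto intro!: Q1)
      next
        case False
        then have r: "1 < r" using cof(2) by simp
        have Q1: "Q R' M (os1 @ [int r, 1]) U T'" if "same ?S R' R" "T' \<le> T + 20 + div_time ps n" for R' T'
          using Q[OF that] False out by simp
        show ?thesis using r P(1) CK K0 rD out(2-4) by (auto intro!: Q1)
      qed
    qed
    done
qed

lemma wp_fetch:
  assumes R: "R rN = int N" "R rJ = int j" and N: "N \<le> x + 1" and j: "j < seg"
    and iw: "in_word w (M (N + 2 * j))" "in_word w (M (N + 2 * j + 1))"
    and Q: "\<And>R' U'. same {rP, rU, rC, rK} R' R \<Longrightarrow> R' rC = M (N + 2 * j) \<Longrightarrow> R' rK = M (N + 2 * j + 1) \<Longrightarrow>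
      U' \<le> max U (N + 2 * seg) \<Longrightarrow> Q R' M os U' (T + 6)"
  shows "wp w fetch_prog Q R M os U T"
proof -
  have iws: "in_word w (2 * int j)" "in_word w (2 * int j + int N)" "in_word w (2 * int j + int N + 1)"
    using j seg_bounds N x3 by (auto intro!: in_word_lin)
  have "T + 6 = Suc (Suc (Suc (Suc (Suc (Suc T)))))" by simp
  note Q' = Q[unfolded this]
  show ?thesis unfolding fetch_prog_def
    using iws iw j by (auto simp: R le_max_iff_disj intro!: Q')
qed

text \<open>Each prime in the list divides \<open>n\<close>, so its multiplicity is positive and
  absorbs the constant 30.\<close>

lemma div_time_le:
  assumes "distinct ps" "\<And>p. p \<in> set ps \<Longrightarrow> prime p \<and> p dvd n" "n > 0"
  shows "div_time ps n \<le> 40 * Omega n"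
proof -
  have "div_time ps n = (\<Sum>p\<in>set ps. 30 + 10 * multiplicity p n)"
    unfolding div_time_def by (rule sum_list_distinct_conv_sum_set[OF assms(1)])
  also have "\<dots> \<le> (\<Sum>p\<in>set ps. 40 * multiplicity p n)"
  proof (rule sum_mono)
    fix p assume "p \<in> set ps"
    then have "multiplicity p n > 0"
      using assms(2)[of p] assms(3) prime_multiplicity_gt_zero_iff[OF prime_imp_prime_elem, of p n] by simp
    then show "30 + 10 * multiplicity p n \<le> 40 * multiplicity p n" by simp
  qed
  also have "\<dots> \<le> (\<Sum>p\<in>prime_factors n. 40 * multiplicity p n)"
    by (rule sum_mono2) (use assms in \<open>auto simp: prime_factors_dvd\<close>)
  finally show ?thesis by (simp add: Omega_def sum_distrib_left)
qed

lemma enc_block_factor_list: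
  defines "ps n \<equiv> divisors_in (primes_upto y) n"
  shows "enc_block (n, factor_list y n) =
    [int n, int (length (ps n)) + (if cofactor (ps n) n = 1 then 0 else 1)] @
    concat (map (\<lambda>p. [int p, int (multiplicity p n)]) (ps n)) @
    (if cofactor (ps n) n = 1 then [] else [int (cofactor (ps n) n), 1])"
  by (simp add: enc_block_def factor_list_def ps_def Let_def o_def)

text \<open>The cell is decoded in two passes of at most \<open>40 * Omega (a + j)\<close> steps
  each, apart from a constant.\<close>

lemma wp_block:
  assumes R: "R rN = int N" "R rJ = int j" "R rA = int a" and N: "N \<le> x + 1" and j: "j < seg"
    and a: "1 \<le> a" "a + j \<le> x"
    and cells: "cells N (\<lambda>j. divisors_in (primes_upto y) (a + j)) M"
    and Q: "\<And>R' U' T'. same {rI, rP, rC, rK, rU, rD, rF, rT, rE, rQ, rV, rW} R' R \<Longrightarrow> U' \<le> max U (N + 2 * seg) \<Longrightarrow>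
      T' \<le> T + 70 + 80 * Omega (a + j) \<Longrightarrow> Q R' M (os @ enc_block (a + j, factor_list y (a + j))) U' T'"
  shows "wp w block_prog Q R M os U T"
proof -
  define n where "n = a + j"
  define ps where "ps = divisors_in (primes_upto y) n"
  define C where "C = M (N + 2 * j)"
  define K where "K = M (N + 2 * j + 1)"
  let ?S = "{rI, rP, rC, rK, rU, rD, rF, rT, rE, rQ, rV, rW}"
  have n: "n > 0" "n \<le> x" using a by (auto simp: n_def)
  have enc: "encodes ps C K" using cells j by (auto simp: cells_def ps_def n_def C_def K_def)
  have pr: "\<And>p. p \<in> set ps \<Longrightarrow> prime p \<and> p dvd n" and dist: "distinct ps"
    by (auto simp: ps_def set_divisors_in_primes_upto distinct_divisors_in distinct_primes_upto)
  have px: "prime p \<and> p \<le> x" if "p \<in> set ps" for p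
    using pr[OF that] n dvd_imp_le[of p n] by simp
  have iw: "in_word w C" "in_word w K" using in_word_encodes[OF enc dist pr n(1)] n by auto
  have len: "length ps \<le> x"
  proof -
    have "length ps < 2 ^ length ps" by (rule less_exp)
    also have "\<dots> \<le> prod_list ps" by (rule prod_list_primes[OF dist pr n(1)])
    also have "\<dots> \<le> n" by (rule prod_list_primes[OF dist pr n(1)])
    finally show ?thesis using n by simp
  qed
  have cof: "cofactor ps n > 0" using cofactor_props[OF n(1), of ps] pr by auto
  have dt: "div_time ps n \<le> 40 * Omega n" by (rule div_time_le[OF dist pr n(1)])
  have iwn: "in_word w (int n)" using n by (intro in_word_lin) auto
  have an: "int a + int j = int n" by (simp add: n_def)
  have "wp w fetch_prog (wp w (count_prog ;; print rI ;; print rF ;; fetch_prog ;; print_prog) Q)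
      (R(rI := int n)) M os U (Suc T)"
  proof (rule wp_fetch[OF _ _ N j])
    fix R1 U1
    assume s1: "same {rP, rU, rC, rK} R1 (R(rI := int n))" "R1 rC = M (N + 2 * j)" "R1 rK = M (N + 2 * j + 1)"
      and U1: "U1 \<le> max U (N + 2 * seg)"
    have R1: "R1 rI = int n" "R1 rN = int N" "R1 rJ = int j" using sameD[OF s1(1)] R by simp_all
    have s1': "same ?S R1 R" using same_trans[OF s1(1), of ?S R] by simp
    show "wp w (count_prog ;; print rI ;; print rF ;; fetch_prog ;; print_prog) Q R1 M os U1 (Suc T + 6)"
      unfolding wp.simps(2)
    proof (rule wp_count[OF R1(1) s1(2,3)[folded C_def K_def] enc iw n px len])
      fix R2 T2
      assume s2: "same {rU, rD, rF, rT, rE, rQ, rV, rC, rK} R2 R1" "R2 rD = int (cofactor ps n)"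
        "R2 rF = int (length ps) + (if cofactor ps n = 1 then 0 else 1)"
        and T2: "T2 \<le> Suc T + 6 + 20 + div_time ps n"
      have R2: "R2 rI = int n" "R2 rN = int N" "R2 rJ = int j" using sameD[OF s2(1)] R1 by simp_all
      have s2': "same ?S R2 R" by (rule same_trans[OF s2(1) s1']) auto
      have "wp w fetch_prog (wp w print_prog Q) R2 M ((os @ [R2 rI]) @ [R2 rF]) U1 (Suc (Suc T2))"
      proof (rule wp_fetch[OF R2(2,3) N j])
        fix R3 U3
        assume s3: "same {rP, rU, rC, rK} R3 R2" "R3 rC = M (N + 2 * j)" "R3 rK = M (N + 2 * j + 1)"
          and U3: "U3 \<le> max U1 (N + 2 * seg)"
        have R3: "R3 rI = int n" "R3 rD = int (cofactor ps n)" using sameD[OF s3(1)] R2 s2 by simp_all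
        have s3': "same ?S R3 R" by (rule same_trans[OF s3(1) s2']) auto
        show "wp w print_prog Q R3 M ((os @ [R2 rI]) @ [R2 rF]) U3 (Suc (Suc T2) + 6)"
        proof (rule wp_print[OF R3(1) s3(2,3)[folded C_def K_def] enc iw n px R3(2) cof])
          fix R4 T4
          assume s4: "same {rU, rW, rT, rE, rQ, rV, rC, rK} R4 R3" and T4: "T4 \<le> Suc (Suc T2) + 6 + 20 + div_time ps n"
          have s4': "same ?S R4 R" by (rule same_trans[OF s4 s3']) auto
          have U: "U3 \<le> max U (N + 2 * seg)" using U1 U3 by simp
          have T: "T4 \<le> T + 70 + 80 * Omega (a + j)" using T2 T4 dt by (simp add: n_def)
          have o: "os @ enc_block (a + j, factor_list y (a + j)) = ((os @ [R2 rI]) @ [R2 rF]) @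
             concat (map (\<lambda>p. [int p, int (multiplicity p n)]) ps) @
             (if cofactor ps n = 1 then [] else [int (cofactor ps n), 1])"
            unfolding enc_block_factor_list n_def[symmetric] ps_def[symmetric] R2(1) s2(3) by simp
          show "Q R4 M (((os @ [R2 rI]) @ [R2 rF]) @ concat (map (\<lambda>p. [int p, int (multiplicity p n)]) ps) @
             (if cofactor ps n = 1 then [] else [int (cofactor ps n), 1])) U3 T4"
            using Q[OF s4' U T] unfolding o .
        qed
      qed (use iw in \<open>auto simp: C_def K_def\<close>)
      then show "wp w (print rI) (wp w (print rF) (wp w fetch_prog (wp w print_prog Q))) R2 M os U1 T2"
        by simp
    qed
  qed (use iw R in \<open>auto simp: C_def K_def\<close>)
  note A = this
  show ?thesis unfolding block_prog_def
    apply (simp add: R an iwn)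
    apply (rule wp_mono[OF A])
    apply simp
    done
qed


definition block :: "nat \<Rightarrow> int list" where
  "block n = enc_block (n, factor_list y n)"

definition block_time :: "nat \<Rightarrow> nat" where
  "block_time n = 100 + 80 * Omega n"

lemma wp_output:
  assumes R: "R rX = int x" "R rM = int seg" "R rN = int N" "R rA = int a" and N: "N \<le> x + 1"
    and a: "1 \<le> a" "a \<le> x"
    and cells: "cells N (\<lambda>j. divisors_in (primes_upto y) (a + j)) M"
    and Q: "\<And>R' U' T'. same {rJ, rI, rP, rC, rK, rU, rD, rF, rT, rE, rQ, rV, rW} R' R \<Longrightarrow> U' \<le> max U (N + 2 * seg) \<Longrightarrow>
      T' \<le> T + 20 + sum_list (map block_time [a..<min (a + seg) (x + 1)]) \<Longrightarrow>
      Q R' M (os @ concat (map block [a..<min (a + seg) (x + 1)])) U' T'"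
  shows "wp w output_prog Q R M os U T"
proof -
  let ?S = "{rJ, rI, rP, rC, rK, rU, rD, rF, rT, rE, rQ, rV, rW}"
  \<comment> \<open>The last segment is cut at \<open>x\<close>; from \<open>a\<close> on there are
    \<open>x + 1 - a\<close> numbers left.\<close>
  define H where "H = min seg (x + 1 - a)"
  have aH: "a + H = min (a + seg) (x + 1)" using a by (auto simp: H_def)
  have upt: "[a..<a + Suc k] = [a..<a + k] @ [a + k]" for k by simp
  have iw: "in_word w (int a + int k)" "in_word w (int k)" "in_word w (int k + 1)" if "k \<le> seg" for k
    using that a seg_bounds x3 by (auto intro!: in_word_lin)
  have iwx: "in_word w (int x + 1)" using x3 by (intro in_word_lin) auto
  show ?thesis unfolding output_prog_def
    apply simp
    apply (rule wp_for_same[where N = H and S = ?S and I = "\<lambda>k R' M' os' U' T'.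
       os' = os @ concat (map block [a..<a + k]) \<and> M' = M \<and> R' rJ = int k \<and>
       U' \<le> max U (N + 2 * seg) \<and> T' \<le> T + 1 + sum_list (map block_time [a..<a + k])"])
    subgoal by simp
    subgoal premises P for k R1 M1 os1 U1 T1
    proof -
      have k: "k < seg" "a + k \<le> x" using P(1) a by (auto simp: H_def)
      have st: "os1 = os @ concat (map block [a..<a + k])" "M1 = M" "R1 rJ = int k" "U1 \<le> max U (N + 2 * seg)"
        "T1 \<le> T + 1 + sum_list (map block_time [a..<a + k])" using P(4) by auto
      have P2: "same ?S R1 R" using P(2) by simp
      have Rs: "R1 rX = int x" "R1 rM = int seg" "R1 rN = int N" "R1 rA = int a" using P(3) R by simp_all
      define Q' where "Q' = (\<lambda>R' M' os' U' T'. in_word w (R' rJ + 1) \<and> same ?S (R'(rU := 1, rJ := R' rJ + 1)) R \<and>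
          os' = os @ concat (map block [a..<a + Suc k]) \<and> M' = M \<and> R' rJ = int k \<and>
          U' \<le> max U (N + 2 * seg) \<and> T' + 3 \<le> T + 1 + sum_list (map block_time [a..<a + Suc k]))"
      have A: "wp w block_prog Q' (R1(rU := 1, rT := 1)) M os1 U1 (Suc (Suc (Suc (Suc (Suc (Suc (Suc T1)))))))"
      proof (rule wp_block[OF _ _ _ N k(1) a(1) k(2) cells])
        fix R2 U2 T2
        assume h: "same {rI, rP, rC, rK, rU, rD, rF, rT, rE, rQ, rV, rW} R2 (R1(rU := 1, rT := 1))"
          "U2 \<le> max U1 (N + 2 * seg)" "T2 \<le> Suc (Suc (Suc (Suc (Suc (Suc (Suc T1)))))) + 70 + 80 * Omega (a + k)"
        have "same {rI, rP, rC, rK, rU, rD, rF, rT, rE, rQ, rV, rW} R2 R1" using h(1) by simp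
        then have "same ?S R2 R" by (rule same_trans[OF _ P2]) auto
        moreover have "R2 rJ = int k" using sameD[OF h(1)] st by simp
        ultimately show "Q' R2 M (os1 @ enc_block (a + k, factor_list y (a + k))) U2 T2"
          using h(2,3) st iw[of k] k unfolding Q'_def upt
          by (simp add: block_def block_time_def)
      qed (use Rs st in auto)
      show ?thesis
        apply (simp add: Rs st(2,3) iwx iw[OF less_imp_le[OF k(1)]] k)
        apply (intro conjI impI)
        subgoal
          apply (rule wp_mono[OF A])
          apply (simp add: Q'_def iw[OF less_imp_le[OF k(1)]])
          done
        subgoal using k by linarith
        done
    qed
    subgoal premises P for R1 M1 os1 U1 T1
    proof -
      have st: "os1 = os @ concat (map block [a..<a + H])" "M1 = M" "R1 rJ = int H" "U1 \<le> max U (N + 2 * seg)"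
        "T1 \<le> T + 1 + sum_list (map block_time [a..<a + H])" using P(3) by auto
      have Rs: "R1 rX = int x" "R1 rM = int seg" "R1 rA = int a" using P(2) R by simp_all
      have H: "H \<le> seg" "H < seg \<Longrightarrow> a + H = x + 1" using a by (auto simp: H_def)
      have Q': "Q R' M os1 U1 T'" if "same ?S R' R" "T' \<le> T1 + 10" for R' T'
        using Q[OF that(1) st(4), of T'] that(2) st(1,5) unfolding aH by simp
      show ?thesis
      proof (cases "H = seg")
        case True
        then show ?thesis using P(1) iw[of H] iwx by (auto simp: Rs st(2,3) intro!: Q')
      next
        case False
        then have "int a + int H = int x + 1" using H by simp
        then show ?thesis using P(1) iw[of H] iwx H(1) by (auto simp: Rs st(2,3) intro!: Q')
      qed
    qed
    done
qed

section \<open>The whole program\<close>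

definition seg_time :: "nat list list \<Rightarrow> nat" where
  "seg_time bs = 100 + 20 * seg + 30 * length bs + sieve_time (concat bs) + 10 * L"

text \<open>The postcondition still mentions the division \<open>bs\<close> of the entries into
  words and the number \<open>H\<close> of segments. The number-theoretic estimates are thus kept
  apart from the program proof and are applied to these two data afterwards.\<close>

lemma wp_main:
  assumes R: "R rX = int x"
    and Q: "\<And>R' M' U' T' bs H. entries_ok G (concat bs) \<Longrightarrow>
      decode_entries 1 (concat bs) = primes_upto y \<Longrightarrow> 1 + advance (concat bs) \<le> y \<Longrightarrow>
      (L - 1) * length bs \<le> (l + 2) * length (concat bs) + (L - 1) \<Longrightarrow>
      U' \<le> length bs + 2 * seg \<Longrightarrow> H * seg \<le> x + seg \<Longrightarrow>
      T' \<le> 200 + 20 * y + 20 * L + 20 * l + y * (10 * y + 60) + H * seg_time bs + sum_list (map block_time [1..<x + 1]) \<Longrightarrow>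
      Q R' M' (concat (map block [1..<x + 1])) U' T'"
  shows "wp w main_prog Q R M [] 0 0"
  unfolding main_prog_def wp.simps(2)
proof (rule wp_sqrt[where R = R, OF R])
  fix R1 T1
  assume s1: "same {rY, rT, rU} R1 R" "R1 rY = int y" "T1 \<le> 0 + 20 * y"
  have R1: "R1 rX = int x" using sameD[OF s1(1)] R by simp
  show "wp w (log_prog rX rL) (wp w (log_prog rL rl) (wp w setup_prog (wp w gen_prog (wp w (const rA 1)
     (wp w (Loop (const rU 1 ;; arith Add rT rX rU ;; arith Less rT rA rT) rT
       (clear_prog ;; sieve_prog ;; output_prog ;; arith Add rA rA rM)) Q))))) R1 M [] 0 T1"
  proof (rule wp_log[where R = R1 and a = rX, OF _ _ R1 le_refl L])
    fix R2 T2
    assume s2: "same {rL, rG, rT, rU} R2 R1" "R2 rL = int L" "T2 \<le> T1 + 20 * L"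
    have R2: "R2 rX = int x" "R2 rY = int y" using sameD[OF s2(1)] R1 s1 by simp_all
    show "wp w (log_prog rL rl) (wp w setup_prog (wp w gen_prog (wp w (const rA 1)
     (wp w (Loop (const rU 1 ;; arith Add rT rX rU ;; arith Less rT rA rT) rT
       (clear_prog ;; sieve_prog ;; output_prog ;; arith Add rA rA rM)) Q)))) R2 M [] 0 T2"
    proof (rule wp_log[where R = R2 and a = rL, OF _ _ s2(2) L_le_x l])
      fix R3 T3
      assume s3: "same {rl, rG, rT, rU} R3 R2" "R3 rl = int l" "R3 rG = int (2 ^ l)" "T3 \<le> T2 + 20 * l"
      have R3: "R3 rX = int x" "R3 rY = int y" "R3 rL = int L" "R3 rG = int G"
        using sameD[OF s3(1)] R2 s2 s3 by (simp_all add: G_def)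
      define R4 where "R4 = R3(rT := int L * int l, rM := int seg, rU := 4, rR := 4 * int G)"
      have Ll: "L * l \<le> x * x" using L_le_x l_le_L by (intro mult_le_mono) auto
      have iw: "in_word w (int L * int l)" "in_word w (int y div (int L * int l))" "in_word w (int y div (int L * int l) + 1)"
        "in_word w (4 * int G)"
      proof -
        have "int (L * l) \<le> int (x * x)" using Ll by (simp only: of_nat_le_iff)
        then have "int L * int l \<le> int x * int x" by simp
        moreover have "0 \<le> int L * int l" by simp
        moreover have "1 * 1 \<le> int x * int x" using x3 by (intro mult_mono) auto
        ultimately show "in_word w (int L * int l)" by (intro in_word_quad; linarith)
        have "int y div (int L * int l) + 1 = int seg" by (simp add: seg_def of_nat_div)
        then show "in_word w (int y div (int L * int l))" "in_word w (int y div (int L * int l) + 1)"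
          using seg_bounds by (auto intro!: in_word_lin)
        show "in_word w (4 * int G)" using G_bounds by (intro in_word_lin) auto
      qed
      have segI: "int y div (int L * int l) + 1 = int seg" by (simp add: seg_def of_nat_div)
      have Ll0: "int L * int l \<noteq> 0" using L_ge_2 l_ge_2 by simp
      have "wp w gen_prog (wp w (const rA 1)
         (wp w (Loop (const rU 1 ;; arith Add rT rX rU ;; arith Less rT rA rT) rT
           (clear_prog ;; sieve_prog ;; output_prog ;; arith Add rA rA rM)) Q)) R4 M [] 0 (Suc (Suc (Suc (Suc (Suc (Suc T3))))))"
      proof (rule wp_gen)
        show "R4 rX = int x" "R4 rY = int y" "R4 rG = int G" "R4 rR = 4 * int G"
          by (simp_all add: R4_def R3)
        fix R5 M5 U5 T5 bs
        assume s5: "same {rN, rW, rB, rC, rI, rD, rF, rE, rT, rU} R5 R4" "R5 rN = int (length bs)"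
          and mem: "\<forall>i<length bs. M5 i = int (pack (4 * G) (bs ! i))"
          and ok: "entries_ok G (concat bs)" and dec: "decode_entries 1 (concat bs) = primes_upto y"
          and adv: "1 + advance (concat bs) \<le> y"
          and len: "(L - 1) * length bs \<le> (l + 2) * length (concat bs) + (L - 1)" "length bs \<le> x + 1"
          and pk: "\<forall>i<length bs. pack (4 * G) (bs ! i) < x * (8 * x)"
          and U5: "U5 \<le> max 0 (length bs)"
          and T5: "T5 \<le> Suc (Suc (Suc (Suc (Suc (Suc T3))))) + 20 + y * (10 * y + 60)"
        define N where "N = length bs"
        have R5: "R5 rX = int x" "R5 rM = int seg" "R5 rN = int N" "R5 rR = 4 * int G"
          using sameD[OF s5(1)] s5(2) by (simp_all add: R4_def R3 N_def)
        let ?S = "{rA, rT, rU, rJ, rE, rP, rV, rQ, rW, rI, rC, rK, rD, rF}"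
        \<comment> \<open>Segment \<open>k\<close>, counted from 0, starts at
          \<open>1 + k * seg\<close>, so \<open>H\<close> is the number of segments that start
          within \<open>x\<close>.\<close>
        define H where "H = (LEAST k. x < 1 + k * seg)"
        have "x < 1 + x * seg" using mult_le_mono2[OF seg_bounds(1), of x] by linarith
        then have H: "x < 1 + H * seg" unfolding H_def by (rule LeastI)
        have Hlt: "1 + k * seg \<le> x" if "k < H" for k using not_less_Least[OF that[unfolded H_def]] by simp
        have Hs: "H * seg \<le> x + seg"
        proof (cases H)
          case (Suc k)
          then show ?thesis using Hlt[of k] by simp
        qed simp
        \<comment> \<open>The time allowed for the first \<open>k\<close> segments. Printing is
          charged to the numbers printed, with the range cut at \<open>x\<close>, and everything
          else to the segments.\<close>
        define tm where "tm k = T5 + 2 + k * seg_time bs + sum_list (map block_time [1..<min (1 + k * seg) (x + 1)])" for k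
        show "wp w (const rA 1) (wp w (Loop (const rU 1 ;; arith Add rT rX rU ;; arith Less rT rA rT) rT
           (clear_prog ;; sieve_prog ;; output_prog ;; arith Add rA rA rM)) Q) R5 M5 [] U5 T5"
          apply simp
          apply (rule wp_for_same[where N = H and S = ?S and I = "\<lambda>k R' M' os' U' T'.
            R' rA = int (1 + k * seg) \<and> (\<forall>i<N. M' i = M5 i) \<and>
            os' = concat (map block [1..<min (1 + k * seg) (x + 1)]) \<and> U' \<le> N + 2 * seg \<and> T' \<le> tm k"])
          subgoal using U5 by (simp add: tm_def N_def)
          subgoal premises P for k R6 M6 os6 U6 T6
          proof -
            define a where "a = 1 + k * seg"
            have a: "1 \<le> a" "a \<le> x" using Hlt[OF P(1)] by (auto simp: a_def)
            have P2: "same ?S R6 R5" using P(2) by simp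
            have R6: "R6 rX = int x" "R6 rM = int seg" "R6 rN = int N" "R6 rR = 4 * int G" "R6 rA = int a"
              using P(3,4) R5 by (simp_all add: a_def)
            have st: "\<forall>i<N. M6 i = M5 i" "os6 = concat (map block [1..<a])" "U6 \<le> N + 2 * seg" "T6 \<le> tm k"
              using P(4) a by (auto simp: a_def min_def)
            have Nx: "N \<le> x + 1" using len by (simp add: N_def)
            define Q' where "Q' = (\<lambda>R' M' os' U' T'. same ?S R' R5 \<and> R' rA = int (1 + Suc k * seg) \<and> (\<forall>i<N. M' i = M5 i) \<and>
              os' = concat (map block [1..<min (1 + Suc k * seg) (x + 1)]) \<and> U' \<le> N + 2 * seg \<and> Suc T' \<le> tm (Suc k))"
            have A: "wp w clear_prog (wp w sieve_prog (wp w output_prog (wp w (arith Add rA rA rM) Q')))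
               (R6(rU := 1, rT := 1)) M6 os6 U6 (Suc (Suc (Suc (Suc T6))))"
            proof (rule wp_clear[OF _ _ Nx])
              fix R7 M7 U7 T7
              assume s7: "same {rJ, rE, rT, rP, rU} R7 (R6(rU := 1, rT := 1))" "\<forall>i<N. M7 i = M6 i"
                "cells N (\<lambda>_. []) M7" "U7 \<le> max U6 (N + 2 * seg)" "T7 \<le> Suc (Suc (Suc (Suc T6))) + 20 * seg"
              have R7: "R7 rX = int x" "R7 rM = int seg" "R7 rN = int N" "R7 rR = 4 * int G" "R7 rA = int a"
                using sameD[OF s7(1)] R6 by simp_all
              have "same {rJ, rE, rT, rP, rU} R7 R6" using s7(1) by simp
              then have s7': "same ?S R7 R5" by (rule same_trans[OF _ P2]) auto
              have W7: "\<forall>i<N. M7 i = int (pack (4 * G) (bs ! i)) \<and> pack (4 * G) (bs ! i) < x * (8 * x)"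
                using mem pk s7(2) st(1) by (simp add: N_def)
              show "wp w sieve_prog (wp w output_prog (wp w (arith Add rA rA rM) Q')) R7 M7 os6 U7 T7"
              proof (rule wp_sieve[OF R7(2,3,5,4) N_def Nx a ok adv dec W7 s7(3)])
                fix R8 M8 U8 T8
                assume s8: "same {rJ, rE, rT, rP, rU, rV, rQ, rW, rI} R8 R7" "\<forall>i<N. M8 i = M7 i"
                  "cells N (\<lambda>j. divisors_in (primes_upto y) (a + j)) M8" "U8 \<le> max U7 (N + 2 * seg)"
                  "T8 \<le> T7 + 30 + 30 * N + sieve_time (concat bs) + 10 * L"
                have R8: "R8 rX = int x" "R8 rM = int seg" "R8 rN = int N" "R8 rA = int a"
                  using sameD[OF s8(1)] R7 by simp_all
                have s8': "same ?S R8 R5" by (rule same_trans[OF s8(1) s7']) auto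
                show "wp w output_prog (wp w (arith Add rA rA rM) Q') R8 M8 os6 U8 T8"
                proof (rule wp_output[OF R8 Nx a s8(3)])
                  fix R9 U9 T9
                  assume s9: "same {rJ, rI, rP, rC, rK, rU, rD, rF, rT, rE, rQ, rV, rW} R9 R8"
                    "U9 \<le> max U8 (N + 2 * seg)"
                    "T9 \<le> T8 + 20 + sum_list (map block_time [a..<min (a + seg) (x + 1)])"
                  have R9: "R9 rM = int seg" "R9 rA = int a" using sameD[OF s9(1)] R8 by simp_all
                  have s9': "same ?S R9 R5" by (rule same_trans[OF s9(1) s8']) auto
                  have iw: "in_word w (int a + int seg)" using a seg_bounds by (intro in_word_lin) auto
                  have am: "min (1 + k * seg) (x + 1) = a" "min (1 + Suc k * seg) (x + 1) = min (a + seg) (x + 1)"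
                    using a by (auto simp: a_def min_def)
                  have upt: "[1..<min (a + seg) (x + 1)] = [1..<a] @ [a..<min (a + seg) (x + 1)]"
                  proof -
                    have "a \<le> min (a + seg) (x + 1)" using a by simp
                    then obtain d where d: "min (a + seg) (x + 1) = a + d" by (metis le_iff_add)
                    show ?thesis unfolding d by (rule upt_add_eq_append[OF a(1)])
                  qed
                  have "tm (Suc k) = T5 + 2 + (k * seg_time bs + seg_time bs) +
                     (sum_list (map block_time [1..<a]) + sum_list (map block_time [a..<min (a + seg) (x + 1)]))"
                    unfolding tm_def am upt by simp
                  moreover have "tm k = T5 + 2 + k * seg_time bs + sum_list (map block_time [1..<a])"
                    unfolding tm_def am ..
                  ultimately have tt: "T9 + 2 \<le> tm (Suc k)"
                    using s9(3) s8(5) s7(5) st(4) by (simp add: seg_time_def N_def)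
                  have os: "os6 @ concat (map block [a..<min (a + seg) (x + 1)]) = concat (map block [1..<min (1 + Suc k * seg) (x + 1)])"
                    unfolding am upt st(2) by simp
                  have ra: "int a + int seg = 1 + (int seg + int k * int seg)" by (simp add: a_def)
                  show "wp w (arith Add rA rA rM) Q' R9 M8 (os6 @ concat (map block [a..<min (a + seg) (x + 1)])) U9 T9"
                    unfolding os using R9 iw s9' tt s9(2) s8(2,4) s7(2,4) st(1,3)
                    by (simp add: Q'_def ra)
                qed
              qed
            qed (use R6 in auto)
            have iwx: "in_word w (int x + 1)" using x3 by (intro in_word_lin) auto
            have B: "wp w (const rU 1 ;; arith Add rT rX rU ;; arith Less rT rA rT) (\<lambda>R' M' os' U' T'. R' rT \<noteq> 0 \<and>
               wp w (clear_prog ;; sieve_prog ;; output_prog ;; arith Add rA rA rM) Q' R' M' os' U' (Suc T')) R6 M6 os6 U6 T6"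
              using A a by (simp add: R6 iwx)
            show ?thesis
              apply (rule wp_mono[OF B])
              apply (erule conjE, rule conjI, assumption)
              apply (erule wp_mono)
              apply (simp add: Q'_def)
              done
          qed
          subgoal premises P for R6 M6 os6 U6 T6
          proof -
            have R6: "R6 rX = int x" "R6 rA = int (1 + H * seg)" using P(2,3) R5 by simp_all
            have iwx: "in_word w (int x + 1)" using x3 by (intro in_word_lin) auto
            have mH: "min (1 + H * seg) (x + 1) = x + 1" using H by simp
            have st: "os6 = concat (map block [1..<x + 1])" "U6 \<le> N + 2 * seg" "T6 \<le> tm H"
              using P(3) unfolding mH by auto
            have c: "\<not> int (1 + H * seg) < int x + 1" using H by linarith
            have "Q R' M6 os6 U6 (Suc (Suc (Suc (Suc T6))))" for R'
              unfolding st(1)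
            proof (rule Q[OF ok dec adv len(1) _ Hs])
              show "U6 \<le> length bs + 2 * seg" using st by (simp add: N_def)
              show "Suc (Suc (Suc (Suc T6))) \<le> 200 + 20 * y + 20 * L + 20 * l + y * (10 * y + 60) + H * seg_time bs + sum_list (map block_time [1..<x + 1])"
                using st(3) T5 s3(4) s2(3) s1(3) unfolding tm_def mH by linarith
            qed
            then show ?thesis using c by (simp add: R6 iwx)
          qed
          done
      qed
      note A = this
      show "wp w setup_prog (wp w gen_prog (wp w (const rA 1)
         (wp w (Loop (const rU 1 ;; arith Add rT rX rU ;; arith Less rT rA rT) rT
           (clear_prog ;; sieve_prog ;; output_prog ;; arith Add rA rA rM)) Q))) R3 M [] 0 T3"
        unfolding setup_prog_def
        using A iw Ll0 by (simp add: R3 s3(2) segI[symmetric] R4_def fun_upd_twist mult.commute)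
    qed (use L_ge_2 in auto)
  qed (use x3 in auto)
qed

end

subsection \<open>Resource bounds\<close>

text \<open>Beyond 6 the left side grows by at most \<open>(7 / 6) ^ 4 = 2401 / 1296\<close>, which
  is below 2. With the constant 32 the bound used in \<open>L_sq_le\<close> is the perfect square
  \<open>256 * (y * y)\<close>.\<close>

lemma power4_le_exp: "n ^ 4 \<le> 32 * (2::nat) ^ n"
proof (induction n rule: less_induct)
  case (less n)
  show ?case
  proof (cases "n \<le> 6")
    case True
    then have "n \<in> {0, 1, 2, 3, 4, 5, 6}" by auto
    then show ?thesis by auto
  next
    case False
    then obtain m where m: "n = Suc m" "m \<ge> 6" by (cases n) auto
    have "6 * (m + 1) \<le> 7 * m" using m by simp
    then have "(6 * (m + 1)) ^ 4 \<le> (7 * m) ^ 4" by (rule power_mono) simp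
    then have "1296 * (m + 1) ^ 4 \<le> 2401 * m ^ 4" by (simp only: power_mult_distrib) simp
    then have "(m + 1) ^ 4 \<le> 2 * m ^ 4" by linarith
    also have "\<dots> \<le> 2 * (32 * 2 ^ m)" using less.IH[of m] m by simp
    finally show ?thesis using m by simp
  qed
qed

text \<open>Applied to \<open>l\<close> it gives \<open>l * (l + 2)\<close> at most
  \<open>8 * L\<close>, the reason why the packed prime list fits into the space bound.\<close>

lemma quadratic_le_exp: "n * (n + 2) \<le> 4 * (2::nat) ^ n"
proof (induction n rule: less_induct)
  case (less n)
  show ?case
  proof (cases "n \<le> 3")
    case True
    then have "n \<in> {0, 1, 2, 3}" by auto
    then show ?thesis by auto
  next
    case False
    then obtain m where m: "n = Suc m" "m \<ge> 3" by (cases n) auto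
    have "9 \<le> m * m" using mult_le_mono[OF m(2) m(2)] by simp
    then have "Suc m * (Suc m + 2) \<le> 2 * (m * (m + 2))" using m by (simp add: algebra_simps)
    also have "\<dots> \<le> 2 * (4 * 2 ^ m)" using less.IH[of m] m by simp
    finally show ?thesis using m by simp
  qed
qed

text \<open>This makes \<open>ln (ln x)\<close> positive from 3 on. That \<open>exp 1\<close> is
  strictly below 3 follows from \<open>(5 / 6) ^ 6 > 1 / 3\<close>.\<close>

lemma one_less_ln_3: "1 < ln (3::real)"
proof -
  have "1 + (- 1 / 6) \<le> exp (- 1 / 6 :: real)" by (rule exp_ge_add_one_self)
  then have "(5 / 6) ^ 6 \<le> exp (- 1 / 6 :: real) ^ 6" by (intro power_mono) auto
  also have "\<dots> = exp (- 1)" by (simp add: exp_of_nat_mult[symmetric])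
  finally have "1 / 3 < exp (- 1 :: real)" by (simp add: power_divide)
  then have "exp 1 < (3::real)" by (simp add: exp_minus field_simps)
  then have "ln (exp 1) < ln (3::real)" by (subst ln_less_cancel_iff) auto
  then show ?thesis by simp
qed

context sieve
begin

text \<open>As \<open>x\<close> is below \<open>4 * (y * y)\<close>, its logarithm is small against
  \<open>y\<close>. This keeps a constant number of words within the space bound, and
  \<open>10 * L\<close> steps within the time allowed for one segment.\<close>

lemma L_sq_le: "L * L \<le> 16 * y"
proof -
  have "(y + 1) * (y + 1) \<le> (2 * y) * (2 * y)" using y_ge_1 by (intro mult_le_mono) auto
  then have "(2::nat) ^ (L - 1) \<le> 4 * (y * y)" using L(1) y(2) by simp
  moreover have "(2::nat) ^ L = 2 * 2 ^ (L - 1)" using L_ge_2 by (cases L) auto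
  ultimately have "L ^ 4 \<le> 256 * (y * y)" using power4_le_exp[of L] by simp
  then have "(L * L)\<^sup>2 \<le> (16 * y)\<^sup>2" by (simp add: power2_eq_square power4_eq_xxxx mult_ac)
  then show ?thesis by (rule power2_le_imp_le) simp
qed

text \<open>Chebyshev's bound is applied at the least power \<open>2 ^ m\<close> above
  \<open>y\<close>. Since \<open>y\<close> is about the square root of \<open>x\<close>, this
  \<open>m\<close> is at least \<open>L / 2\<close>.\<close>

lemma L_primes_le: "L * length (primes_upto y) \<le> 24 * y"
proof -
  define m where "m = (LEAST m. y < 2 ^ m)"
  have "y < 2 ^ y" by (rule less_exp)
  then have m: "y < 2 ^ m" unfolding m_def by (rule LeastI)
  have m0: "m \<noteq> 0" using m y_ge_1 by (intro notI) simp
  have "\<not> y < 2 ^ (m - 1)"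
    by (rule not_less_Least) (use m0 in \<open>simp add: m_def[symmetric]\<close>)
  then have my: "2 ^ m \<le> 2 * y" using m0 by (cases m) auto
  have "(2::nat) ^ (L - 1) < 2 ^ m * 2 ^ m"
    using L(1) y(2) mult_le_mono[of "y + 1" "2 ^ m" "y + 1" "2 ^ m"] m by linarith
  also have "(2::nat) ^ m * 2 ^ m = 2 ^ (m + m)" by (rule power_add[symmetric])
  finally have "L - 1 < m + m" by (subst (asm) power_strict_increasing_iff) auto
  then have "L \<le> 2 * m" by simp
  then have "L * length (primes_upto y) \<le> 2 * m * length (primes_upto y)" by (rule mult_le_mono1)
  also have "length (primes_upto y) \<le> card {p::nat. prime p \<and> p \<le> 2 ^ m}"
    unfolding length_primes_upto by (rule card_mono) (use m in auto)
  then have "2 * m * length (primes_upto y) \<le> 2 * (m * card {p::nat. prime p \<and> p \<le> 2 ^ m})" by simp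
  also have "\<dots> \<le> 2 * (6 * 2 ^ m)" using card_primes_le_pow2[of m] by linarith
  also have "\<dots> \<le> 24 * y" using my by simp
  finally show ?thesis .
qed

text \<open>\<open>E - P\<close> counts the entries that report no prime. Each of them advances by
  \<open>G > L\<close>, and the total advance is below \<open>y\<close>.\<close>

lemma L_entries_le:
  assumes ok: "entries_ok G es" and dec: "decode_entries 1 es = primes_upto y" and adv: "1 + advance es \<le> y"
  shows "L * length es \<le> 25 * y"
proof -
  define E P where "E = length es" and "P = length (primes_upto y)"
  have "G * E \<le> G * P + y"
    using length_entries_le[OF ok, of 1] adv unfolding dec by (simp add: E_def P_def)
  then have "G * (E - P) \<le> y" by (simp add: diff_mult_distrib2)
  moreover have "L * (E - P) \<le> G * (E - P)" using G_bounds(3) by (intro mult_le_mono1) simp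
  ultimately have "L * (E - P) \<le> y" by linarith
  moreover have "L * E \<le> L * (P + (E - P))" by (intro mult_le_mono2) simp
  ultimately show ?thesis using L_primes_le by (simp add: E_def P_def distrib_left)
qed

lemma L_words_le:
  assumes "(L - 1) * N \<le> (l + 2) * E + (L - 1)"
  shows "L * N \<le> 2 * ((l + 2) * E) + 2 * L"
proof -
  have "L * N \<le> 2 * (L - 1) * N" using L_ge_2 by (intro mult_le_mono1) simp
  also have "\<dots> = 2 * ((L - 1) * N)" by simp
  also have "\<dots> \<le> 2 * ((l + 2) * E + (L - 1))" using assms by (rule mult_le_mono2)
  finally show ?thesis by simp
qed

text \<open>With \<open>r\<close> registers and memory mark \<open>U\<close> the space is of order
  \<open>L * (r + U)\<close> bits, so the claim is a bound of order \<open>y / l\<close>, multiplied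
  out to stay in the natural numbers.\<close>

lemma space_le:
  assumes ok: "entries_ok G (concat bs)" and dec: "decode_entries 1 (concat bs) = primes_upto y"
    and adv: "1 + advance (concat bs) \<le> y"
    and len: "(L - 1) * length bs \<le> (l + 2) * length (concat bs) + (L - 1)"
    and U: "U \<le> length bs + 2 * seg"
  shows "l * (L * (r + U)) \<le> (16 * r + 500) * y"
proof -
  define N E where "N = length bs" and "E = length (concat bs)"
  have LE: "L * E \<le> 25 * y" unfolding E_def by (rule L_entries_le[OF ok dec adv])
  have lL: "l * L \<le> 16 * y"
    using mult_le_mono1[OF l_le_L, of L] L_sq_le by linarith
  have l2: "l * (l + 2) \<le> 8 * L"
    using quadratic_le_exp[of l] pow_l_le by linarith
  have N: "L * N \<le> 2 * ((l + 2) * E) + 2 * L"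
    using L_words_le len unfolding N_def E_def by blast
  have "l * (L * N) \<le> l * (2 * ((l + 2) * E) + 2 * L)" using N by (rule mult_le_mono2)
  also have "\<dots> = 2 * (l * (l + 2) * E) + 2 * (l * L)" by (simp add: algebra_simps)
  also have "l * (l + 2) * E \<le> 8 * L * E" using l2 by (rule mult_le_mono1)
  also have "8 * L * E = 8 * (L * E)" by simp
  also have "8 * (L * E) \<le> 200 * y" using LE by linarith
  finally have 1: "l * (L * N) \<le> 432 * y" using lL by simp
  have "l * (L * seg) = (L * l) * (y div (L * l)) + l * L" by (simp add: seg_def algebra_simps)
  also have "(L * l) * (y div (L * l)) \<le> y" by (rule times_div_less_eq_dividend)
  finally have 2: "l * (L * seg) \<le> 17 * y" using lL by simp
  have 3: "l * (L * r) \<le> 16 * r * y" using mult_le_mono1[OF lL, of r] by (simp add: mult_ac)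
  have "l * (L * (r + U)) \<le> l * (L * (r + (N + 2 * seg)))"
    using U by (intro mult_le_mono2) (simp add: N_def)
  also have "\<dots> = l * (L * r) + l * (L * N) + 2 * (l * (L * seg))" by (simp add: algebra_simps)
  also have "\<dots> \<le> 16 * r * y + 432 * y + 2 * (17 * y)" using 1 2 3 by linarith
  also have "\<dots> \<le> (16 * r + 500) * y" by (simp add: algebra_simps)
  finally show ?thesis .
qed

lemma y_le_seg: "y \<le> seg * (L * l)"
proof -
  have "L * l > 0" using L_ge_2 l_ge_2 by simp
  then have "y mod (L * l) < L * l" by simp
  moreover have "y = y div (L * l) * (L * l) + y mod (L * l)" by (simp only: div_mult_mod_eq)
  ultimately show ?thesis unfolding seg_def add_mult_distrib mult_1 by linarith
qed

text \<open>Converts a bound of order \<open>y / L\<close> into one of order \<open>seg * l\<close>,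
  the time allowed for one segment.\<close>

lemma div_L_le:
  assumes "L * n \<le> c * y"
  shows "n \<le> c * (seg * l)"
proof -
  have "L * n \<le> c * (seg * (L * l))" using assms mult_le_mono2[OF y_le_seg, of c] by linarith
  then have "L * n \<le> L * (c * (seg * l))" by (simp add: mult_ac)
  then show ?thesis using L_ge_2 by simp
qed

lemma sum_inverse_primes: "z \<le> x \<Longrightarrow> (\<Sum>p | prime p \<and> p \<le> z. 1 / real p) \<le> 3 * real l"
  using sum_inverse_primes_le[of z L l] L(2) l(2) l_ge_2 by simp

text \<open>Walking through the list costs order \<open>y / L\<close>, that is, order
  \<open>seg * l\<close> by the choice of \<open>seg\<close>. Marking costs \<open>seg\<close> times
  the sum of the prime reciprocals, which is again of this order.\<close>

lemma seg_time_le: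
  assumes ok: "entries_ok G (concat bs)" and dec: "decode_entries 1 (concat bs) = primes_upto y"
    and adv: "1 + advance (concat bs) \<le> y"
    and len: "(L - 1) * length bs \<le> (l + 2) * length (concat bs) + (L - 1)"
  shows "real (seg_time bs) \<le> 7000 * (real seg * real l)"
proof -
  define N E P where "N = length bs" and "E = length (concat bs)" and "P = length (primes_upto y)"
  define z where "z = seg * l"
  have z1: "seg \<le> z" "1 \<le> z" using seg_bounds(1) l_ge_2 by (simp_all add: z_def)
  have E: "E \<le> 25 * z" unfolding E_def z_def by (rule div_L_le[OF L_entries_le[OF ok dec adv]])
  have P: "P \<le> 24 * z" unfolding P_def z_def by (rule div_L_le[OF L_primes_le])
  have L': "L \<le> 16 * z" unfolding z_def by (rule div_L_le[OF L_sq_le])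
  have "L * N \<le> 2 * ((l + 2) * E) + 2 * L"
    using L_words_le len unfolding N_def E_def by blast
  also have "(l + 2) * E \<le> (2 * L) * E" using l_le_L L_ge_2 by (intro mult_le_mono1) simp
  finally have "L * N \<le> L * (4 * E + 2)" by (simp add: algebra_simps)
  then have N: "N \<le> 4 * E + 2" using L_ge_2 unfolding mult_le_cancel1 by simp
  have "sum_list (map (\<lambda>p. 30 + 20 * (seg div p + 1)) ps) =
      50 * length ps + 20 * sum_list (map (\<lambda>p. seg div p) ps)" for ps
    by (induction ps) auto
  then have "seg_time bs = 100 + 20 * seg + 30 * N + 60 * E + 50 * P + 10 * L +
      20 * sum_list (map (\<lambda>p. seg div p) (primes_upto y))"
    by (simp only: seg_time_def sieve_time_def dec N_def E_def P_def)
  also have "sum_list (map (\<lambda>p. seg div p) (primes_upto y)) = (\<Sum>p | prime p \<and> p \<le> y. seg div p)"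
    by (subst sum_list_distinct_conv_sum_set[OF distinct_primes_upto]) (simp add: set_primes_upto)
  \<comment> \<open>The bounds on \<open>N\<close>, \<open>E\<close>, \<open>P\<close> and
    \<open>L\<close> sum to \<open>6040 * z\<close>: from \<open>4 * E + 2\<close> words alone come
    \<open>3060 * z\<close>.\<close>
  finally have "seg_time bs \<le> 6100 * z + 20 * (\<Sum>p | prime p \<and> p \<le> y. seg div p)"
    using E P L' N z1 by linarith
  then have "real (seg_time bs) \<le> real (6100 * z + 20 * (\<Sum>p | prime p \<and> p \<le> y. seg div p))"
    by (simp only: of_nat_le_iff)
  also have "\<dots> = 6100 * real z + 20 * (\<Sum>p | prime p \<and> p \<le> y. real (seg div p))" by simp
  also have "(\<Sum>p | prime p \<and> p \<le> y. real (seg div p)) \<le> (\<Sum>p | prime p \<and> p \<le> y. real seg * (1 / real p))"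
    by (intro sum_mono) (use of_nat_div_le_of_nat in simp)
  also have "\<dots> = real seg * (\<Sum>p | prime p \<and> p \<le> y. 1 / real p)" by (rule sum_distrib_left[symmetric])
  also have "\<dots> \<le> real seg * (3 * real l)" by (intro mult_left_mono sum_inverse_primes y_le_x) simp
  finally have "real (seg_time bs) \<le> 6100 * real z + 20 * (real seg * (3 * real l))" by simp
  moreover have "real z = real seg * real l" "real seg * (3 * real l) = 3 * (real seg * real l)"
    by (simp_all add: z_def)
  moreover have "0 \<le> real seg * real l" by simp
  ultimately show ?thesis by linarith
qed

lemma block_time_le: "real (sum_list (map block_time [1..<x + 1])) \<le> 600 * (real x * real l)"
proof -
  have "sum_list (map block_time [1..<x + 1]) = (\<Sum>n\<in>{1..x}. block_time n)"
    by (simp only: interv_sum_list_conv_sum_set_nat set_upt Suc_eq_plus1[symmetric] atLeastLessThanSuc_atLeastAtMost)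
  also have "\<dots> = 100 * x + 80 * (\<Sum>n\<in>{1..x}. Omega n)"
    by (simp add: block_time_def sum.distrib sum_distrib_left)
  finally have "real (sum_list (map block_time [1..<x + 1])) = 100 * real x + 80 * real (\<Sum>n\<in>{1..x}. Omega n)"
    by simp
  also have "real (\<Sum>n\<in>{1..x}. Omega n) \<le> 2 * real x * (\<Sum>p | prime p \<and> p \<le> x. 1 / real p)"
    by (rule sum_Omega_le)
  also have "\<dots> \<le> 2 * real x * (3 * real l)" by (intro mult_left_mono sum_inverse_primes) auto
  also have "\<dots> = 6 * (real x * real l)" by simp
  finally have "real (sum_list (map block_time [1..<x + 1])) \<le> 100 * real x + 80 * (6 * (real x * real l))" by simp
  moreover have "100 * real x \<le> 100 * (real x * real l)" using l_ge_2 mult_left_mono[of 1 "real l" "real x"] by simp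
  moreover have "0 \<le> real x * real l" by simp
  ultimately show ?thesis by linarith
qed

lemma time_le:
  assumes ok: "entries_ok G (concat bs)" and dec: "decode_entries 1 (concat bs) = primes_upto y"
    and adv: "1 + advance (concat bs) \<le> y"
    and len: "(L - 1) * length bs \<le> (l + 2) * length (concat bs) + (L - 1)"
    and H: "H * seg \<le> x + seg"
    and T: "T \<le> 200 + 20 * y + 20 * L + 20 * l + y * (10 * y + 60) + H * seg_time bs + sum_list (map block_time [1..<x + 1])"
  shows "real (T + 1) \<le> 15000 * (real x * real l)"
proof -
  have "y * (10 * y + 60) \<le> y * (70 * y)" using y_ge_1 by (intro mult_le_mono2) simp
  moreover have "y * (70 * y) = 70 * (y * y)" by simp
  ultimately have "y * (10 * y + 60) \<le> 70 * x" using y(1) by linarith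
  then have "T + 1 \<le> 210 * x + H * seg_time bs + sum_list (map block_time [1..<x + 1])"
    using T y_le_x L_le_x l_le_L x3 by linarith
  then have "real (T + 1) \<le> real (210 * x + H * seg_time bs + sum_list (map block_time [1..<x + 1]))"
    by (simp only: of_nat_le_iff)
  also have "\<dots> = 210 * real x + real H * real (seg_time bs) + real (sum_list (map block_time [1..<x + 1]))"
    by simp
  also have "real H * real (seg_time bs) \<le> real H * (7000 * (real seg * real l))"
    by (intro mult_left_mono seg_time_le[OF ok dec adv len]) simp
  also have "\<dots> = 7000 * (real (H * seg) * real l)" by simp
  \<comment> \<open>The segments overshoot \<open>x\<close> by at most one segment, and
    \<open>seg\<close> is at most \<open>x\<close>.\<close>
  also have "real (H * seg) \<le> real (2 * x)" using H seg_bounds(3) by (subst of_nat_le_iff) simp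
  then have "7000 * (real (H * seg) * real l) \<le> 7000 * (real (2 * x) * real l)"
    by (intro mult_left_mono mult_right_mono) auto
  also have "real (sum_list (map block_time [1..<x + 1])) \<le> 600 * (real x * real l)" by (rule block_time_le)
  finally have "real (T + 1) \<le> 210 * real x + 7000 * (real (2 * x) * real l) + 600 * (real x * real l)" by simp
  moreover have "210 * real x \<le> 210 * (real x * real l)" using l_ge_2 mult_left_mono[of 1 "real l" "real x"] by simp
  moreover have "real (2 * x) * real l = 2 * (real x * real l)" by simp
  moreover have "0 \<le> real x * real l" by simp
  ultimately show ?thesis by linarith
qed

text \<open>Needed for the time, where \<open>l\<close> is a factor. The crude bounds
  \<open>ln 2\<close> at least \<open>1 / 2\<close> and \<open>ln 3\<close> at most 2 give the
  constants: \<open>L\<close> is at most \<open>3 * ln x\<close>, and \<open>l - 1\<close> at most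
  \<open>2 * (2 + ln (ln x))\<close>.\<close>

lemma l_le_lnln: "real l \<le> 5 + 2 * ln (ln (real x))"
proof -
  have "exp 1 \<le> real x" using exp_le x3 by linarith
  then have lnx: "1 \<le> ln (real x)" using x3 by (subst ln_ge_iff) auto
  have "ln (3::real) \<le> ln (2 ^ 2)" by (subst ln_le_cancel_iff) auto
  then have ln2: "1 / 2 \<le> ln (2::real)" using one_less_ln_3 by (simp only: ln_realpow)
  have "real (2 ^ (L - 1)) \<le> real x" using L(1) by (simp only: of_nat_le_iff)
  then have "(2::real) ^ (L - 1) \<le> real x" by (simp only: of_nat_power of_nat_numeral)
  then have "ln ((2::real) ^ (L - 1)) \<le> ln (real x)" using x3 by (subst ln_le_cancel_iff) auto
  then have "real (L - 1) * ln 2 \<le> ln (real x)" by (simp add: ln_realpow)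
  moreover have "real (L - 1) * (1 / 2) \<le> real (L - 1) * ln 2" using ln2 by (intro mult_left_mono) auto
  moreover have "real (L - 1) = real L - 1" using L_ge_2 by simp
  ultimately have Lx: "real L \<le> 3 * ln (real x)" using lnx by linarith
  have "real (2 ^ (l - 1)) \<le> real L" using l(1) by (simp only: of_nat_le_iff)
  then have "real (2 ^ (l - 1)) \<le> 3 * ln (real x)" using Lx by (rule order_trans)
  then have "(2::real) ^ (l - 1) \<le> 3 * ln (real x)" by (simp only: of_nat_power of_nat_numeral)
  then have "ln ((2::real) ^ (l - 1)) \<le> ln (3 * ln (real x))" using lnx by (subst ln_le_cancel_iff) auto
  also have "\<dots> = ln 3 + ln (ln (real x))" using lnx by (simp add: ln_mult)
  also have "ln (3::real) \<le> 2" using ln_le_minus_one[of "3::real"] by simp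
  finally have "real (l - 1) * ln 2 \<le> 2 + ln (ln (real x))" by (simp add: ln_realpow)
  moreover have "real (l - 1) * (1 / 2) \<le> real (l - 1) * ln 2" using ln2 by (intro mult_left_mono) auto
  moreover have "real (l - 1) = real l - 1" using l_ge_2 by simp
  ultimately show ?thesis by linarith
qed

text \<open>Needed for the space, where \<open>l\<close> is a divisor.\<close>

lemma lnln_le_l: "ln (ln (real x)) \<le> real l"
proof -
  have lnx: "0 < ln (real x)" using x3 by simp
  have "real x \<le> real (2 ^ L)" using L(2) by (subst of_nat_le_iff) simp
  then have "ln (real x) \<le> ln ((2::real) ^ L)" using x3 by (subst ln_le_cancel_iff) auto
  also have "\<dots> = real L * ln 2" by (simp add: ln_realpow)
  also have "\<dots> \<le> real L * 1" using ln_2_less_1 by (intro mult_left_mono) auto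
  also have "\<dots> \<le> real (2 ^ l)" using l(2) by simp
  finally have "ln (ln (real x)) \<le> ln ((2::real) ^ l)" using lnx by (subst ln_le_cancel_iff) auto
  also have "\<dots> = real l * ln 2" by (simp add: ln_realpow)
  also have "\<dots> \<le> real l * 1" using ln_2_less_1 by (intro mult_left_mono) auto
  finally show ?thesis by simp
qed

lemma outputs: "outputs_factorizations x (concat (map block [1..<x + 1]))"
  unfolding outputs_factorizations_def
proof (intro exI[of _ "map (\<lambda>n. (n, factor_list y n)) [1..<x + 1]"] conjI)
  show "concat (map block [1..<x + 1]) = concat (map enc_block (map (\<lambda>n. (n, factor_list y n)) [1..<x + 1]))"
    by (simp add: block_def[abs_def] o_def)
  show "mset (map fst (map (\<lambda>n. (n, factor_list y n)) [1..<x + 1])) = mset [1..<Suc x]" by (simp add: o_def)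
  show "\<forall>(n, ps)\<in>set (map (\<lambda>n. (n, factor_list y n)) [1..<x + 1]). is_factorization n ps"
  proof -
    have "is_factorization n (factor_list y n)" if "n \<in> set [1..<x + 1]" for n
    proof (rule is_factorization_factor_list)
      have "1 \<le> n" "n < x + 1" using that unfolding set_upt atLeastLessThan_iff by blast+
      then show "n > 0" "n < (y + 1)\<^sup>2" using y(2) unfolding power2_eq_square by linarith+
    qed
    then show ?thesis unfolding set_map by (intro ballI) (elim imageE, simp del: upt_Suc set_upt)
  qed
qed

end

section \<open>Choice of the parameters and conclusion\<close>

lemma ex_power2_bracket: "n > 0 \<Longrightarrow> \<exists>k. 2 ^ (k - 1) \<le> (n::nat) \<and> n < 2 ^ k"
proof -
  assume n: "n > 0"
  define k where "k = (LEAST k. n < 2 ^ k)"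
  have "n < 2 ^ n" by (rule less_exp)
  then have k: "n < 2 ^ k" unfolding k_def by (rule LeastI)
  have k0: "k \<noteq> 0" using k n by (intro notI) simp
  have "\<not> n < 2 ^ (k - 1)"
    by (rule not_less_Least) (use k0 in \<open>simp add: k_def[symmetric]\<close>)
  then show ?thesis using k by (intro exI[of _ k]) simp
qed

lemma ex_sqrt_bracket: "\<exists>y. y * y \<le> (x::nat) \<and> x < (y + 1) * (y + 1)"
proof (induction x)
  case (Suc x)
  then obtain y where y: "y * y \<le> x" "x < (y + 1) * (y + 1)" by blast
  show ?case
  proof (cases "Suc x < (y + 1) * (y + 1)")
    case True
    then show ?thesis using y by (intro exI[of _ y]) simp
  next
    case False
    then have "Suc x = (y + 1) * (y + 1)" using y by linarith
    then show ?thesis by (intro exI[of _ "y + 1"]) simp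
  qed
qed (rule exI[of _ 0], simp)

text \<open>Since 100 is below \<open>3 ^ 6\<close>, hence below \<open>x ^ 6\<close>, the product
  \<open>100 * (x * x)\<close> is at most \<open>x ^ 8\<close>: this is the origin of the word size
  factor 8.\<close>

lemma word_size_bound: "x \<ge> 3 \<Longrightarrow> 100 * (x * x) \<le> 2 ^ word_size 8 x"
proof -
  assume x: "x \<ge> 3"
  define c where "c = nat \<lceil>log 2 (real x)\<rceil>"
  have "real x = 2 powr (log 2 (real x))" using x by simp
  also have "\<dots> \<le> 2 powr (real c)" unfolding c_def
    by (intro powr_mono) (use of_nat_ceiling in auto)
  also have "\<dots> = real (2 ^ c)" by (simp add: powr_realpow)
  finally have xc: "x \<le> 2 ^ c" by (simp only: of_nat_le_iff)
  have "3 ^ 6 \<le> x ^ 6" using x by (rule power_mono) simp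
  then have "100 * (x * x) \<le> x ^ 6 * (x * x)" by (intro mult_le_mono1) simp
  also have "\<dots> = x ^ 8" by (simp add: eval_nat_numeral)
  also have "\<dots> \<le> (2 ^ c) ^ 8" using xc by (rule power_mono) simp
  also have "\<dots> = 2 ^ word_size 8 x" by (simp add: word_size_def c_def power_mult[symmetric] mult.commute)
  finally show ?thesis .
qed

lemma word_size_le: "x \<ge> 3 \<Longrightarrow> x < 2 ^ L \<Longrightarrow> word_size 8 x \<le> 8 * L"
proof -
  assume x: "x \<ge> 3" "x < 2 ^ L"
  then have "real x \<le> real (2 ^ L)" by (subst of_nat_le_iff) simp
  then have "log 2 (real x) \<le> log 2 (2 ^ L)" using x by (subst log_le_cancel_iff) auto
  also have "\<dots> = real L" by simp
  finally have "nat \<lceil>log 2 (real x)\<rceil> \<le> L" by (simp add: ceiling_le_iff nat_le_iff)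
  then show ?thesis by (simp add: word_size_def)
qed

theorem theorem1:
  shows "\<exists>(P :: instr list) (cw :: nat) (ct :: real) (cs :: real).
    \<forall>x :: nat. x \<ge> 3 \<longrightarrow>
      (\<exists>t s. run (word_size cw x) P t (init_state x) = Some s \<and> halted s \<and>
         real t \<le> ct * real x * ln (ln (real x)) \<and>
         real (space_bits (word_size cw x) P s) \<le> cs * sqrt (real x) / ln (ln (real x)) \<and>
         outputs_factorizations x (out s))"
proof -
  define P where "P = compile 0 main_prog @ [Halt]"
  define r where "r = num_regs P"
  \<comment> \<open>The least value of \<open>ln (ln x)\<close>. As it is positive, the additive 5
    in \<open>l_le_lnln\<close> is at most \<open>5 / c0\<close> times
    \<open>ln (ln x)\<close>.\<close>
  define c0 where "c0 = ln (ln (3::real))"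
  have c0: "c0 > 0" using one_less_ln_3 by (simp add: c0_def)
  show ?thesis
  proof (rule exI[of _ P], rule exI[of _ 8], rule exI[of _ "15000 * (5 / c0 + 2)"],
      rule exI[of _ "real (8 * (16 * r + 500))"], intro allI impI)
    fix x :: nat
    assume x3: "x \<ge> 3"
    obtain y where y: "y * y \<le> x" and y2: "x < (y + 1) * (y + 1)" using ex_sqrt_bracket by blast
    obtain L where L: "2 ^ (L - 1) \<le> x" "x < 2 ^ L" using ex_power2_bracket[of x] x3 by auto
    have "L \<noteq> 0" using L x3 by (intro notI) simp
    then obtain l where l: "2 ^ (l - 1) \<le> L" "L < 2 ^ l" using ex_power2_bracket[of L] by auto
    define w where "w = word_size 8 x"
    interpret sieve w x y L l
      by unfold_locales (use x3 y y2 L l word_size_bound[OF x3] in \<open>auto simp: w_def\<close>)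
    define lnln where "lnln = ln (ln (real x))"
    have "ln 3 \<le> ln (real x)" using x3 by (subst ln_le_cancel_iff) auto
    then have lnln: "c0 \<le> lnln" unfolding c0_def lnln_def using one_less_ln_3 by (subst ln_le_cancel_iff) auto
    have l_le: "real l \<le> (5 / c0 + 2) * lnln"
    proof -
      have "5 = 5 / c0 * c0" using c0 by simp
      also have "\<dots> \<le> 5 / c0 * lnln" using lnln c0 by (intro mult_left_mono) auto
      finally show ?thesis using l_le_lnln unfolding lnln_def[symmetric] by (simp add: distrib_right)
    qed
    have "wp w main_prog (\<lambda>R M os U T. real (T + 1) \<le> 15000 * (real x * real l) \<and>
        l * (L * (r + U)) \<le> (16 * r + 500) * y \<and> outputs_factorizations x os)
        ((\<lambda>_. 0)(0 := int x)) (\<lambda>_. 0) [] 0 0"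
      by (rule wp_main, simp, intro conjI, erule (5) time_le, erule (4) space_le, rule outputs)
    from wp_halt[OF this] obtain t s where ts: "run w P t (init_state x) = Some s" "halted s"
      "real (t - 1 + 1) \<le> 15000 * (real x * real l)" "l * (L * (r + mem_used s)) \<le> (16 * r + 500) * y"
      "outputs_factorizations x (out s)"
      unfolding P_def by blast
    show "\<exists>t s. run (word_size 8 x) P t (init_state x) = Some s \<and> halted s \<and>
         real t \<le> 15000 * (5 / c0 + 2) * real x * ln (ln (real x)) \<and>
         real (space_bits (word_size 8 x) P s) \<le> real (8 * (16 * r + 500)) * sqrt (real x) / ln (ln (real x)) \<and>
         outputs_factorizations x (out s)"
    proof (intro exI conjI)
      show "run (word_size 8 x) P t (init_state x) = Some s" using ts(1) by (simp add: w_def)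
      have "real t \<le> real (t - 1 + 1)" by simp
      also have "\<dots> \<le> 15000 * (real x * real l)" by (rule ts(3))
      also have "\<dots> \<le> 15000 * (real x * ((5 / c0 + 2) * lnln))" by (intro mult_left_mono l_le) auto
      finally show "real t \<le> 15000 * (5 / c0 + 2) * real x * ln (ln (real x))"
        by (simp add: lnln_def mult_ac)
      have "l * space_bits w P s \<le> l * (8 * L * (r + mem_used s))"
        unfolding space_bits_def r_def[symmetric]
        using word_size_le[OF x3 L(2)] by (intro mult_le_mono2 mult_le_mono1) (simp add: w_def)
      also have "\<dots> = 8 * (l * (L * (r + mem_used s)))" by (simp only: mult_ac)
      also have "\<dots> \<le> 8 * ((16 * r + 500) * y)" using ts(4) by (rule mult_le_mono2)
      also have "\<dots> = 8 * (16 * r + 500) * y" by (simp only: mult.assoc)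
      finally have "real (l * space_bits w P s) \<le> real (8 * (16 * r + 500) * y)" by (simp only: of_nat_le_iff)
      also have "\<dots> = real (8 * (16 * r + 500)) * real y" by (rule of_nat_mult)
      also have "real y \<le> sqrt (real x)"
        using y by (intro real_le_rsqrt) (metis of_nat_le_iff of_nat_mult power2_eq_square)
      finally have "real l * real (space_bits w P s) \<le> real (8 * (16 * r + 500)) * sqrt (real x)"
        by (simp add: mult_left_mono)
      moreover have "lnln * real (space_bits w P s) \<le> real l * real (space_bits w P s)"
        using lnln_le_l by (intro mult_right_mono) (auto simp: lnln_def)
      ultimately have "lnln * real (space_bits w P s) \<le> real (8 * (16 * r + 500)) * sqrt (real x)" by linarith
      then show "real (space_bits (word_size 8 x) P s) \<le> real (8 * (16 * r + 500)) * sqrt (real x) / ln (ln (real x))"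
        using lnln c0 unfolding lnln_def[symmetric] w_def by (simp add: pos_le_divide_eq mult.commute)
    qed (use ts in auto)
  qed
qed

end
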